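(* Let $f:\,]0,1]\to\,]0,1]$ be a monotonically increasing function with $\lim_{\lambda\to0}f(\lambda)=0$ and $f(1)=1$, such that for every $0<a<\infty$ $$F(a):=\liminf_{\lambda\to0}\frac{f(\lambda a)}{f(\lambda)}>0 .$$ Let $g:\,]0,1[\,\to\,]0,\infty[$ be a function. Let a pair $v$ and $q$ be a suitable weak solution to the Navier-Stokes equations in $Q$ such that $$M_1:=\sup_{0<r<1}\{A_f(v,r)+E_f(v,r)+D_f(q,r)\}<\infty .$$ Let $s>1$ and $l>1$ be numbers satisfying $$l>\kappa:=l\Big(\frac 3s+\frac 2l-1\Big)>0,$$ and assume that for some parameter $0\le\eta\le1$ $$s<p(\eta),\qquad l<q(\eta),$$ where $\frac1{p(\eta)}=\frac\eta6+\frac{3(1-\eta)}{10}$ and $\frac1{q(\eta)}=\frac\eta2+\frac{3(1-\eta)}{10}$. Suppose also that $$\big(f(\lambda)\big)^{\frac l2(1+\frac 3s)-\frac 32(1-\frac s{p(\eta)})\frac ls}\,\Big(g\big(\lambda\sqrt{f(\lambda)}\big)\Big)^{-1}\to\infty\qquad\text{as }\lambda\to0 .$$ Then $$\lim_{r\to0}g(r)\,M^{s,l}_\kappa(v,r)=0 .$$ In other words, there do not exist a number $\varepsilon_0>0$ and a sequence $r_k\downarrow0$ such that $g(r_k)M^{s,l}_\kappa(v,r_k)\ge\varepsilon_0$ for all natural $k$.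
   Context: Notation: $B(r)\subset\mathbb R^3$ is the ball of radius $r$ centred at the origin, $B=B(1)$, $Q(r)=B(r)\times]-r^2,0[$, $Q=Q(1)$, $z=(x,t)$. Suitable weak solution: a pair $v$ (an $\mathbb R^3$-valued velocity) and $q$ (scalar pressure) is a suitable weak solution to the Navier-Stokes equations in $Q$ if (1) $v\in L_\infty(-1,0;L_2(B))$, $\nabla v\in L_2(Q)$, $q\in L_{3/2}(Q)$; (2) $\partial_tv+v\cdot\nabla v-\Delta v+\nabla q=0$ and $\mathrm{div}\,v=0$ in $Q$ in the sense of distributions; (3) for a.a. $t\in]-1,0[$, the local energy inequality $$\int_B\varphi(x,t)|v(x,t)|^2dx+2\int_{-1}^t\int_B\varphi|\nabla v|^2dx\,d\tau\le\int_{-1}^t\int_B\big(|v|^2(\partial_t\varphi+\Delta\varphi)+v\cdot\nabla\varphi(|v|^2+2q)\big)dx\,d\tau$$ holds for all smooth non-negative functions $\varphi$ vanishing in a neighbourhood of the parabolic boundary of $Q$. Quantities (for $0<r<1$): $$A_f(v,r)=\sup_{-r^2<t<0}\frac{f^2(r)}r\int_{B(r)}|v(x,t)|^2dx,\qquad E_f(v,r)=\frac{f(r)}r\int_{Q(r)}|\nabla v|^2dz,$$ $$D_f(q,r)=\frac{f^2(r)}{r^2}\int_{Q(r)}|q|^{3/2}dz,\qquad M^{s,l}_\kappa(v,r)=\frac1{r^\kappa}\int_{-r^2}^0\Big(\int_{B(r)}|v|^sdx\Big)^{l/s}dt,$$ where the supremum in time is understood as an essential supremum. The symbol $q$ denotes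 the pressure, whereas $q(\eta)$ is the number defined in the statement.
   Formalization: The function f is additionally assumed continuous on ]0,1]; without this the claim fails, e.g. for a step function f and constant v, q=0, since the growth condition says nothing about g at radii r not of the form λ√f(λ). *)

theory Defs
  imports "HOL-Analysis.Analysis" "HOL-Probability.Essential_Supremum"
begin

type_synonym space = "real ^ 3"
type_synonym spacetime = "space \<times> real"

definition Qcyl :: "real \<Rightarrow> spacetime set" where
  "Qcyl r = ball 0 r \<times> {- (r^2) <..< 0}"

section \<open>Smooth functions and test functions\<close>

text \<open>\<open>Ck_on k\<close>: all iterated directional derivatives of order at most \<open>k\<close> exist and are
  continuous, and those of order less than \<open>k\<close> are (Frechet) differentiable.
  The notion is meant for open sets.\<close>

fun Ck_on :: "nat \<Rightarrow> 'a::real_normed_vector set \<Rightarrow> ('a \<Rightarrow> 'b::real_normed_vector) \<Rightarrow> bool" where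
  "Ck_on 0 S u \<longleftrightarrow> continuous_on S u"
| "Ck_on (Suc k) S u \<longleftrightarrow> continuous_on S u \<and> (\<forall>z\<in>S. u differentiable (at z)) \<and>
     (\<forall>d. Ck_on k S (\<lambda>z. frechet_derivative u (at z) d))"

definition smooth_on :: "'a::real_normed_vector set \<Rightarrow> ('a \<Rightarrow> 'b::real_normed_vector) \<Rightarrow> bool" where
  "smooth_on S u \<longleftrightarrow> (\<forall>k. Ck_on k S u)"

definition test_function :: "spacetime set \<Rightarrow> (spacetime \<Rightarrow> 'b::real_normed_vector) \<Rightarrow> bool" where
  "test_function \<Omega> \<phi> \<longleftrightarrow> smooth_on UNIV \<phi> \<and>
     compact (closure {z. \<phi> z \<noteq> 0}) \<and> closure {z. \<phi> z \<noteq> 0} \<subseteq> \<Omega>"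

text \<open>Classical partial derivatives; they are only applied to smooth functions.\<close>

definition dx :: "3 \<Rightarrow> (spacetime \<Rightarrow> 'b::real_normed_vector) \<Rightarrow> spacetime \<Rightarrow> 'b" where
  "dx i u z = frechet_derivative u (at z) (axis i 1, 0)"

definition dt :: "(spacetime \<Rightarrow> 'b::real_normed_vector) \<Rightarrow> spacetime \<Rightarrow> 'b" where
  "dt u z = frechet_derivative u (at z) (0, 1)"

definition grad_x :: "(spacetime \<Rightarrow> real) \<Rightarrow> spacetime \<Rightarrow> space" where
  "grad_x u z = (\<chi> i. dx i u z)"

definition div_x :: "(spacetime \<Rightarrow> space) \<Rightarrow> spacetime \<Rightarrow> real" where
  "div_x u z = (\<Sum>i\<in>UNIV. dx i u z $ i)"

definition laplace_x :: "(spacetime \<Rightarrow> 'b::real_normed_vector) \<Rightarrow> spacetime \<Rightarrow> 'b" where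
  "laplace_x u z = (\<Sum>i\<in>UNIV. dx i (dx i u) z)"

section \<open>Function spaces and the weak spatial gradient\<close>

text \<open>\<open>mem_Lp\<close> is the space $L_p(\Omega)$, for finite exponents.\<close>

definition mem_Lp :: "real \<Rightarrow> spacetime set \<Rightarrow> (spacetime \<Rightarrow> 'b::euclidean_space) \<Rightarrow> bool" where
  "mem_Lp p \<Omega> u \<longleftrightarrow> u \<in> borel_measurable (lebesgue_on \<Omega>) \<and>
     (\<integral>\<^sup>+ z\<in>\<Omega>. ennreal (norm (u z) powr p) \<partial>lebesgue) < \<infinity>"

definition mem_Linf_L2 :: "(spacetime \<Rightarrow> 'b::euclidean_space) \<Rightarrow> bool" where
  "mem_Linf_L2 u \<longleftrightarrow> u \<in> borel_measurable (lebesgue_on (Qcyl 1)) \<and>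
     esssup (lebesgue_on {-1<..<0})
       (\<lambda>t. \<integral>\<^sup>+ x\<in>ball 0 1. ennreal (norm (u (x, t)) ^ 2) \<partial>lebesgue) < \<infinity>"

definition locally_integrable :: "spacetime set \<Rightarrow> (spacetime \<Rightarrow> 'b::euclidean_space) \<Rightarrow> bool" where
  "locally_integrable \<Omega> u \<longleftrightarrow> (\<forall>K. compact K \<and> K \<subseteq> \<Omega> \<longrightarrow> set_integrable lebesgue K u)"

text \<open>The entry \<open>G z $ i $ j\<close> is the distributional derivative of the \<open>i\<close>-th component of \<open>v\<close>
  in the direction \<open>x\<^sub>j\<close>, so that \<open>G z *v v z\<close> is $v\cdot\nabla v$, and the norm of \<open>G z\<close> is the
  Frobenius norm of the matrix.\<close>

definition has_weak_gradient ::
  "spacetime set \<Rightarrow> (spacetime \<Rightarrow> space) \<Rightarrow> (spacetime \<Rightarrow> real ^ 3 ^ 3) \<Rightarrow> bool" where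
  "has_weak_gradient \<Omega> v G \<longleftrightarrow> locally_integrable \<Omega> v \<and> locally_integrable \<Omega> G \<and>
     (\<forall>\<psi> :: spacetime \<Rightarrow> real. test_function \<Omega> \<psi> \<longrightarrow> (\<forall>i j.
        (LINT z:\<Omega>|lebesgue. v z $ i * dx j \<psi> z) = - (LINT z:\<Omega>|lebesgue. G z $ i $ j * \<psi> z)))"

text \<open>The weak gradient on the unit cylinder; it is determined almost everywhere there, and it is
  only used for \<open>v\<close> that have one.\<close>

definition nabla :: "(spacetime \<Rightarrow> space) \<Rightarrow> spacetime \<Rightarrow> real ^ 3 ^ 3" where
  "nabla v = (SOME G. has_weak_gradient (Qcyl 1) v G)"

section \<open>Suitable weak solutions\<close>

text \<open>The momentum equation and the incompressibility condition, tested against smooth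
  functions compactly supported in the open cylinder.\<close>

definition momentum_equation :: "(spacetime \<Rightarrow> space) \<Rightarrow> (spacetime \<Rightarrow> real) \<Rightarrow> bool" where
  "momentum_equation v q \<longleftrightarrow>
     (\<forall>\<phi> :: spacetime \<Rightarrow> space. test_function (Qcyl 1) \<phi> \<longrightarrow>
        (LINT z:Qcyl 1|lebesgue.
           - (v z \<bullet> dt \<phi> z) + (nabla v z *v v z) \<bullet> \<phi> z - v z \<bullet> laplace_x \<phi> z
           - q z * div_x \<phi> z) = 0)"

definition divergence_free :: "(spacetime \<Rightarrow> space) \<Rightarrow> bool" where
  "divergence_free v \<longleftrightarrow>
     (\<forall>\<psi> :: spacetime \<Rightarrow> real. test_function (Qcyl 1) \<psi> \<longrightarrow>
        (LINT z:Qcyl 1|lebesgue. v z \<bullet> grad_x \<psi> z) = 0)"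

definition parabolic_boundary :: "spacetime set" where
  "parabolic_boundary = cball 0 1 \<times> {-1} \<union> sphere 0 1 \<times> {-1..0}"

definition energy_test_function :: "(spacetime \<Rightarrow> real) \<Rightarrow> bool" where
  "energy_test_function \<phi> \<longleftrightarrow> smooth_on UNIV \<phi> \<and> (\<forall>z\<in>Qcyl 1. 0 \<le> \<phi> z) \<and>
     (\<exists>U. open U \<and> parabolic_boundary \<subseteq> U \<and> (\<forall>z\<in>U \<inter> Qcyl 1. \<phi> z = 0))"

definition local_energy_inequality :: "(spacetime \<Rightarrow> space) \<Rightarrow> (spacetime \<Rightarrow> real) \<Rightarrow> bool" where
  "local_energy_inequality v q \<longleftrightarrow>
     (AE t in lebesgue_on {-1<..<0}. \<forall>\<phi>. energy_test_function \<phi> \<longrightarrow>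
        (LINT x:ball 0 1|lebesgue. \<phi> (x, t) * norm (v (x, t)) ^ 2)
        + 2 * (LINT z:ball 0 1 \<times> {-1<..<t}|lebesgue. \<phi> z * norm (nabla v z) ^ 2)
        \<le> (LINT z:ball 0 1 \<times> {-1<..<t}|lebesgue.
              norm (v z) ^ 2 * (dt \<phi> z + laplace_x \<phi> z)
              + (v z \<bullet> grad_x \<phi> z) * (norm (v z) ^ 2 + 2 * q z)))"

definition suitable_weak_solution :: "(spacetime \<Rightarrow> space) \<Rightarrow> (spacetime \<Rightarrow> real) \<Rightarrow> bool" where
  "suitable_weak_solution v q \<longleftrightarrow>
     mem_Linf_L2 v \<and>
     (\<exists>G. has_weak_gradient (Qcyl 1) v G) \<and> mem_Lp 2 (Qcyl 1) (nabla v) \<and>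
     mem_Lp (3/2) (Qcyl 1) q \<and>
     momentum_equation v q \<and> divergence_free v \<and>
     local_energy_inequality v q"

section \<open>Scaled quantities\<close>

text \<open>These take values in $[0,\infty]$, so that finiteness is part of the
  hypotheses and of the conclusion instead of being lost in the convention that non-integrable
  functions have integral zero.\<close>

text \<open>Powers with a positive exponent.\<close>

definition epowr :: "ennreal \<Rightarrow> real \<Rightarrow> ennreal" where
  "epowr x a = (if x = \<infinity> then \<infinity> else ennreal (enn2real x powr a))"

definition A_f :: "(real \<Rightarrow> real) \<Rightarrow> (spacetime \<Rightarrow> space) \<Rightarrow> real \<Rightarrow> ennreal" where
  "A_f f v r = esssup (lebesgue_on {- (r^2) <..< 0})
     (\<lambda>t. ennreal (f r ^ 2 / r) *
        (\<integral>\<^sup>+ x\<in>ball 0 r. ennreal (norm (v (x, t)) ^ 2) \<partial>lebesgue))"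

definition E_f :: "(real \<Rightarrow> real) \<Rightarrow> (spacetime \<Rightarrow> space) \<Rightarrow> real \<Rightarrow> ennreal" where
  "E_f f v r = ennreal (f r / r) *
     (\<integral>\<^sup>+ z\<in>Qcyl r. ennreal (norm (nabla v z) ^ 2) \<partial>lebesgue)"

definition D_f :: "(real \<Rightarrow> real) \<Rightarrow> (spacetime \<Rightarrow> real) \<Rightarrow> real \<Rightarrow> ennreal" where
  "D_f f q r = ennreal (f r ^ 2 / r ^ 2) *
     (\<integral>\<^sup>+ z\<in>Qcyl r. ennreal (\<bar>q z\<bar> powr (3/2)) \<partial>lebesgue)"

definition M_mixed :: "real \<Rightarrow> real \<Rightarrow> real \<Rightarrow> (spacetime \<Rightarrow> space) \<Rightarrow> real \<Rightarrow> ennreal" where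
  "M_mixed s l \<kappa> v r = ennreal (1 / r powr \<kappa>) *
     (\<integral>\<^sup>+ t\<in>{- (r^2) <..< 0}.
        epowr (\<integral>\<^sup>+ x\<in>ball 0 r. ennreal (norm (v (x, t)) powr s) \<partial>lebesgue) (l / s) \<partial>lebesgue)"

definition p_exp :: "real \<Rightarrow> real" where
  "p_exp \<eta> = 1 / (\<eta> / 6 + 3 * (1 - \<eta>) / 10)"

definition q_exp :: "real \<Rightarrow> real" where
  "q_exp \<eta> = 1 / (\<eta> / 2 + 3 * (1 - \<eta>) / 10)"

end

theory Submission
  imports Defs
begin

text \<open>The limit follows from a quantitative bound. Every small \<open>r\<close> is \<open>\<lambda> * sqrt (f \<lambda>)\<close> for some \<open>\<lambda>\<close>,
  and the rescaled velocity $\lambda f(\lambda)\, v(\lambda y, \lambda^2 f(\lambda) \tau)$ is bounded by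
  $M_1$ alone in $L_\infty L_2 \cap L_2 W^1_2$ of a fixed cylinder. The Sobolev embedding puts it into
  $L_2 L_6$, and interpolation with $L_\infty L_2$ into $L_{q(\eta)} L_{p(\eta)}$. In these coordinates
  \<open>ball 0 r\<close> becomes the ball of radius $\sqrt{f(\lambda)}$, whose volume enters through
  Hoelder's inequality because $s < p(\eta)$. Altogether
  $M^{s,l}_\kappa(v, r) \le C f(\lambda)^{-e}$, where $e$ is the exponent in the growth hypothesis.\<close>

section \<open>Smooth cutoff functions\<close>

text \<open>The parameter \<eta> only selects a point on the interpolation line between
  L_\<infinity> L_2 and L_2 L_6: with \<theta> = \<eta> + 3 (1 - \<eta>) / 5 one has 1/p(\<eta>) =
  1/2 - \<theta>/3 and 1/q(\<eta>) = \<theta>/2. So s < p(\<eta>) leaves a positive power of the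
  ball volume, and l < q(\<eta>) permits Hoelder's inequality in time. The rescaling itself is never
  carried out: the estimates live on \<open>ball 0 L \<times> {- (r^2)<..<0}\<close> with r = L
  sqrt(F), F = f(L). Its duration L^2 F is what makes the lower-order term of the local Sobolev
  inequality, r^2 / L^2 times the A-bound, exactly as large as the gradient term M L / F. The
  analytic obstacle is that only a distributional gradient in space-time is given, tested with
  smooth functions compactly supported in the open cylinder. Cutoffs must therefore be smooth and
  vanish near both ends of the time interval, and yet exhaust that interval. Their steep time slopes
  do no harm, because only their spatial derivatives enter. All mollifiers and cutoffs are built
  from exp(-1/x).\<close>

definition bexp :: "real poly \<Rightarrow> real \<Rightarrow> real" where
  "bexp p x = (if 0 < x then poly p (1 / x) * exp (- (1 / x)) else 0)"

lemma poly_exp_tendsto_0: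
  fixes p :: "real poly"
  shows "((\<lambda>y. poly p y * exp (- y)) \<longlongrightarrow> 0) at_top"
proof -
  have "((\<lambda>y. \<Sum>i\<le>degree p. coeff p i * (y ^ i / exp y)) \<longlongrightarrow> (\<Sum>i\<le>degree p. coeff p i * 0)) at_top"
    by (intro tendsto_sum tendsto_mult tendsto_const tendsto_power_div_exp_0)
  moreover have "(\<lambda>y. \<Sum>i\<le>degree p. coeff p i * (y ^ i / exp y)) = (\<lambda>y. poly p y * exp (- y))"
    by (simp add: poly_altdef exp_minus divide_inverse sum_distrib_right mult.assoc)
  ultimately show ?thesis by simp
qed

lemma bexp_tendsto_0: "(bexp p \<longlongrightarrow> 0) (at 0)"
proof -
  have "((\<lambda>x. poly p (1 / x) * exp (- (1 / x))) \<longlongrightarrow> 0) (at_right 0)"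
    using filterlim_compose[OF poly_exp_tendsto_0[of p] filterlim_inverse_at_top_right]
    by (simp add: inverse_eq_divide)
  then have "(bexp p \<longlongrightarrow> 0) (at_right 0)"
    by (rule Lim_transform_eventually)
       (auto simp: bexp_def eventually_at_right_less intro: eventually_at_rightI[of 0 1])
  moreover have "(bexp p \<longlongrightarrow> 0) (at_left 0)"
    by (rule tendsto_eventually) (auto simp: bexp_def eventually_at_filter)
  ultimately show ?thesis by (simp add: filterlim_split_at_real)
qed

text \<open>With y = 1/x, the derivative of p(y) exp(-y) in x is y^2 (p - p')(y) exp(-y). The
  arbitrary polynomial factor makes the family closed under differentiation, so a single first-order
  lemma gives smoothness of every order.\<close>

definition bexp_deriv :: "real poly \<Rightarrow> real poly" where
  "bexp_deriv p = [:0, 0, 1:] * (p - pderiv p)"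

lemma bexp_has_real_derivative: "(bexp p has_real_derivative bexp (bexp_deriv p) x) (at x)"
proof -
  consider "x > 0" | "x < 0" | "x = 0" by linarith
  then show ?thesis
  proof cases
    case 1
    define y where "y = 1 / x"
    have y: "((\<lambda>x. 1 / x) has_real_derivative - y\<^sup>2) (at x)"
      using 1 by (auto intro!: derivative_eq_intros simp: y_def power2_eq_square)
    have "((\<lambda>x. poly p (1 / x) * exp (- (1 / x))) has_real_derivative
        poly p y * (exp (- y) * y\<^sup>2) + poly (pderiv p) y * - y\<^sup>2 * exp (- y)) (at x)"
      using DERIV_mult[OF DERIV_chain2[OF poly_DERIV y] DERIV_chain2[OF DERIV_exp DERIV_minus[OF y]]]
      by (simp add: y_def ac_simps)
    also have "poly p y * (exp (- y) * y\<^sup>2) + poly (pderiv p) y * - y\<^sup>2 * exp (- y) = bexp (bexp_deriv p) x"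
      using 1 by (simp add: bexp_def bexp_deriv_def y_def algebra_simps power2_eq_square)
    finally have "((\<lambda>x. poly p (1 / x) * exp (- (1 / x))) has_real_derivative bexp (bexp_deriv p) x) (at x)" .
    then show ?thesis
      by (rule has_field_derivative_transform_within_open[where S="{0<..}"])
         (use 1 in \<open>auto simp: bexp_def\<close>)
  next
    case 2
    have "((\<lambda>x. 0) has_real_derivative bexp (bexp_deriv p) x) (at x)"
      using 2 by (auto simp: bexp_def)
    then show ?thesis
      by (rule has_field_derivative_transform_within_open[where S="{..<0}"])
         (use 2 in \<open>auto simp: bexp_def\<close>)
  next
    case 3
    \<comment> \<open>The difference quotient at 0 is again a member of the family: dividing by h
      multiplies the polynomial by y = 1/h. For h \<le> 0 both sides are 0, including h = 0 with its
      division by zero.\<close>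
    have "(\<lambda>h. (bexp p (0 + h) - bexp p 0) / h) = bexp (pCons 0 p)"
      by (auto simp: bexp_def)
    then show ?thesis
      using bexp_tendsto_0[of "pCons 0 p"] 3 by (simp add: DERIV_def bexp_def)
  qed
qed

text \<open>A class of smooth functions that is closed under directional derivatives by construction,
  which makes membership in every \<open>Ck_on k UNIV\<close> an easy induction.\<close>

inductive smooth_elem :: "('a::real_normed_vector \<Rightarrow> real) \<Rightarrow> bool" where
  bexp: "bounded_linear h \<Longrightarrow> smooth_elem (\<lambda>z. bexp p (h z + c))"
| const: "smooth_elem (\<lambda>z. c)"
| add: "smooth_elem u \<Longrightarrow> smooth_elem w \<Longrightarrow> smooth_elem (\<lambda>z. u z + w z)"
| mult: "smooth_elem u \<Longrightarrow> smooth_elem w \<Longrightarrow> smooth_elem (\<lambda>z. u z * w z)"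

lemma smooth_elem_prod:
  "finite I \<Longrightarrow> (\<And>i. i \<in> I \<Longrightarrow> smooth_elem (u i)) \<Longrightarrow> smooth_elem (\<lambda>z. \<Prod>i\<in>I. u i z)"
  by (induction rule: finite_induct) (auto intro: smooth_elem.intros)

text \<open>With c = -1 this yields the reflected mollifier \<open>k (z - w)\<close> as a function
  of w, which is the test function that identifies the gradient of a mollification.\<close>

lemma smooth_elem_affine:
  "smooth_elem u \<Longrightarrow> smooth_elem (\<lambda>z. u (a + c *\<^sub>R z))"
proof (induction rule: smooth_elem.induct)
  case (bexp h p d)
  interpret bounded_linear h by fact
  have "(\<lambda>z. bexp p (h (a + c *\<^sub>R z) + d)) = (\<lambda>z. bexp p (c * h z + (h a + d)))"
    by (simp add: add scaleR algebra_simps)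
  moreover have "bounded_linear (\<lambda>z. c * h z)"
    using bexp bounded_linear_const_mult by blast
  ultimately show ?case using smooth_elem.bexp by metis
qed (auto intro: smooth_elem.intros)

lemma smooth_elem_has_derivative:
  assumes "smooth_elem u"
  shows "\<exists>D. (\<forall>z. (u has_derivative D z) (at z)) \<and> (\<forall>d. smooth_elem (\<lambda>z. D z d))"
  using assms
proof (induction rule: smooth_elem.induct)
  case (bexp h p c)
  have "((\<lambda>z. bexp p (h z + c)) has_derivative (\<lambda>d. bexp (bexp_deriv p) (h z + c) * h d)) (at z)" for z
  proof -
    have "((\<lambda>z. h z + c) has_derivative h) (at z)"
      using bexp by (auto intro!: derivative_eq_intros bounded_linear_imp_has_derivative)
    from has_derivative_compose[OF this bexp_has_real_derivative[THEN has_field_derivative_imp_has_derivative]]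
    show ?thesis by simp
  qed
  then show ?case
    by (intro exI[of _ "\<lambda>z d. bexp (bexp_deriv p) (h z + c) * h d"])
       (auto intro!: smooth_elem.intros bexp)
next
  case (const c)
  show ?case by (intro exI[of _ "\<lambda>z d. 0"]) (auto intro: smooth_elem.intros)
next
  case (add u w)
  then obtain D E where "\<And>z. (u has_derivative D z) (at z)" "\<And>d. smooth_elem (\<lambda>z. D z d)"
    "\<And>z. (w has_derivative E z) (at z)" "\<And>d. smooth_elem (\<lambda>z. E z d)" by metis
  then show ?case
    by (intro exI[of _ "\<lambda>z d. D z d + E z d"])
       (auto intro!: smooth_elem.intros has_derivative_add)
next
  case (mult u w)
  then obtain D E where "\<And>z. (u has_derivative D z) (at z)" "\<And>d. smooth_elem (\<lambda>z. D z d)"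
    "\<And>z. (w has_derivative E z) (at z)" "\<And>d. smooth_elem (\<lambda>z. E z d)" by metis
  then show ?case using mult
    by (intro exI[of _ "\<lambda>z d. u z * E z d + D z d * w z"])
       (auto intro!: smooth_elem.intros has_derivative_mult)
qed

lemma smooth_elem_frechet:
  assumes "smooth_elem u"
  shows "(u has_derivative frechet_derivative u (at z)) (at z)"
    and "smooth_elem (\<lambda>z. frechet_derivative u (at z) d)"
proof -
  obtain D where D: "\<And>z. (u has_derivative D z) (at z)" "\<And>d. smooth_elem (\<lambda>z. D z d)"
    using smooth_elem_has_derivative[OF assms] by metis
  have "D = (\<lambda>z. frechet_derivative u (at z))"
    using frechet_derivative_at[OF D(1)] by auto
  with D show "(u has_derivative frechet_derivative u (at z)) (at z)"
    "smooth_elem (\<lambda>z. frechet_derivative u (at z) d)" by auto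
qed

lemma smooth_elem_continuous: "smooth_elem u \<Longrightarrow> continuous_on A u"
  by (rule has_derivative_continuous_on[OF has_derivative_at_withinI[OF smooth_elem_frechet(1)]])

lemma smooth_elem_smooth_on:
  assumes "smooth_elem u"
  shows "smooth_on UNIV u"
proof -
  have "Ck_on k UNIV u" for k
    using assms
  proof (induction k arbitrary: u)
    case (Suc k)
    then show ?case
      using smooth_elem_frechet[of u] smooth_elem_continuous[of u]
      by (auto simp: differentiable_def)
  qed (simp add: smooth_elem_continuous)
  then show ?thesis by (simp add: smooth_on_def)
qed

lemma smooth_elem_test_function:
  assumes "smooth_elem u" "compact K" "K \<subseteq> \<Omega>" "\<And>z. z \<notin> K \<Longrightarrow> u z = 0"
  shows "test_function \<Omega> u"
proof -
  have sub: "{z. u z \<noteq> 0} \<subseteq> K" using assms(4) by auto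
  then have "closure {z. u z \<noteq> 0} \<subseteq> K" "bounded {z. u z \<noteq> 0}"
    using assms(2) compact_imp_bounded bounded_subset
    by (auto simp: closure_minimal compact_imp_closed)
  then show ?thesis
    using assms(3) smooth_elem_smooth_on[OF assms(1)] by (auto simp: test_function_def)
qed

text \<open>For |y| < 1 this is exp(-2 / (1 - y^2)). The product form keeps it inside
  \<open>smooth_elem\<close>, which admits affine arguments and products but no composition with
  y^2.\<close>

definition hat :: "real \<Rightarrow> real" where
  "hat y = bexp 1 (1 - y) * bexp 1 (1 + y)"

definition hat_deriv :: "real \<Rightarrow> real" where
  "hat_deriv y = bexp 1 (1 - y) * bexp (bexp_deriv 1) (1 + y)
     - bexp (bexp_deriv 1) (1 - y) * bexp 1 (1 + y)"

lemma bexp_one: "0 \<le> bexp 1 x" "bexp 1 x \<le> 1" "x \<le> 0 \<Longrightarrow> bexp p x = 0" "0 < x \<Longrightarrow> 0 < bexp 1 x"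
  by (auto simp: bexp_def)

text \<open>Here \<open>bexp_deriv 1\<close> is the polynomial y^2, and y^2 exp(-y) \<le> 2 follows
  from exp(y) \<ge> y^2 / 2.\<close>

lemma bexp_deriv_one: "\<bar>bexp (bexp_deriv 1) x\<bar> \<le> 2"
proof (cases "x > 0")
  case True
  define y where "y = 1 / x"
  have "y > 0" using True by (simp add: y_def)
  have "1 + y + y\<^sup>2 / 2 \<le> exp y" using \<open>y > 0\<close> exp_lower_Taylor_quadratic by simp
  then have "y\<^sup>2 \<le> 2 * exp y" using \<open>y > 0\<close> by linarith
  then have "y\<^sup>2 * exp (- y) \<le> 2" by (simp add: exp_minus field_simps)
  then show ?thesis using True
    by (simp add: bexp_def bexp_deriv_def y_def power2_eq_square)
qed (simp add: bexp_def)

lemma hat_simps: "0 \<le> hat y" "hat y \<le> 1" "\<bar>y\<bar> < 1 \<Longrightarrow> 0 < hat y" "\<bar>y\<bar> \<ge> 1 \<Longrightarrow> hat y = 0"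
  "\<bar>y\<bar> \<le> 1 / 2 \<Longrightarrow> exp (- 4) \<le> hat y"
proof -
  show "0 \<le> hat y" "hat y \<le> 1" "\<bar>y\<bar> < 1 \<Longrightarrow> 0 < hat y"
    using bexp_one[of "1 - y"] bexp_one[of "1 + y"] by (auto simp: hat_def mult_le_one)
  show "\<bar>y\<bar> \<ge> 1 \<Longrightarrow> hat y = 0" by (auto simp: hat_def bexp_def)
  have "exp (- 2) \<le> bexp 1 x" if "x \<ge> 1 / 2" for x
    using that by (auto simp: bexp_def field_simps)
  then show "exp (- 4) \<le> hat y" if "\<bar>y\<bar> \<le> 1 / 2"
    using that mult_mono[of "exp (- 2)" "bexp 1 (1 - y)" "exp (- 2)" "bexp 1 (1 + y)"]
    by (auto simp: hat_def bexp_one simp flip: exp_add)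
qed

lemma hat_has_real_derivative: "(hat has_real_derivative hat_deriv y) (at y)"
  unfolding hat_def hat_deriv_def
  by (auto intro!: derivative_eq_intros DERIV_chain2[OF bexp_has_real_derivative])

lemma hat_deriv_bound: "\<bar>hat_deriv y\<bar> \<le> 4"
proof -
  have "\<bar>bexp 1 (1 - y) * bexp (bexp_deriv 1) (1 + y)\<bar> \<le> 1 * 2"
    "\<bar>bexp (bexp_deriv 1) (1 - y) * bexp 1 (1 + y)\<bar> \<le> 2 * 1"
    unfolding abs_mult by (intro mult_mono; simp add: bexp_one bexp_deriv_one)+
  then show ?thesis unfolding hat_deriv_def by linarith
qed

lemma smooth_elem_hat:
  assumes "bounded_linear h"
  shows "smooth_elem (\<lambda>z. hat (h z + c))"
proof -
  have "smooth_elem (\<lambda>z. bexp 1 (- h z + (1 - c)) * bexp 1 (h z + (1 + c)))"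
    by (intro smooth_elem.intros bounded_linear_minus assms)
  then show ?thesis by (simp add: hat_def algebra_simps)
qed

section \<open>The Sobolev inequality for smooth functions\<close>

text \<open>Cauchy-Schwarz twice: in (b, c) to split off \<open>f1\<close>, then in a for the
  product of the other two factors. The second bound is a function of b times a function of c, so
  its integral factorises.\<close>

lemma Loomis_Whitney_3:
  fixes f1 f2 f3 :: "real \<times> real \<Rightarrow> ennreal"
  assumes [measurable]: "f1 \<in> borel_measurable borel" "f2 \<in> borel_measurable borel" "f3 \<in> borel_measurable borel"
  shows "(\<integral>\<^sup>+(a, b, c). f1 (b, c) * (f2 (a, c) * f3 (a, b)) \<partial>lborel)\<^sup>2
    \<le> (\<integral>\<^sup>+y. (f1 y)\<^sup>2 \<partial>lborel) * ((\<integral>\<^sup>+y. (f2 y)\<^sup>2 \<partial>lborel) * (\<integral>\<^sup>+y. (f3 y)\<^sup>2 \<partial>lborel))"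
proof -
  define h where "h = (\<lambda>(b, c). \<integral>\<^sup>+a. f2 (a, c) * f3 (a, b) \<partial>lborel)"
  define A2 where "A2 = (\<lambda>c. \<integral>\<^sup>+a. (f2 (a, c))\<^sup>2 \<partial>lborel)"
  define A3 where "A3 = (\<lambda>b. \<integral>\<^sup>+a. (f3 (a, b))\<^sup>2 \<partial>lborel)"
  have [measurable]: "h \<in> borel_measurable borel" unfolding h_def borel_prod[symmetric] by measurable
  have [measurable]: "A2 \<in> borel_measurable borel" "A3 \<in> borel_measurable borel"
    unfolding A2_def A3_def by measurable
  have "(\<integral>\<^sup>+(a, b, c). f1 (b, c) * (f2 (a, c) * f3 (a, b)) \<partial>lborel)
      = (\<integral>\<^sup>+y. \<integral>\<^sup>+a. f1 y * (f2 (a, snd y) * f3 (a, fst y)) \<partial>lborel \<partial>lborel)"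
    unfolding lborel_prod[symmetric, where 'b="real \<times> real"]
    by (subst lborel_pair.nn_integral_snd[symmetric]) (auto simp: split_beta lborel_prod borel_prod[symmetric])
  also have "\<dots> = (\<integral>\<^sup>+y. f1 y * h y \<partial>lborel)"
    by (auto simp: h_def split_beta intro!: nn_integral_cong nn_integral_cmult)
  finally have "(\<integral>\<^sup>+(a, b, c). f1 (b, c) * (f2 (a, c) * f3 (a, b)) \<partial>lborel)\<^sup>2
      \<le> (\<integral>\<^sup>+y. (f1 y)\<^sup>2 \<partial>lborel) * (\<integral>\<^sup>+y. (h y)\<^sup>2 \<partial>lborel)"
    by (simp add: Cauchy_Schwarz_nn_integral)
  also have "(\<integral>\<^sup>+y. (h y)\<^sup>2 \<partial>lborel) \<le> (\<integral>\<^sup>+y. A3 (fst y) * A2 (snd y) \<partial>lborel)"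
  proof (rule nn_integral_mono)
    fix y
    show "(h y)\<^sup>2 \<le> A3 (fst y) * A2 (snd y)"
      using Cauchy_Schwarz_nn_integral[of "\<lambda>a. f2 (a, snd y)" lborel "\<lambda>a. f3 (a, fst y)"]
      by (simp add: h_def A2_def A3_def split_beta mult.commute)
  qed
  also have "(\<integral>\<^sup>+y. A3 (fst y) * A2 (snd y) \<partial>lborel) = (\<integral>\<^sup>+b. A3 b \<partial>lborel) * (\<integral>\<^sup>+c. A2 c \<partial>lborel)"
    unfolding lborel_prod[symmetric]
    by (subst lborel.nn_integral_fst[symmetric]) (auto simp: nn_integral_cmult nn_integral_multc)
  also have "(\<integral>\<^sup>+b. A3 b \<partial>lborel) = (\<integral>\<^sup>+y. (f3 y)\<^sup>2 \<partial>lborel)"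
    unfolding A3_def lborel_prod[symmetric] by (subst lborel_pair.nn_integral_snd) (auto simp: lborel_prod)
  also have "(\<integral>\<^sup>+c. A2 c \<partial>lborel) = (\<integral>\<^sup>+y. (f2 y)\<^sup>2 \<partial>lborel)"
    unfolding A2_def lborel_prod[symmetric] by (subst lborel_pair.nn_integral_snd) (auto simp: lborel_prod)
  finally show ?thesis by (simp add: mult_left_mono mult_right_mono mult.commute)
qed

lemma integrable_continuous_support:
  fixes f :: "'a::euclidean_space \<Rightarrow> real"
  assumes "continuous_on UNIV f" "\<And>x. norm x > R \<Longrightarrow> f x = 0"
  shows "integrable lborel f"
proof -
  have "integrable lborel (\<lambda>x. indicator (cball 0 R) x *\<^sub>R f x)"
    by (rule borel_integrable_compact) (auto intro: continuous_on_subset[OF assms(1)])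
  also have "(\<lambda>x. indicator (cball 0 R) x *\<^sub>R f x) = f"
    using assms(2) by (auto simp: indicator_def fun_eq_iff)
  finally show ?thesis .
qed

text \<open>Fundamental theorem of calculus for u^4, started to the left of the support. The fourth
  power is the one whose derivative 4 u^3 u' leads back to the integral of u^6 under
  Cauchy-Schwarz.\<close>

lemma power4_le_integral_deriv:
  fixes u u' :: "real \<Rightarrow> real"
  assumes d: "\<And>x. (u has_real_derivative u' x) (at x)" and c: "continuous_on UNIV u'"
    and z: "\<And>x. \<bar>x\<bar> > R \<Longrightarrow> u x = 0"
  shows "u x ^ 4 \<le> (\<integral>y. 4 * \<bar>u y\<bar> ^ 3 * \<bar>u' y\<bar> \<partial>lborel)"
proof -
  define a where "a = min x (- \<bar>R\<bar>) - 1"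
  have a: "a \<le> x" "u a = 0" using z[of a] by (auto simp: a_def)
  have cu: "continuous_on UNIV u" using d DERIV_continuous_on has_field_derivative_at_within by metis
  let ?f = "\<lambda>y. 4 * u y ^ 3 * u' y"
  have int: "integrable lborel ?f"
    by (rule integrable_continuous_support[where R=R]) (auto intro!: continuous_intros cu c simp: z)
  have "integral\<^sup>L lborel (\<lambda>y. indicator {a..x} y *\<^sub>R ?f y) = u x ^ 4 - u a ^ 4"
  proof (rule integral_FTC_atLeastAtMost[OF a(1)])
    fix y
    have "((\<lambda>x. u x ^ 4) has_real_derivative of_nat 4 * (u' y * u y ^ (4 - Suc 0))) (at y within {a..x})"
      by (rule DERIV_power[OF has_field_derivative_at_within[OF d]])
    moreover have "of_nat 4 * (u' y * u y ^ (4 - Suc 0)) = ?f y" by simp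
    ultimately show "((\<lambda>x. u x ^ 4) has_vector_derivative ?f y) (at y within {a..x})"
      by (simp only: has_real_derivative_iff_has_vector_derivative)
  next
    show "continuous_on {a..x} ?f"
      by (rule continuous_on_subset[of UNIV]) (auto intro!: continuous_intros cu c)
  qed
  then have "u x ^ 4 = integral\<^sup>L lborel (\<lambda>y. indicator {a..x} y *\<^sub>R ?f y)" using a by simp
  also have "\<dots> \<le> (\<integral>y. 4 * \<bar>u y\<bar> ^ 3 * \<bar>u' y\<bar> \<partial>lborel)"
  proof (rule integral_mono)
    show "integrable lborel (\<lambda>y. indicator {a..x} y *\<^sub>R ?f y)"
      by (rule integrable_mult_indicator[OF _ int]) simp
    show "integrable lborel (\<lambda>y. 4 * \<bar>u y\<bar> ^ 3 * \<bar>u' y\<bar>)"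
      using integrable_norm[OF int] by (simp add: abs_mult power_abs)
    show "indicator {a..x} y *\<^sub>R ?f y \<le> 4 * \<bar>u y\<bar> ^ 3 * \<bar>u' y\<bar>" for y
      using abs_ge_self[of "u y ^ 3 * u' y"] by (auto simp: indicator_def abs_mult power_abs)
  qed
  finally show ?thesis .
qed

lemma nn_integral_cubic_bound:
  fixes u w :: "'a::euclidean_space \<Rightarrow> real"
  assumes [measurable]: "u \<in> borel_measurable borel" "w \<in> borel_measurable borel"
  shows "(\<integral>\<^sup>+x. ennreal (4 * \<bar>u x\<bar> ^ 3 * \<bar>w x\<bar>) \<partial>lborel)\<^sup>2
    \<le> 16 * ((\<integral>\<^sup>+x. ennreal (u x ^ 6) \<partial>lborel) * (\<integral>\<^sup>+x. ennreal (w x ^ 2) \<partial>lborel))"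
proof -
  have "(\<integral>\<^sup>+x. ennreal (4 * \<bar>u x\<bar> ^ 3 * \<bar>w x\<bar>) \<partial>lborel)
      = (\<integral>\<^sup>+x. ennreal (4 * \<bar>u x\<bar> ^ 3) * ennreal \<bar>w x\<bar> \<partial>lborel)"
    by (simp add: ennreal_mult)
  then have "(\<integral>\<^sup>+x. ennreal (4 * \<bar>u x\<bar> ^ 3 * \<bar>w x\<bar>) \<partial>lborel)\<^sup>2
      \<le> (\<integral>\<^sup>+x. (ennreal (4 * \<bar>u x\<bar> ^ 3))\<^sup>2 \<partial>lborel) * (\<integral>\<^sup>+x. (ennreal \<bar>w x\<bar>)\<^sup>2 \<partial>lborel)"
    by (simp add: Cauchy_Schwarz_nn_integral)
  also have "(\<lambda>x. (ennreal (4 * \<bar>u x\<bar> ^ 3))\<^sup>2) = (\<lambda>x. 16 * ennreal (u x ^ 6))"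
    by (auto simp: ennreal_power power_mult_distrib ennreal_mult' simp flip: power_mult)
  also have "(\<lambda>x. (ennreal \<bar>w x\<bar>)\<^sup>2) = (\<lambda>x. ennreal (w x ^ 2))"
    by (simp add: ennreal_power)
  finally show ?thesis by (simp add: nn_integral_cmult mult.assoc)
qed

section \<open>Lebesgue measure on triples and on \<open>real ^ 3\<close>, and the
  Gagliardo-Nirenberg argument\<close>

lemma box_Pair: "box (a, b) (c, d) = box a c \<times> box b d"
  by (auto simp: box_def Basis_prod_def ball_Un)

lemma emeasure_lborel_Times:
  "A \<in> sets borel \<Longrightarrow> B \<in> sets borel \<Longrightarrow> emeasure lborel (A \<times> B) = emeasure lborel A * emeasure lborel B"
  by (subst lborel_prod[symmetric]) (simp add: lborel.emeasure_pair_measure_Times)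

lemma continuous_on_vec3: "continuous_on UNIV (\<lambda>(a, b, c). vector [a, b, c] :: real ^ 3)"
proof -
  have "(\<lambda>(a, b, c). vector [a, b, c] :: real ^ 3) = (\<lambda>y. \<chi> i. if i = 1 then fst y else if i = 2 then fst (snd y) else snd (snd y))"
    by (auto simp: vec_eq_iff forall_3 fun_eq_iff)
  moreover have "continuous_on UNIV (\<lambda>y :: real \<times> real \<times> real.
      if i = 1 then fst y else if i = 2 then fst (snd y) else snd (snd y))" for i :: 3
    by (cases "i = 1"; cases "i = 2"; auto intro!: continuous_intros)
  ultimately show ?thesis by (simp only: continuous_on_vec_lambda)
qed

text \<open>Lebesgue measure is determined by its values on boxes, and the preimage of a box is a
  box with the same sides. This transports iterated integration in three real variables to
  \<open>real ^ 3\<close>.\<close>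

lemma lborel_distr_vec3:
  "distr lborel borel (\<lambda>(a, b, c). vector [a, b, c] :: real ^ 3) = lborel"
proof (rule lborel_eqI[symmetric])
  let ?e = "\<lambda>(a, b, c). vector [a, b, c] :: real ^ 3"
  have [measurable]: "?e \<in> borel_measurable borel"
    by (intro borel_measurable_continuous_onI continuous_on_vec3)
  fix l u :: "real ^ 3"
  assume le: "\<And>b. b \<in> Basis \<Longrightarrow> l \<bullet> b \<le> u \<bullet> b"
  have le': "l $ i \<le> u $ i" for i
    using le[of "axis i 1"] by (auto simp: inner_axis)
  have "?e -` box l u = box (l $ 1, l $ 2, l $ 3) (u $ 1, u $ 2, u $ 3)"
    by (auto simp: mem_box_cart forall_3 box_Pair)
  then have "emeasure (distr lborel borel ?e) (box l u)
      = emeasure lborel (box (l $ 1, l $ 2, l $ 3) (u $ 1, u $ 2, u $ 3))"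
    by (simp add: emeasure_distr)
  also have "\<dots> = ennreal ((u - l) $ 1) * (ennreal ((u - l) $ 2) * ennreal ((u - l) $ 3))"
    using le' by (simp add: box_Pair emeasure_lborel_Times borel_Times)
  also have "\<dots> = ennreal (\<Prod>i\<in>UNIV. (u - l) $ i)"
    using le' unfolding UNIV_3 by (simp add: ennreal_mult[symmetric])
  also have "(\<Prod>i\<in>UNIV. (u - l) $ i) = (\<Prod>b\<in>Basis. (u - l) \<bullet> b)"
  proof -
    have B: "(Basis :: (real ^ 3) set) = range (\<lambda>i. axis i 1)" by (auto simp: Basis_vec_def)
    have "inj (\<lambda>i :: 3. axis i (1 :: real))" by (auto simp: inj_def axis_eq_axis)
    then show ?thesis unfolding B by (subst prod.reindex) (auto simp: inner_axis)
  qed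
  finally show "emeasure (distr lborel borel ?e) (box l u) = ennreal (\<Prod>b\<in>Basis. (u - l) \<bullet> b)" .
qed simp

text \<open>Let X be the integral of u^6. Write u^6 as a product of three factors u^2, each at most
  the square root of an integral that no longer depends on one of the variables. Loomis-Whitney
  gives X^2 \<le> I1 I2 I3, and Cauchy-Schwarz gives Ij^2 \<le> 16 X Dj with Dj the integral of
  \<open>uj\<close> squared. Hence X^4 \<le> 16^3 X^3 D1 D2 D3, and 4096 = 16^3.\<close>

lemma Gagliardo_Nirenberg_triple:
  fixes u u1 u2 u3 :: "real \<times> real \<times> real \<Rightarrow> real"
  assumes cu: "continuous_on UNIV u" and c1: "continuous_on UNIV u1"
    and c2: "continuous_on UNIV u2" and c3: "continuous_on UNIV u3"
    and d1: "\<And>a b c. ((\<lambda>a. u (a, b, c)) has_real_derivative u1 (a, b, c)) (at a)"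
    and d2: "\<And>a b c. ((\<lambda>b. u (a, b, c)) has_real_derivative u2 (a, b, c)) (at b)"
    and d3: "\<And>a b c. ((\<lambda>c. u (a, b, c)) has_real_derivative u3 (a, b, c)) (at c)"
    and zu: "\<And>y. norm y > R \<Longrightarrow> u y = 0"
  shows "(\<integral>\<^sup>+y. ennreal (u y ^ 6) \<partial>lborel) \<le> 4096 * ((\<integral>\<^sup>+y. ennreal (u1 y ^ 2) \<partial>lborel)
    * ((\<integral>\<^sup>+y. ennreal (u2 y ^ 2) \<partial>lborel) * (\<integral>\<^sup>+y. ennreal (u3 y ^ 2) \<partial>lborel)))"
proof -
  have [measurable]: "u \<in> borel_measurable borel" "u1 \<in> borel_measurable borel"
    "u2 \<in> borel_measurable borel" "u3 \<in> borel_measurable borel"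
    using cu c1 c2 c3 by (auto intro: borel_measurable_continuous_onI)
  have n: "\<bar>a\<bar> \<le> norm (a, b, c)" "\<bar>b\<bar> \<le> norm (a, b, c)" "\<bar>c\<bar> \<le> norm (a, b, c)" for a b c :: real
    using norm_fst_le[of a "(b, c)"] norm_snd_le[of "(b, c)" a] norm_fst_le[of b c] norm_snd_le[of c b]
    by auto
  define k where "k w y = 4 * \<bar>u y\<bar> ^ 3 * \<bar>w y\<bar>" for w y
  have ck: "continuous_on UNIV (k w)" if "continuous_on UNIV w" for w
    unfolding k_def using that cu by (intro continuous_intros)
  have zk: "norm y > R \<Longrightarrow> k w y = 0" for w y by (simp add: k_def zu)
  have zu': "\<bar>a\<bar> > R \<Longrightarrow> u (a, b, c) = 0" "\<bar>b\<bar> > R \<Longrightarrow> u (a, b, c) = 0" "\<bar>c\<bar> > R \<Longrightarrow> u (a, b, c) = 0" for a b c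
    using n[where a=a and b=b and c=c] zu[of "(a, b, c)"] by force+
  have zk': "\<bar>a\<bar> > R \<Longrightarrow> k w (a, b, c) = 0" "\<bar>b\<bar> > R \<Longrightarrow> k w (a, b, c) = 0" "\<bar>c\<bar> > R \<Longrightarrow> k w (a, b, c) = 0" for w a b c
    by (simp_all add: k_def zu')
  have k0: "0 \<le> k w y" for w y by (simp add: k_def)
  define F1 where "F1 = (\<lambda>(b, c). \<integral>a. k u1 (a, b, c) \<partial>lborel)"
  define F2 where "F2 = (\<lambda>(a, c). \<integral>b. k u2 (a, b, c) \<partial>lborel)"
  define F3 where "F3 = (\<lambda>(a, b). \<integral>c. k u3 (a, b, c) \<partial>lborel)"
  have F0: "0 \<le> F1 y" "0 \<le> F2 y" "0 \<le> F3 y" for y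
    by (auto simp: F1_def F2_def F3_def split_beta k0)
  have km[measurable]: "k w \<in> borel_measurable borel" if [measurable]: "w \<in> borel_measurable borel" for w
    unfolding k_def by measurable
  have [measurable]: "F1 \<in> borel_measurable borel" "F2 \<in> borel_measurable borel" "F3 \<in> borel_measurable borel"
    unfolding F1_def F2_def F3_def borel_prod[symmetric]
    by (measurable; simp add: borel_prod)+
  have s1: "continuous_on UNIV (\<lambda>a. k u1 (a, b, c))" "continuous_on UNIV (\<lambda>b. k u2 (a, b, c))"
    "continuous_on UNIV (\<lambda>c. k u3 (a, b, c))" for a b c
    by (intro continuous_on_compose2[OF ck[OF c1]] continuous_on_compose2[OF ck[OF c2]]
          continuous_on_compose2[OF ck[OF c3]] continuous_intros; simp)+
  have i1: "integrable lborel (\<lambda>a. k u1 (a, b, c))" for b c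
    by (rule integrable_continuous_support[OF s1(1), where R=R]) (simp add: zk')
  have i2: "integrable lborel (\<lambda>b. k u2 (a, b, c))" for a c
    by (rule integrable_continuous_support[OF s1(2), where R=R]) (simp add: zk')
  have i3: "integrable lborel (\<lambda>c. k u3 (a, b, c))" for a b
    by (rule integrable_continuous_support[OF s1(3), where R=R]) (simp add: zk')
  have b1: "u (a, b, c) ^ 4 \<le> F1 (b, c)" for a b c
    unfolding F1_def k_def split
    by (rule power4_le_integral_deriv[OF d1, where R=R])
       (auto simp: zu' intro!: continuous_on_compose2[OF c1] continuous_intros)
  have b2: "u (a, b, c) ^ 4 \<le> F2 (a, c)" for a b c
    unfolding F2_def k_def split
    by (rule power4_le_integral_deriv[OF d2, where R=R])
       (auto simp: zu' intro!: continuous_on_compose2[OF c2] continuous_intros)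
  have b3: "u (a, b, c) ^ 4 \<le> F3 (a, b)" for a b c
    unfolding F3_def k_def split
    by (rule power4_le_integral_deriv[OF d3, where R=R])
       (auto simp: zu' intro!: continuous_on_compose2[OF c3] continuous_intros)
  have sq: "u y ^ 2 \<le> sqrt F" if "u y ^ 4 \<le> F" for y F
    by (rule real_le_rsqrt) (use that in \<open>simp flip: power_mult\<close>)
  let ?I = "\<lambda>w. \<integral>\<^sup>+y. ennreal (k w y) \<partial>lborel"
  have I1: "(\<integral>\<^sup>+y. (ennreal (sqrt (F1 y)))\<^sup>2 \<partial>lborel) = ?I u1"
  proof -
    have "(\<integral>\<^sup>+y. (ennreal (sqrt (F1 y)))\<^sup>2 \<partial>lborel) = (\<integral>\<^sup>+y. \<integral>\<^sup>+a. ennreal (k u1 (a, y)) \<partial>lborel \<partial>lborel)"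
      by (intro nn_integral_cong)
         (use nn_integral_eq_integral[OF i1] in \<open>auto simp: ennreal_power F0 k0 F1_def split: prod.split\<close>)
    also have "\<dots> = ?I u1"
      unfolding lborel_prod[symmetric, where 'b="real \<times> real"]
      by (subst lborel_pair.nn_integral_snd) (auto simp: lborel_prod)
    finally show ?thesis .
  qed
  have I2: "(\<integral>\<^sup>+y. (ennreal (sqrt (F2 y)))\<^sup>2 \<partial>lborel) = ?I u2"
  proof -
    have "(\<integral>\<^sup>+y. (ennreal (sqrt (F2 y)))\<^sup>2 \<partial>lborel) = (\<integral>\<^sup>+y. \<integral>\<^sup>+b. ennreal (k u2 (fst y, b, snd y)) \<partial>lborel \<partial>lborel)"
      by (intro nn_integral_cong)
         (use nn_integral_eq_integral[OF i2] in \<open>auto simp: ennreal_power F0 k0 F2_def split: prod.split\<close>)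
    also have "\<dots> = (\<integral>\<^sup>+a. \<integral>\<^sup>+c. \<integral>\<^sup>+b. ennreal (k u2 (a, b, c)) \<partial>lborel \<partial>lborel \<partial>lborel)"
      unfolding lborel_prod[symmetric]
      by (subst lborel.nn_integral_fst[symmetric]) (auto simp: borel_prod)
    also have "\<dots> = (\<integral>\<^sup>+a. \<integral>\<^sup>+y. ennreal (k u2 (a, y)) \<partial>lborel \<partial>lborel)"
      unfolding lborel_prod[symmetric]
      by (subst lborel_pair.nn_integral_snd) (auto simp: lborel_prod)
    also have "\<dots> = ?I u2"
      unfolding lborel_prod[symmetric, where 'b="real \<times> real"]
      by (subst lborel.nn_integral_fst) (auto simp: lborel_prod)
    finally show ?thesis .
  qed
  have I3: "(\<integral>\<^sup>+y. (ennreal (sqrt (F3 y)))\<^sup>2 \<partial>lborel) = ?I u3"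
  proof -
    have "(\<integral>\<^sup>+y. (ennreal (sqrt (F3 y)))\<^sup>2 \<partial>lborel) = (\<integral>\<^sup>+y. \<integral>\<^sup>+c. ennreal (k u3 (fst y, snd y, c)) \<partial>lborel \<partial>lborel)"
      by (intro nn_integral_cong)
         (use nn_integral_eq_integral[OF i3] in \<open>auto simp: ennreal_power F0 k0 F3_def split: prod.split\<close>)
    also have "\<dots> = (\<integral>\<^sup>+a. \<integral>\<^sup>+b. \<integral>\<^sup>+c. ennreal (k u3 (a, b, c)) \<partial>lborel \<partial>lborel \<partial>lborel)"
      unfolding lborel_prod[symmetric]
      by (subst lborel.nn_integral_fst[symmetric]) (auto simp: borel_prod)
    also have "\<dots> = (\<integral>\<^sup>+a. \<integral>\<^sup>+y. ennreal (k u3 (a, y)) \<partial>lborel \<partial>lborel)"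
      unfolding lborel_prod[symmetric]
      by (subst lborel.nn_integral_fst) (auto simp: lborel_prod)
    also have "\<dots> = ?I u3"
      unfolding lborel_prod[symmetric, where 'b="real \<times> real"]
      by (subst lborel.nn_integral_fst) (auto simp: lborel_prod)
    finally show ?thesis .
  qed
  define X where "X = (\<integral>\<^sup>+y. ennreal (u y ^ 6) \<partial>lborel)"
  let ?D = "\<lambda>w. \<integral>\<^sup>+y. ennreal (w y ^ 2) \<partial>lborel"
  have k4096: "(4096 :: ennreal) = 16 * 16 * 16" by simp
  have "X \<le> (\<integral>\<^sup>+(a, b, c). ennreal (sqrt (F1 (b, c))) * (ennreal (sqrt (F2 (a, c))) * ennreal (sqrt (F3 (a, b)))) \<partial>lborel)"
    unfolding X_def
  proof (rule nn_integral_mono, clarify)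
    fix a b c
    have "u (a, b, c) ^ 6 = u (a, b, c) ^ 2 * (u (a, b, c) ^ 2 * u (a, b, c) ^ 2)"
      by (simp flip: power_add)
    also have "\<dots> \<le> sqrt (F1 (b, c)) * (sqrt (F2 (a, c)) * sqrt (F3 (a, b)))"
      by (intro mult_mono sq b1 b2 b3) (auto simp: F0)
    finally show "ennreal (u (a, b, c) ^ 6)
        \<le> ennreal (sqrt (F1 (b, c))) * (ennreal (sqrt (F2 (a, c))) * ennreal (sqrt (F3 (a, b))))"
      by (simp add: F0 ennreal_leI flip: ennreal_mult)
  qed
  then have "X\<^sup>2 \<le> (\<integral>\<^sup>+(a, b, c). ennreal (sqrt (F1 (b, c))) * (ennreal (sqrt (F2 (a, c))) * ennreal (sqrt (F3 (a, b)))) \<partial>lborel)\<^sup>2"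
    by (simp add: power_mono)
  also have "\<dots> \<le> ?I u1 * (?I u2 * ?I u3)"
    unfolding I1[symmetric] I2[symmetric] I3[symmetric] by (rule Loomis_Whitney_3) measurable
  finally have "(X\<^sup>2)\<^sup>2 \<le> (?I u1 * (?I u2 * ?I u3))\<^sup>2" by (rule power_mono) simp
  also have "\<dots> = (?I u1)\<^sup>2 * ((?I u2)\<^sup>2 * (?I u3)\<^sup>2)" by (simp add: power_mult_distrib)
  also have "\<dots> \<le> (16 * (X * ?D u1)) * ((16 * (X * ?D u2)) * (16 * (X * ?D u3)))"
    unfolding X_def k_def by (intro mult_mono nn_integral_cubic_bound) auto
  finally have main: "X * X ^ 3 \<le> (4096 * (?D u1 * (?D u2 * ?D u3))) * X ^ 3"
    by (simp only: k4096 power2_eq_square power3_eq_cube mult_ac)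
  \<comment> \<open>Bounded support makes X finite, which is what permits cancelling
    \<open>X ^ 3\<close> in [0, \<infinity>].\<close>
  have "X < \<infinity>"
  proof -
    have "integrable lborel (\<lambda>y. u y ^ 6)"
      by (rule integrable_continuous_support[where R=R]) (auto intro!: continuous_intros cu simp: zu)
    from nn_integral_eq_integral[OF this] show ?thesis by (simp add: X_def)
  qed
  then have t: "X ^ 3 \<noteq> top" by (simp add: power_eq_top_ennreal)
  have "X \<le> 4096 * (?D u1 * (?D u2 * ?D u3))"
  proof (cases "X = 0")
    case False
    then have "X ^ 3 \<noteq> 0" by simp
    moreover have "X ^ 3 * X \<le> X ^ 3 * (4096 * (?D u1 * (?D u2 * ?D u3)))"
      using main by (simp only: mult.commute[of _ "X ^ 3"])
    ultimately show ?thesis using t ennreal_mult_le_mult_iff by blast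
  qed simp
  then show ?thesis by (simp add: X_def)
qed

section \<open>Fractional powers in \<open>ennreal\<close> and the Sobolev inequality on
  \<open>real ^ 3\<close>\<close>

lemma epowr_mono:
  assumes "x \<le> y" "0 \<le> a"
  shows "epowr x a \<le> epowr y a"
  using assms by (cases x; cases y) (auto simp: epowr_def powr_mono2 top_unique)

lemma epowr_ennreal: "0 \<le> r \<Longrightarrow> epowr (ennreal r) a = ennreal (r powr a)"
  by (simp add: epowr_def)

lemma epowr_cube_root_le:
  assumes "x \<le> y ^ 3"
  shows "epowr x (1 / 3) \<le> y"
proof (cases y)
  case (real r)
  have "epowr x (1 / 3) \<le> epowr (ennreal (r ^ 3)) (1 / 3)"
    using assms real by (intro epowr_mono) (auto simp: ennreal_power)
  also have "\<dots> = ennreal ((r ^ 3) powr (1 / 3))"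
    using real by (intro epowr_ennreal) simp
  also have "(r ^ 3) powr (1 / 3) = r"
  proof (cases "r = 0")
    case False
    then have "r ^ 3 = r powr 3" using real by (simp add: powr_realpow)
    then show ?thesis using real False by (simp only: powr_powr) simp
  qed simp
  finally show ?thesis using real by simp
qed simp

text \<open>The left side is the squared L_6 norm, the form that is later integrated in time. The
  triple product of \<open>Gagliardo_Nirenberg_triple\<close> is at most the cube of the sum, and 16
  is the cube root of 4096.\<close>

lemma Sobolev_smooth_vec3:
  fixes u :: "real ^ 3 \<Rightarrow> real" and D :: "3 \<Rightarrow> real ^ 3 \<Rightarrow> real"
  assumes cu: "continuous_on UNIV u" and cD: "\<And>j. continuous_on UNIV (D j)"
    and d: "\<And>j x. ((\<lambda>h. u (x + h *\<^sub>R axis j 1)) has_real_derivative D j x) (at 0)"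
    and zu: "\<And>x. norm x > R \<Longrightarrow> u x = 0"
  shows "epowr (\<integral>\<^sup>+x. ennreal (u x ^ 6) \<partial>lborel) (1 / 3)
    \<le> 16 * (\<Sum>j\<in>UNIV. \<integral>\<^sup>+x. ennreal (D j x ^ 2) \<partial>lborel)"
proof -
  let ?e = "\<lambda>(a, b, c). vector [a, b, c] :: real ^ 3"
  have ce: "continuous_on UNIV ?e" by (rule continuous_on_vec3)
  then have [measurable]: "?e \<in> borel_measurable borel" by (rule borel_measurable_continuous_onI)
  have [measurable]: "u \<in> borel_measurable borel" "D j \<in> borel_measurable borel" for j
    using cu cD by (auto intro: borel_measurable_continuous_onI)
  have tr: "(\<integral>\<^sup>+y. f (?e y) \<partial>lborel) = (\<integral>\<^sup>+x. f x \<partial>lborel)"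
    if [measurable]: "f \<in> borel_measurable borel" for f :: "real ^ 3 \<Rightarrow> ennreal"
    using nn_integral_distr[of ?e lborel borel f] by (simp add: lborel_distr_vec3)
  have dl: "((\<lambda>s. u (p + (s - a) *\<^sub>R axis j 1)) has_real_derivative D j p) (at a)" for p j a
  proof -
    have "((\<lambda>h. u (p + h *\<^sub>R axis j 1)) has_real_derivative D j p) (at (a - a))"
      using d[of p j] by simp
    then have "((\<lambda>s. u (p + (s - a) *\<^sub>R axis j 1)) has_real_derivative D j p * 1) (at a)"
      by (rule DERIV_chain2) (auto intro!: derivative_eq_intros)
    then show ?thesis by simp
  qed
  have v: "vector [a, b, c] + (s - a) *\<^sub>R axis 1 1 = (vector [s, b, c] :: real ^ 3)"
    "vector [a, b, c] + (s - b) *\<^sub>R axis 2 1 = (vector [a, s, c] :: real ^ 3)"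
    "vector [a, b, c] + (s - c) *\<^sub>R axis 3 1 = (vector [a, b, s] :: real ^ 3)" for a b c s :: real
    by (auto simp: vec_eq_iff forall_3 axis_def)
  have bd: "norm y \<le> 2 * norm (?e y)" for y
  proof -
    obtain a b c where y: "y = (a, b, c)" by (cases y)
    have "norm (?e y) = sqrt (a\<^sup>2 + b\<^sup>2 + c\<^sup>2)"
      by (simp add: y norm_vec_def L2_set_def sum_3)
    moreover have "norm y = sqrt (a\<^sup>2 + (b\<^sup>2 + c\<^sup>2))"
      by (simp add: y norm_Pair)
    ultimately have "norm y = norm (?e y)" by (simp add: add.assoc)
    then show ?thesis by simp
  qed
  have "(\<integral>\<^sup>+y. ennreal (u (?e y) ^ 6) \<partial>lborel) \<le> 4096 * ((\<integral>\<^sup>+y. ennreal (D 1 (?e y) ^ 2) \<partial>lborel)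
    * ((\<integral>\<^sup>+y. ennreal (D 2 (?e y) ^ 2) \<partial>lborel) * (\<integral>\<^sup>+y. ennreal (D 3 (?e y) ^ 2) \<partial>lborel)))"
  proof (rule Gagliardo_Nirenberg_triple[where R = "2 * R"])
    show "continuous_on UNIV (\<lambda>y. u (?e y))" "continuous_on UNIV (\<lambda>y. D 1 (?e y))"
      "continuous_on UNIV (\<lambda>y. D 2 (?e y))" "continuous_on UNIV (\<lambda>y. D 3 (?e y))"
      by (rule continuous_on_compose2[OF cu ce] continuous_on_compose2[OF cD ce]; simp)+
    show "2 * R < norm y \<Longrightarrow> u (?e y) = 0" for y
      using bd[of y] by (intro zu) linarith
    show "((\<lambda>s. u (?e (s, b, c))) has_real_derivative D 1 (?e (a, b, c))) (at a)"
      "((\<lambda>s. u (?e (a, s, c))) has_real_derivative D 2 (?e (a, b, c))) (at b)"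
      "((\<lambda>s. u (?e (a, b, s))) has_real_derivative D 3 (?e (a, b, c))) (at c)" for a b c
      using dl[where p = "vector [a, b, c]" and j = 1 and a = a] dl[where p = "vector [a, b, c]" and j = 2 and a = b] dl[where p = "vector [a, b, c]" and j = 3 and a = c]
      by (simp_all add: v)
  qed
  then have "(\<integral>\<^sup>+x. ennreal (u x ^ 6) \<partial>lborel) \<le> 4096 * ((\<integral>\<^sup>+x. ennreal (D 1 x ^ 2) \<partial>lborel)
    * ((\<integral>\<^sup>+x. ennreal (D 2 x ^ 2) \<partial>lborel) * (\<integral>\<^sup>+x. ennreal (D 3 x ^ 2) \<partial>lborel)))"
    by (simp add: tr[of "\<lambda>x. ennreal (u x ^ 6)"] tr[of "\<lambda>x. ennreal (D j x ^ 2)" for j])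
  also have "\<dots> \<le> 4096 * (\<Sum>j\<in>UNIV. \<integral>\<^sup>+x. ennreal (D j x ^ 2) \<partial>lborel) ^ 3"
    unfolding power3_eq_cube mult.assoc
    by (intro mult_mono) (auto simp: sum_3 add_increasing add_increasing2 add.assoc)
  also have "\<dots> = (16 * (\<Sum>j\<in>UNIV. \<integral>\<^sup>+x. ennreal (D j x ^ 2) \<partial>lborel)) ^ 3"
    by (simp add: power_mult_distrib)
  finally show ?thesis by (rule epowr_cube_root_le)
qed

section \<open>Mollification\<close>

lemma nn_integral_lborel_shift:
  fixes f :: "'a::euclidean_space \<Rightarrow> ennreal"
  assumes [measurable]: "f \<in> borel_measurable borel"
  shows "(\<integral>\<^sup>+z. f (z - w) \<partial>lborel) = (\<integral>\<^sup>+z. f z \<partial>lborel)"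
  by (subst (2) lborel_distr_plus[of "- w", symmetric]) (simp add: nn_integral_distr)

lemma nn_integral_lborel_reflect:
  fixes f :: "'a::euclidean_space \<Rightarrow> ennreal"
  assumes [measurable]: "f \<in> borel_measurable borel"
  shows "(\<integral>\<^sup>+w. f (z - w) \<partial>lborel) = (\<integral>\<^sup>+z. f z \<partial>lborel)"
  by (subst (2) lborel_affine[of "- 1" z]) (auto simp: nn_integral_density nn_integral_distr)

text \<open>Density of compactly supported continuous functions in L_1. Measurability supplies
  continuous functions converging almost everywhere, but without a majorant. Clamping values to
  [-k, k] and cutting off in space creates one: k is fixed first, so that truncating U costs little,
  and only then is the index of the approximating sequence chosen.\<close>

lemma integrable_approx_continuous:
  fixes U :: "'a::euclidean_space \<Rightarrow> real"
  assumes U: "integrable lborel U" and e: "e > 0"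
  obtains g R where "continuous_on UNIV g" "\<And>x. norm x > R \<Longrightarrow> g x = 0"
    "(\<integral>x. \<bar>U x - g x\<bar> \<partial>lborel) < e"
proof -
  have [measurable]: "U \<in> borel_measurable borel" using U by auto
  have "U measurable_on UNIV"
    by (rule lebesgue_measurable_imp_measurable_on) (auto intro: measurable_completion)
  then obtain N g where N: "negligible N" and g: "\<And>n. continuous_on UNIV (g n)"
    and lim: "\<And>x. x \<notin> N \<Longrightarrow> (\<lambda>n. g n x) \<longlonglongrightarrow> U x"
    unfolding measurable_on_def by auto
  have [measurable]: "g n \<in> borel_measurable borel" for n
    using g by (rule borel_measurable_continuous_onI)
  define c :: "nat \<Rightarrow> 'a \<Rightarrow> real" where "c k x = max 0 (min 1 (real k + 1 - norm x))" for k x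
  define cl :: "nat \<Rightarrow> real \<Rightarrow> real" where "cl k y = max (- real k) (min (real k) y)" for k y
  have cc: "continuous_on UNIV (c k)" "continuous_on UNIV (cl k)" for k
    unfolding c_def cl_def by (intro continuous_intros)+
  have [measurable]: "c k \<in> borel_measurable borel" "cl k \<in> borel_measurable borel" for k
    by (rule borel_measurable_continuous_onI[OF cc(1)] borel_measurable_continuous_onI[OF cc(2)])+
  have c01: "0 \<le> c k x" "c k x \<le> 1" and cz: "norm x > real k + 1 \<Longrightarrow> c k x = 0" for k x
    by (auto simp: c_def)
  have cl: "\<bar>cl k y\<bar> \<le> \<bar>y\<bar>" "\<bar>cl k y\<bar> \<le> real k" for k y by (auto simp: cl_def)
  have "(\<lambda>k. \<integral>x. \<bar>U x - c k x * cl k (U x)\<bar> \<partial>lborel) \<longlonglongrightarrow> (\<integral>x. 0 \<partial>(lborel :: 'a measure))"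
  proof (rule integral_dominated_convergence[where w="\<lambda>x. 2 * \<bar>U x\<bar>"])
    show "integrable lborel (\<lambda>x. 2 * \<bar>U x\<bar>)" using U by auto
    show "AE x in lborel. (\<lambda>k. \<bar>U x - c k x * cl k (U x)\<bar>) \<longlonglongrightarrow> 0"
    proof (rule AE_I2, rule tendsto_eventually)
      fix x
      obtain m :: nat where "real m \<ge> norm x" "real m \<ge> \<bar>U x\<bar>"
        using real_nat_ceiling_ge[of "max (norm x) \<bar>U x\<bar>"] by (meson max.boundedE)
      then show "\<forall>\<^sub>F k in sequentially. \<bar>U x - c k x * cl k (U x)\<bar> = 0"
        by (intro eventually_sequentiallyI[of m]) (auto simp: c_def cl_def max_def min_def)
    qed
    show "AE x in lborel. norm \<bar>U x - c k x * cl k (U x)\<bar> \<le> 2 * \<bar>U x\<bar>" for k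
    proof (rule AE_I2)
      fix x
      have "\<bar>c k x * cl k (U x)\<bar> \<le> 1 * \<bar>U x\<bar>"
        unfolding abs_mult by (intro mult_mono cl) (use c01 in auto)
      then show "norm \<bar>U x - c k x * cl k (U x)\<bar> \<le> 2 * \<bar>U x\<bar>" by simp
    qed
  qed auto
  then have "\<forall>\<^sub>F k in sequentially. (\<integral>x. \<bar>U x - c k x * cl k (U x)\<bar> \<partial>lborel) < e / 2"
    using e by (intro order_tendstoD) auto
  then obtain k where k: "(\<integral>x. \<bar>U x - c k x * cl k (U x)\<bar> \<partial>lborel) < e / 2"
    by (auto simp: eventually_sequentially)
  \<comment> \<open>With k fixed, all truncated functions are bounded by k on one ball, so this
    majorant is integrable and independent of n.\<close>
  define w where "w x = real k * indicator (cball 0 (real k + 1)) x" for x :: 'a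
  have wi: "integrable lborel w"
    unfolding w_def using emeasure_bounded_finite[OF bounded_cball, of "0 :: 'a" "real k + 1"]
    by (intro integrable_mult_right integrable_real_indicator) auto
  have bw: "\<bar>c k x * cl k y\<bar> \<le> w x" for x y
  proof (cases "norm x > real k + 1")
    case False
    have "\<bar>c k x * cl k y\<bar> \<le> 1 * real k"
      unfolding abs_mult by (intro mult_mono cl) (use c01 in auto)
    then show ?thesis using False by (simp add: w_def)
  qed (simp add: cz w_def)
  have "(\<lambda>n. \<integral>x. \<bar>c k x * cl k (U x) - c k x * cl k (g n x)\<bar> \<partial>lborel) \<longlonglongrightarrow> (\<integral>x. 0 \<partial>(lborel :: 'a measure))"
  proof (rule integral_dominated_convergence[where w="\<lambda>x. 2 * w x"])
    show "integrable lborel (\<lambda>x. 2 * w x)" using wi by auto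
    have "AE x in lebesgue. x \<notin> N"
      using N by (auto simp: negligible_iff_null_sets intro: AE_not_in)
    then have "AE x in lborel. x \<notin> N" by (simp add: AE_completion_iff)
    then show "AE x in lborel. (\<lambda>n. \<bar>c k x * cl k (U x) - c k x * cl k (g n x)\<bar>) \<longlonglongrightarrow> 0"
    proof eventually_elim
      case (elim x)
      have "isCont (cl k) (U x)" using cc(2) by (simp add: continuous_on_eq_continuous_at)
      then have "(\<lambda>n. cl k (g n x)) \<longlonglongrightarrow> cl k (U x)"
        using lim[OF elim] isCont_tendsto_compose by blast
      then have "(\<lambda>n. \<bar>c k x * cl k (U x) - c k x * cl k (g n x)\<bar>) \<longlonglongrightarrow> \<bar>c k x * cl k (U x) - c k x * cl k (U x)\<bar>"
        by (intro tendsto_intros)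
      then show ?case by simp
    qed
    show "AE x in lborel. norm \<bar>c k x * cl k (U x) - c k x * cl k (g n x)\<bar> \<le> 2 * w x" for n
      using bw by (intro AE_I2) (smt (verit) real_norm_def)
  qed auto
  then have "\<forall>\<^sub>F n in sequentially. (\<integral>x. \<bar>c k x * cl k (U x) - c k x * cl k (g n x)\<bar> \<partial>lborel) < e / 2"
    using e by (intro order_tendstoD) auto
  then obtain n where n: "(\<integral>x. \<bar>c k x * cl k (U x) - c k x * cl k (g n x)\<bar> \<partial>lborel) < e / 2"
    by (auto simp: eventually_sequentially)
  let ?g = "\<lambda>x. c k x * cl k (g n x)"
  have i: "integrable lborel (\<lambda>x. c k x * cl k (U x))" "integrable lborel ?g"
    using bw by (auto intro!: Bochner_Integration.integrable_bound[OF wi] AE_I2 order_trans[OF _ abs_ge_self])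
  have "(\<integral>x. \<bar>U x - ?g x\<bar> \<partial>lborel)
      \<le> (\<integral>x. \<bar>U x - c k x * cl k (U x)\<bar> + \<bar>c k x * cl k (U x) - ?g x\<bar> \<partial>lborel)"
    using U i by (intro integral_mono) auto
  also have "\<dots> = (\<integral>x. \<bar>U x - c k x * cl k (U x)\<bar> \<partial>lborel) + (\<integral>x. \<bar>c k x * cl k (U x) - ?g x\<bar> \<partial>lborel)"
    using U i by (intro Bochner_Integration.integral_add) auto
  finally have "(\<integral>x. \<bar>U x - ?g x\<bar> \<partial>lborel) < e" using k n by simp
  moreover have "continuous_on UNIV ?g"
    by (intro continuous_on_mult cc continuous_on_compose2[OF cc(2) g]) auto
  moreover have "?g x = 0" if "norm x > real k + 1" for x using cz[OF that] by simp
  ultimately show thesis using that by blast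
qed

definition conv :: "('a::euclidean_space \<Rightarrow> real) \<Rightarrow> ('a \<Rightarrow> real) \<Rightarrow> 'a \<Rightarrow> real" where
  "conv k U z = (\<integral>w. k (z - w) * U w \<partial>lborel)"

lemma conv_measurable[measurable]:
  assumes [measurable]: "k \<in> borel_measurable borel" "U \<in> borel_measurable borel"
  shows "conv k U \<in> borel_measurable borel"
  unfolding conv_def by measurable

text \<open>No integrability is assumed: where the integrand is not integrable, \<open>conv\<close>
  is 0 by the convention for the integral.\<close>

lemma abs_conv_le:
  assumes [measurable]: "k \<in> borel_measurable borel" "U \<in> borel_measurable borel" and k: "\<And>y. 0 \<le> k y"
  shows "ennreal \<bar>conv k U z\<bar> \<le> (\<integral>\<^sup>+w. ennreal (k (z - w)) * ennreal \<bar>U w\<bar> \<partial>lborel)"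
proof (cases "integrable lborel (\<lambda>w. k (z - w) * U w)")
  case True
  have "ennreal \<bar>conv k U z\<bar> \<le> (\<integral>\<^sup>+w. ennreal (norm (k (z - w) * U w)) \<partial>lborel)"
    unfolding conv_def using integral_norm_bound_ennreal[OF True] by simp
  then show ?thesis by (simp add: abs_mult k ennreal_mult)
qed (simp add: conv_def not_integrable_integral_eq)

lemma nn_integral_conv:
  fixes k f :: "'a::euclidean_space \<Rightarrow> ennreal"
  assumes [measurable]: "k \<in> borel_measurable borel" "f \<in> borel_measurable borel"
    and k1: "(\<integral>\<^sup>+y. k y \<partial>lborel) = 1"
  shows "(\<integral>\<^sup>+z. \<integral>\<^sup>+w. k (z - w) * f w \<partial>lborel \<partial>lborel) = (\<integral>\<^sup>+w. f w \<partial>lborel)"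
proof -
  have "(\<integral>\<^sup>+z. \<integral>\<^sup>+w. k (z - w) * f w \<partial>lborel \<partial>lborel) = (\<integral>\<^sup>+w. \<integral>\<^sup>+z. k (z - w) * f w \<partial>lborel \<partial>lborel)"
    by (rule lborel_pair.Fubini') measurable
  also have "\<dots> = (\<integral>\<^sup>+w. f w \<partial>lborel)"
    by (simp add: nn_integral_multc nn_integral_lborel_shift k1)
  finally show ?thesis .
qed

lemma conv_L1_le:
  assumes [measurable]: "k \<in> borel_measurable borel" "U \<in> borel_measurable borel"
    and k: "\<And>y. 0 \<le> k y" and k1: "(\<integral>\<^sup>+y. ennreal (k y) \<partial>lborel) = 1"
  shows "(\<integral>\<^sup>+z. ennreal \<bar>conv k U z\<bar> \<partial>lborel) \<le> (\<integral>\<^sup>+z. ennreal \<bar>U z\<bar> \<partial>lborel)"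
proof -
  have "(\<integral>\<^sup>+z. ennreal \<bar>conv k U z\<bar> \<partial>lborel)
      \<le> (\<integral>\<^sup>+z. \<integral>\<^sup>+w. ennreal (k (z - w)) * ennreal \<bar>U w\<bar> \<partial>lborel \<partial>lborel)"
    by (intro nn_integral_mono abs_conv_le k) auto
  also have "\<dots> = (\<integral>\<^sup>+z. ennreal \<bar>U z\<bar> \<partial>lborel)"
    by (rule nn_integral_conv[OF _ _ k1]) auto
  finally show ?thesis .
qed

text \<open>Jensen's inequality for the probability density \<open>k (z - w)\<close>, obtained from
  Cauchy-Schwarz by splitting k into two square roots, followed by Tonelli.\<close>

lemma conv_L2_le:
  assumes [measurable]: "k \<in> borel_measurable borel" "U \<in> borel_measurable borel"
    and k: "\<And>y. 0 \<le> k y" and k1: "(\<integral>\<^sup>+y. ennreal (k y) \<partial>lborel) = 1"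
  shows "(\<integral>\<^sup>+z. ennreal ((conv k U z)\<^sup>2) \<partial>lborel) \<le> (\<integral>\<^sup>+z. ennreal ((U z)\<^sup>2) \<partial>lborel)"
proof -
  have "ennreal ((conv k U z)\<^sup>2) \<le> (\<integral>\<^sup>+w. ennreal (k (z - w)) * ennreal ((U w)\<^sup>2) \<partial>lborel)" for z
  proof -
    have "ennreal ((conv k U z)\<^sup>2) = (ennreal \<bar>conv k U z\<bar>)\<^sup>2" by (simp add: ennreal_power)
    also have "\<dots> \<le> (\<integral>\<^sup>+w. ennreal (k (z - w)) * ennreal \<bar>U w\<bar> \<partial>lborel)\<^sup>2"
      by (intro power_mono abs_conv_le k) auto
    also have "(\<integral>\<^sup>+w. ennreal (k (z - w)) * ennreal \<bar>U w\<bar> \<partial>lborel)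
        = (\<integral>\<^sup>+w. ennreal (sqrt (k (z - w))) * ennreal (sqrt (k (z - w)) * \<bar>U w\<bar>) \<partial>lborel)"
      by (intro nn_integral_cong) (simp add: k mult.assoc[symmetric] flip: ennreal_mult)
    also have "\<dots>\<^sup>2 \<le> (\<integral>\<^sup>+w. (ennreal (sqrt (k (z - w))))\<^sup>2 \<partial>lborel)
        * (\<integral>\<^sup>+w. (ennreal (sqrt (k (z - w)) * \<bar>U w\<bar>))\<^sup>2 \<partial>lborel)"
      by (rule Cauchy_Schwarz_nn_integral) measurable
    also have "(\<integral>\<^sup>+w. (ennreal (sqrt (k (z - w))))\<^sup>2 \<partial>lborel) = 1"
      using nn_integral_lborel_reflect[of "\<lambda>y. ennreal (k y)" z] k1 by (simp add: ennreal_power k)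
    also have "(\<integral>\<^sup>+w. (ennreal (sqrt (k (z - w)) * \<bar>U w\<bar>))\<^sup>2 \<partial>lborel)
        = (\<integral>\<^sup>+w. ennreal (k (z - w)) * ennreal ((U w)\<^sup>2) \<partial>lborel)"
      by (simp add: ennreal_power power_mult_distrib k flip: ennreal_mult)
    finally show ?thesis by simp
  qed
  then have "(\<integral>\<^sup>+z. ennreal ((conv k U z)\<^sup>2) \<partial>lborel)
      \<le> (\<integral>\<^sup>+z. \<integral>\<^sup>+w. ennreal (k (z - w)) * ennreal ((U w)\<^sup>2) \<partial>lborel \<partial>lborel)"
    by (intro nn_integral_mono)
  also have "\<dots> = (\<integral>\<^sup>+z. ennreal ((U z)\<^sup>2) \<partial>lborel)"
    by (rule nn_integral_conv[OF _ _ k1]) auto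
  finally show ?thesis .
qed

lemma integrable_conv_integrand:
  fixes k U :: "'a::euclidean_space \<Rightarrow> real"
  assumes [measurable]: "k \<in> borel_measurable borel" and b: "\<And>y. \<bar>k y\<bar> \<le> B" and U: "integrable lborel U"
  shows "integrable lborel (\<lambda>w. k (z - w) * U w)"
proof (rule Bochner_Integration.integrable_bound[where f="\<lambda>w. B * \<bar>U w\<bar>"])
  have [measurable]: "U \<in> borel_measurable borel" using U by auto
  show "integrable lborel (\<lambda>w. B * \<bar>U w\<bar>)" using U by auto
  show "(\<lambda>w. k (z - w) * U w) \<in> borel_measurable lborel" by measurable
  show "AE w in lborel. norm (k (z - w) * U w) \<le> norm (B * \<bar>U w\<bar>)"
    using b by (intro AE_I2) (auto simp: abs_mult intro!: mult_right_mono order_trans[OF b abs_ge_self])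
qed

lemma conv_diff:
  fixes k :: "'a::euclidean_space \<Rightarrow> real"
  assumes "k \<in> borel_measurable borel" "\<And>y. \<bar>k y\<bar> \<le> B" "integrable lborel U" "integrable lborel g"
  shows "conv k U z - conv k g z = conv k (\<lambda>w. U w - g w) z"
  using integrable_conv_integrand[OF assms(1,2,3)] integrable_conv_integrand[OF assms(1,2,4)]
  by (simp add: conv_def right_diff_distrib)

text \<open>Compare with a compactly supported continuous g close to U in L_1. The error splits into
  the mollified U - g, the mollification error of g, and g - U. The outer two are small because
  mollification does not increase the L_1 norm, the middle one by uniform continuity of g.\<close>

lemma conv_tendsto_L1:
  fixes k :: "nat \<Rightarrow> 'a::euclidean_space \<Rightarrow> real"
  assumes km[measurable]: "\<And>n. k n \<in> borel_measurable borel"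
    and k0: "\<And>n y. 0 \<le> k n y" and kB: "\<And>n y. k n y \<le> B n"
    and k1: "\<And>n. (\<integral>\<^sup>+y. ennreal (k n y) \<partial>lborel) = 1"
    and ks: "\<And>n y. norm y > r n \<Longrightarrow> k n y = 0" and r: "r \<longlonglongrightarrow> 0"
    and U: "integrable lborel U"
  shows "(\<lambda>n. \<integral>\<^sup>+z. ennreal \<bar>conv (k n) U z - U z\<bar> \<partial>lborel) \<longlonglongrightarrow> 0"
proof (rule order_tendstoI)
  fix E :: ennreal
  assume "0 < E"
  then obtain e where e: "e > 0" "ennreal (3 * e) < E"
  proof -
    obtain x where x: "0 < x" "x < E" using dense[OF \<open>0 < E\<close>] by auto
    then obtain e' where "x = ennreal e'" "0 < e'"
      by (cases x) (auto simp: top_unique dest: less_imp_le)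
    then show thesis using that[of "e' / 3"] x by auto
  qed
  have [measurable]: "U \<in> borel_measurable borel" using U by auto
  have kb: "\<bar>k n y\<bar> \<le> B n" for n y using k0 kB by simp
  obtain g R where g: "continuous_on UNIV g" and gz: "\<And>x. norm x > R \<Longrightarrow> g x = 0"
    and gU: "(\<integral>x. \<bar>U x - g x\<bar> \<partial>lborel) < e"
    using integrable_approx_continuous[OF U e(1)] by blast
  have [measurable]: "g \<in> borel_measurable borel" using g by (rule borel_measurable_continuous_onI)
  have gi: "integrable lborel g" by (rule integrable_continuous_support[OF g gz])
  have gU': "(\<integral>\<^sup>+x. ennreal \<bar>U x - g x\<bar> \<partial>lborel) \<le> ennreal e"
  proof -
    have "(\<integral>\<^sup>+x. ennreal \<bar>U x - g x\<bar> \<partial>lborel) = ennreal (\<integral>x. \<bar>U x - g x\<bar> \<partial>lborel)"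
      using U gi by (intro nn_integral_eq_integral) auto
    then show ?thesis using gU by (simp add: ennreal_leI)
  qed
  define m where "m = measure lborel (cball (0::'a) (\<bar>R\<bar> + 1))"
  have m: "emeasure lborel (cball (0::'a) (\<bar>R\<bar> + 1)) = ennreal m"
    unfolding m_def by (rule emeasure_eq_ennreal_measure)
      (use emeasure_bounded_finite[of "cball (0::'a) (\<bar>R\<bar> + 1)"] in auto)
  have m0: "0 \<le> m" by (simp add: m_def)
  \<comment> \<open>Chosen so that an error e' on a ball of measure m costs at most e in L_1; the
    \<open>+ 1\<close> avoids dividing by m.\<close>
  define e' where "e' = e / (m + 1)"
  have e': "e' > 0" "e' * m \<le> e" using e m0 by (auto simp: e'_def field_simps)
  \<comment> \<open>The margin 2 lets two points at distance below 1 be treated together: either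
    both lie in this ball, or both lie outside the support of g.\<close>
  have "uniformly_continuous_on (cball 0 (\<bar>R\<bar> + 2)) g"
    by (intro compact_uniformly_continuous continuous_on_subset[OF g]) auto
  then obtain d where d: "d > 0"
    "\<And>x y. x \<in> cball 0 (\<bar>R\<bar> + 2) \<Longrightarrow> y \<in> cball 0 (\<bar>R\<bar> + 2) \<Longrightarrow> dist y x < d \<Longrightarrow> dist (g y) (g x) < e'"
    unfolding uniformly_continuous_on_def using e' by metis
  have gc: "\<bar>g w - g z\<bar> \<le> e'" if "norm (z - w) < min d 1" for w z
  proof (cases "z \<in> cball 0 (\<bar>R\<bar> + 2) \<and> w \<in> cball 0 (\<bar>R\<bar> + 2)")
    case True
    then show ?thesis using d(2)[of z w] that by (auto simp: dist_norm norm_minus_commute)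
  next
    case False
    have "norm z \<le> norm w + norm (z - w)" "norm w \<le> norm z + norm (z - w)"
      by (metis norm_triangle_sub, metis norm_triangle_sub norm_minus_commute)
    then have "norm z > R" "norm w > R" using False that by auto
    then show ?thesis using gz e' by simp
  qed
  have ev: "\<forall>\<^sub>F n in sequentially. r n < min d 1"
    using r d by (intro order_tendstoD) auto
  show "\<forall>\<^sub>F n in sequentially. (\<integral>\<^sup>+z. ennreal \<bar>conv (k n) U z - U z\<bar> \<partial>lborel) < E"
    using ev
  proof eventually_elim
    case (elim n)
    have kg: "(\<integral>w. k n (z - w) \<partial>lborel) = 1" "integrable lborel (\<lambda>w. k n (z - w))" for z
    proof -
      have "(\<integral>\<^sup>+w. ennreal (k n (z - w)) \<partial>lborel) = ennreal 1"
        using nn_integral_lborel_reflect[of "\<lambda>y. ennreal (k n y)" z] k1 by simp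
      then have "has_bochner_integral lborel (\<lambda>w. k n (z - w)) 1"
        by (intro has_bochner_integral_nn_integral) (auto simp: k0)
      then show "(\<integral>w. k n (z - w) \<partial>lborel) = 1" "integrable lborel (\<lambda>w. k n (z - w))"
        by (auto simp: has_bochner_integral_iff)
    qed
    have cg: "\<bar>conv (k n) g z - g z\<bar> \<le> e' * indicator (cball 0 (\<bar>R\<bar> + 1)) z" for z
    proof -
      have ig: "integrable lborel (\<lambda>w. k n (z - w) * g w)"
        by (rule integrable_conv_integrand[OF km kb gi])
      have id: "integrable lborel (\<lambda>w. k n (z - w) * (g w - g z))"
        using ig kg(2) by (simp add: right_diff_distrib)
      have "conv (k n) g z - g z = (\<integral>w. k n (z - w) * (g w - g z) \<partial>lborel)"
        using ig kg by (simp add: conv_def right_diff_distrib)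
      also have "\<bar>\<dots>\<bar> \<le> (\<integral>w. \<bar>k n (z - w) * (g w - g z)\<bar> \<partial>lborel)"
        using integral_norm_bound[of lborel "\<lambda>w. k n (z - w) * (g w - g z)"] by simp
      also have "\<dots> \<le> (\<integral>w. k n (z - w) * (e' * indicator (cball 0 (\<bar>R\<bar> + 1)) z) \<partial>lborel)"
      proof (rule integral_mono)
        show "integrable lborel (\<lambda>w. \<bar>k n (z - w) * (g w - g z)\<bar>)" using id by simp
        show "integrable lborel (\<lambda>w. k n (z - w) * (e' * indicator (cball 0 (\<bar>R\<bar> + 1)) z))"
          using kg(2) by simp
        show "\<bar>k n (z - w) * (g w - g z)\<bar> \<le> k n (z - w) * (e' * indicator (cball 0 (\<bar>R\<bar> + 1)) z)" for w
        proof (cases "norm (z - w) > r n")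
          case False
          then have lt: "norm (z - w) < min d 1" using elim by simp
          have "\<bar>g w - g z\<bar> \<le> e' * indicator (cball 0 (\<bar>R\<bar> + 1)) z"
          proof (cases "z \<in> cball 0 (\<bar>R\<bar> + 1)")
            case False
            then have "norm z > R" "norm w > R"
              using lt norm_triangle_sub[of z w] by auto
            then show ?thesis using e'(1) by (simp add: gz)
          qed (use gc[OF lt] in simp)
          then show ?thesis unfolding abs_mult using k0 by (simp add: mult_left_mono)
        qed (simp add: ks)
      qed
      finally show ?thesis by (simp add: kg)
    qed
    have "(\<integral>\<^sup>+z. ennreal \<bar>conv (k n) U z - U z\<bar> \<partial>lborel)
        \<le> (\<integral>\<^sup>+z. ennreal \<bar>conv (k n) (\<lambda>w. U w - g w) z\<bar>
            + (ennreal \<bar>conv (k n) g z - g z\<bar> + ennreal \<bar>U z - g z\<bar>) \<partial>lborel)"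
    proof (rule nn_integral_mono)
      fix z
      have "\<bar>conv (k n) U z - U z\<bar> \<le> \<bar>conv (k n) (\<lambda>w. U w - g w) z\<bar>
          + (\<bar>conv (k n) g z - g z\<bar> + \<bar>U z - g z\<bar>)"
        using conv_diff[OF km kb U gi, of n z] by linarith
      then show "ennreal \<bar>conv (k n) U z - U z\<bar> \<le> ennreal \<bar>conv (k n) (\<lambda>w. U w - g w) z\<bar>
            + (ennreal \<bar>conv (k n) g z - g z\<bar> + ennreal \<bar>U z - g z\<bar>)"
        by (simp flip: ennreal_plus)
    qed
    also have "\<dots> = (\<integral>\<^sup>+z. ennreal \<bar>conv (k n) (\<lambda>w. U w - g w) z\<bar> \<partial>lborel)
            + ((\<integral>\<^sup>+z. ennreal \<bar>conv (k n) g z - g z\<bar> \<partial>lborel) + (\<integral>\<^sup>+z. ennreal \<bar>U z - g z\<bar> \<partial>lborel))"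
      by (simp add: nn_integral_add)
    also have "\<dots> \<le> ennreal e + (ennreal e + ennreal e)"
    proof (intro add_mono gU')
      have "(\<integral>\<^sup>+z. ennreal \<bar>conv (k n) (\<lambda>w. U w - g w) z\<bar> \<partial>lborel) \<le> (\<integral>\<^sup>+z. ennreal \<bar>U z - g z\<bar> \<partial>lborel)"
        by (rule conv_L1_le[OF _ _ k0 k1]) auto
      then show "(\<integral>\<^sup>+z. ennreal \<bar>conv (k n) (\<lambda>w. U w - g w) z\<bar> \<partial>lborel) \<le> ennreal e"
        using gU' by (rule order_trans)
      have "(\<integral>\<^sup>+z. ennreal \<bar>conv (k n) g z - g z\<bar> \<partial>lborel)
          \<le> (\<integral>\<^sup>+z. ennreal e' * indicator (cball (0 :: 'a) (\<bar>R\<bar> + 1)) z \<partial>lborel)"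
      proof (rule nn_integral_mono)
        fix z
        show "ennreal \<bar>conv (k n) g z - g z\<bar> \<le> ennreal e' * indicator (cball 0 (\<bar>R\<bar> + 1)) z"
          using cg[of z] by (cases "z \<in> cball 0 (\<bar>R\<bar> + 1)") (auto intro: ennreal_leI)
      qed
      also have "\<dots> = ennreal e' * ennreal m" by (simp add: nn_integral_cmult_indicator m)
      also have "\<dots> \<le> ennreal e" using e' m0 by (simp add: ennreal_leI flip: ennreal_mult)
      finally show "(\<integral>\<^sup>+z. ennreal \<bar>conv (k n) g z - g z\<bar> \<partial>lborel) \<le> ennreal e" .
    qed
    also have "\<dots> = ennreal (3 * e)" using e by (simp flip: ennreal_plus)
    also note e(2)
    finally show ?case .
  qed
qed simp

lemma continuous_conv:
  fixes k U :: "'a::euclidean_space \<Rightarrow> real"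
  assumes k: "continuous_on UNIV k" and b: "\<And>y. \<bar>k y\<bar> \<le> B" and U: "integrable lborel U"
  shows "continuous_on UNIV (conv k U)"
proof -
  have [measurable]: "k \<in> borel_measurable borel" "U \<in> borel_measurable borel"
    using U k by (auto intro: borel_measurable_continuous_onI)
  have "(\<lambda>n. conv k U (x n)) \<longlonglongrightarrow> conv k U z" if x: "x \<longlonglongrightarrow> z" for x z
    unfolding conv_def
  proof (rule integral_dominated_convergence[where w="\<lambda>w. B * \<bar>U w\<bar>"])
    show "integrable lborel (\<lambda>w. B * \<bar>U w\<bar>)" using U by auto
    have "isCont k y" for y using k by (simp add: continuous_on_eq_continuous_at)
    then show "AE w in lborel. (\<lambda>n. k (x n - w) * U w) \<longlonglongrightarrow> k (z - w) * U w"
      by (intro AE_I2 tendsto_mult tendsto_const isCont_tendsto_compose[where g = k] tendsto_diff x)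
    show "AE w in lborel. norm (k (x n - w) * U w) \<le> B * \<bar>U w\<bar>" for n
      using b by (intro AE_I2) (simp add: abs_mult mult_right_mono)
  qed auto
  then show ?thesis by (auto simp: continuous_on_sequentially o_def)
qed

text \<open>Differentiation under the integral sign. The difference quotients of k are bounded by B'
  through the mean value inequality, which gives the majorant B' |U| for dominated convergence along
  sequences tending to 0.\<close>

lemma conv_has_directional_derivative:
  fixes k k' U :: "'a::euclidean_space \<Rightarrow> real"
  assumes k[measurable]: "k \<in> borel_measurable borel" and k'[measurable]: "k' \<in> borel_measurable borel"
    and B: "\<And>y. \<bar>k y\<bar> \<le> B" and B': "\<And>y. \<bar>k' y\<bar> \<le> B'"
    and d: "\<And>y. ((\<lambda>h. k (y + h *\<^sub>R v)) has_real_derivative k' y) (at 0)"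
    and U: "integrable lborel U"
  shows "((\<lambda>h. conv k U (z + h *\<^sub>R v)) has_real_derivative conv k' U z) (at 0)"
proof -
  have [measurable]: "U \<in> borel_measurable borel" using U by auto
  \<comment> \<open>Shifting the base point turns the hypothesis at parameter 0 into
    differentiability along the whole line, as the mean value inequality requires.\<close>
  have dl: "((\<lambda>h. k (y + h *\<^sub>R v)) has_real_derivative k' (y + a *\<^sub>R v)) (at a)" for y a
  proof -
    have "((\<lambda>h. k ((y + a *\<^sub>R v) + h *\<^sub>R v)) has_real_derivative k' (y + a *\<^sub>R v)) (at (a - a))"
      using d by simp
    then have "((\<lambda>h. k ((y + a *\<^sub>R v) + (h - a) *\<^sub>R v)) has_real_derivative k' (y + a *\<^sub>R v) * 1) (at a)"
      by (rule DERIV_chain2) (auto intro!: derivative_eq_intros)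
    then show ?thesis by (simp add: algebra_simps)
  qed
  have lip: "\<bar>k (y + h *\<^sub>R v) - k y\<bar> \<le> B' * \<bar>h\<bar>" for y h
  proof -
    have "norm (k (y + h *\<^sub>R v) - k (y + 0 *\<^sub>R v)) \<le> B' * norm (h - 0)"
      by (rule field_differentiable_bound[of UNIV "\<lambda>h. k (y + h *\<^sub>R v)"]) (use dl B' in auto)
    then show ?thesis by simp
  qed
  have "(\<lambda>n. (conv k U (z + x n *\<^sub>R v) - conv k U z) / x n) \<longlonglongrightarrow> conv k' U z"
    if x: "\<And>n. x n \<noteq> 0" "x \<longlonglongrightarrow> 0" for x
  proof -
    have "(conv k U (z + x n *\<^sub>R v) - conv k U z) / x n
        = (\<integral>w. (k (z - w + x n *\<^sub>R v) - k (z - w)) / x n * U w \<partial>lborel)" for n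
    proof -
      have "conv k U (z + x n *\<^sub>R v) - conv k U z
          = (\<integral>w. k (z + x n *\<^sub>R v - w) * U w - k (z - w) * U w \<partial>lborel)"
        unfolding conv_def
        by (rule Bochner_Integration.integral_diff[symmetric]; rule integrable_conv_integrand[OF k B U])
      also have "\<dots> / x n = (\<integral>w. (k (z + x n *\<^sub>R v - w) * U w - k (z - w) * U w) / x n \<partial>lborel)"
        by simp
      finally show ?thesis by (simp add: algebra_simps diff_divide_distrib)
    qed
    moreover have "(\<lambda>n. \<integral>w. (k (z - w + x n *\<^sub>R v) - k (z - w)) / x n * U w \<partial>lborel)
        \<longlonglongrightarrow> (\<integral>w. k' (z - w) * U w \<partial>lborel)"
    proof (rule integral_dominated_convergence[where w="\<lambda>w. B' * \<bar>U w\<bar>"])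
      show "integrable lborel (\<lambda>w. B' * \<bar>U w\<bar>)" using U by auto
      show "AE w in lborel. (\<lambda>n. (k (z - w + x n *\<^sub>R v) - k (z - w)) / x n * U w) \<longlonglongrightarrow> k' (z - w) * U w"
      proof (intro AE_I2 tendsto_mult tendsto_const)
        fix w
        have "((\<lambda>h. (k (z - w + h *\<^sub>R v) - k (z - w)) / h) \<longlongrightarrow> k' (z - w)) (at 0)"
          using d[of "z - w"] by (simp add: DERIV_def)
        moreover have "filterlim x (at 0) sequentially"
          using x by (simp add: filterlim_at)
        ultimately show "(\<lambda>n. (k (z - w + x n *\<^sub>R v) - k (z - w)) / x n) \<longlonglongrightarrow> k' (z - w)"
          by (rule filterlim_compose)
      qed
      show "AE w in lborel. norm ((k (z - w + x n *\<^sub>R v) - k (z - w)) / x n * U w) \<le> B' * \<bar>U w\<bar>" for n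
      proof (rule AE_I2)
        fix w
        have "\<bar>(k (z - w + x n *\<^sub>R v) - k (z - w)) / x n\<bar> \<le> B'"
          using lip[of "z - w" "x n"] x(1)[of n] by (simp add: divide_le_eq)
        then show "norm ((k (z - w + x n *\<^sub>R v) - k (z - w)) / x n * U w) \<le> B' * \<bar>U w\<bar>"
          unfolding real_norm_def abs_mult by (rule mult_right_mono) simp
      qed
    qed auto
    ultimately show ?thesis by (simp only: conv_def[of k' U z])
  qed
  then have "((\<lambda>h. (conv k U (z + h *\<^sub>R v) - conv k U z) / h) \<longlongrightarrow> conv k' U z) (at 0)"
    by (auto simp: tendsto_at_iff_sequentially o_def)
  then show ?thesis by (simp add: DERIV_def)
qed

lemma conv_eq_0:
  assumes "\<And>y. norm y > r \<Longrightarrow> k y = 0" "\<And>w. norm w > R \<Longrightarrow> U w = 0" "norm z > r + R"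
  shows "conv k U z = 0"
proof -
  have "(\<lambda>w. k (z - w) * U w) = (\<lambda>w. 0)"
  proof
    fix w
    show "k (z - w) * U w = 0"
      using assms norm_triangle_sub[of z w] by (cases "norm w > R") auto
  qed
  then show ?thesis by (simp add: conv_def)
qed

section \<open>The Sobolev inequality for weakly differentiable functions\<close>

lemma epowr_measurable[measurable]: "(\<lambda>x. epowr x a) \<in> borel_measurable borel"
  unfolding epowr_def by measurable

lemma epowr_epowr_inverse: "0 < a \<Longrightarrow> epowr (epowr x a) (1 / a) = x"
  by (cases x) (auto simp: epowr_def powr_powr)

text \<open>A positive power is increasing on [0, \<infinity>] and is inverted by the power 1 / a,
  so strict lower bounds can be moved through it. This lets the cube root be combined with Fatou's
  lemma.\<close>

lemma epowr_le_liminf: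
  assumes a: "0 < a" and X: "X \<le> liminf Y"
  shows "epowr X a \<le> liminf (\<lambda>n. epowr (Y n) a)"
  unfolding le_Liminf_iff
proof (intro allI impI)
  fix y assume y: "y < epowr X a"
  have i: "epowr (epowr y (1 / a)) a = y"
    using epowr_epowr_inverse[of "1 / a" y] a by simp
  have "epowr y (1 / a) < X"
    using epowr_mono[of X "epowr y (1 / a)" a] a y i by (auto simp: not_le[symmetric])
  then have "\<forall>\<^sub>F n in sequentially. epowr y (1 / a) < Y n"
    using X unfolding le_Liminf_iff by blast
  then show "\<forall>\<^sub>F n in sequentially. y < epowr (Y n) a"
  proof eventually_elim
    case (elim n)
    show ?case
    proof (rule ccontr)
      assume "\<not> y < epowr (Y n) a"
      then have "epowr (epowr (Y n) a) (1 / a) \<le> epowr y (1 / a)"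
        using a by (intro epowr_mono) auto
      then show False using elim epowr_epowr_inverse[OF a, of "Y n"] by simp
    qed
  qed
qed

text \<open>Tonelli applied to the indicator of a measurable null set containing the exceptional
  set, which need not be measurable itself. The outer variable is the second one, that is,
  time.\<close>

lemma AE_lborel_swap:
  assumes "AE z in (lborel :: ('a::euclidean_space \<times> 'b::euclidean_space) measure). P z"
  shows "AE y in lborel. AE x in lborel. P (x, y)"
proof -
  obtain N where N: "{z. \<not> P z} \<subseteq> N" "N \<in> null_sets lborel"
    using assms by (auto elim!: AE_E simp: null_sets_def)
  have [measurable]: "N \<in> sets (lborel \<Otimes>\<^sub>M lborel)" unfolding lborel_prod using N by auto
  have "(\<integral>\<^sup>+y. \<integral>\<^sup>+x. indicator N (x, y) \<partial>lborel \<partial>lborel) = (\<integral>\<^sup>+z. indicator N z \<partial>(lborel \<Otimes>\<^sub>M lborel))"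
    by (rule lborel_pair.nn_integral_snd) measurable
  also have "\<dots> = 0" using N by (simp add: lborel_prod null_sets_def)
  finally have "AE y in lborel. (\<integral>\<^sup>+x. indicator N (x, y) \<partial>lborel) = 0"
    by (subst (asm) nn_integral_0_iff_AE) auto
  then show ?thesis
  proof eventually_elim
    case (elim y)
    then have "AE x in lborel. indicator N (x, y) = (0 :: ennreal)"
      by (subst (asm) nn_integral_0_iff_AE) auto
    then show ?case by eventually_elim (use N in \<open>auto simp: indicator_def split: if_splits\<close>)
  qed
qed

section \<open>Mollifiers on space-time\<close>

definition bump :: "real \<Rightarrow> spacetime \<Rightarrow> real" where
  "bump m z = (\<Prod>i\<in>UNIV. hat (m * fst z $ i)) * hat (m * snd z)"

text \<open>Normalised separately for each m by its own integral, so that no change of variables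
  under dilation is needed.\<close>

definition mollifier :: "real \<Rightarrow> spacetime \<Rightarrow> real" where
  "mollifier m z = bump m z * (1 / (\<integral>w. bump m w \<partial>lborel))"

lemma bounded_linear_coord:
  "bounded_linear (\<lambda>z :: spacetime. m * fst z $ i)" "bounded_linear (\<lambda>z :: spacetime. m * snd z)"
  by (auto intro!: bounded_linear_const_mult bounded_linear_fst bounded_linear_snd
      bounded_linear_compose[OF bounded_linear_vec_nth bounded_linear_fst])

lemma smooth_elem_bump: "smooth_elem (bump m)"
  unfolding bump_def
  using smooth_elem_hat[OF bounded_linear_coord(1), of m _ 0] smooth_elem_hat[OF bounded_linear_coord(2), of m 0]
  by (auto intro!: smooth_elem.mult smooth_elem_prod)

lemma smooth_elem_mollifier: "smooth_elem (mollifier m)"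
  unfolding mollifier_def by (intro smooth_elem.mult smooth_elem_bump smooth_elem.const)

lemma bump_range: "0 \<le> bump m z" "bump m z \<le> 1"
  unfolding bump_def by (auto intro!: mult_nonneg_nonneg prod_nonneg mult_le_one prod_le_1 simp: hat_simps)

lemma norm_spacetime_le:
  fixes z :: spacetime
  shows "norm z \<le> (\<Sum>i\<in>UNIV. \<bar>fst z $ i\<bar>) + \<bar>snd z\<bar>"
  using norm_le_l1_cart[of "fst z"] norm_Pair_le[of "fst z" "snd z"] by simp

text \<open>Each of the four coordinates is at most \<open>1 / m\<close> in absolute value on the
  support, and the norm is at most their sum.\<close>

lemma bump_support:
  assumes m: "m > 0" and z: "norm z > 4 / m"
  shows "bump m z = 0"
proof (rule ccontr)
  assume "bump m z \<noteq> 0"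
  then have "\<And>i. hat (m * fst z $ i) \<noteq> 0" "hat (m * snd z) \<noteq> 0" by (auto simp: bump_def)
  then have "\<bar>m * fst z $ i\<bar> < 1" "\<bar>m * snd z\<bar> < 1" for i
    using hat_simps(4) not_le by blast+
  then have c: "\<bar>fst z $ i\<bar> \<le> 1 / m" "\<bar>snd z\<bar> \<le> 1 / m" for i
    using m by (auto simp: abs_mult field_simps less_imp_le)
  then have "norm z \<le> 1 / m + 1 / m + 1 / m + 1 / m"
    using norm_spacetime_le[of z] c(1)[of 1] c(1)[of 2] c(1)[of 3] c(2) unfolding sum_3 by linarith
  then show False using z by simp
qed

lemma bump_integrable: "m > 0 \<Longrightarrow> integrable lborel (bump m)"
  by (rule integrable_continuous_support[OF smooth_elem_continuous[OF smooth_elem_bump] bump_support])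

lemma bump_integral_pos:
  assumes m: "m > 0"
  shows "0 < (\<integral>w. bump m w \<partial>lborel)"
proof -
  let ?B = "ball (0 :: spacetime) (1 / (2 * m))"
  have fin: "emeasure lborel ?B < \<infinity>" by (intro emeasure_bounded_finite bounded_ball)
  have "exp (- 4 :: real) ^ 4 * indicator ?B w \<le> bump m w" for w
  proof (cases "w \<in> ?B")
    case True
    have "\<bar>fst w $ i\<bar> \<le> norm w" "\<bar>snd w\<bar> \<le> norm w" for i
      using component_le_norm_cart[of "fst w" i] norm_fst_le[of "fst w" "snd w"] norm_snd_le[of "snd w" "fst w"]
      by auto
    then have "\<bar>fst w $ i\<bar> < 1 / (2 * m)" "\<bar>snd w\<bar> < 1 / (2 * m)" for i
      using True by (auto intro: le_less_trans)
    then have *: "\<bar>m * fst w $ i\<bar> \<le> 1 / 2" "\<bar>m * snd w\<bar> \<le> 1 / 2" for i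
      using m by (auto simp: abs_mult field_simps less_imp_le)
    have "(\<Prod>i\<in>(UNIV :: 3 set). exp (- 4)) * exp (- 4) \<le> bump m w"
      unfolding bump_def by (intro mult_mono prod_mono hat_simps conjI * prod_nonneg) (auto simp: hat_simps)
    then show ?thesis using True by (simp add: power_numeral_reduce)
  qed (simp add: bump_range)
  then have "(\<integral>w. exp (- 4 :: real) ^ 4 * indicator ?B w \<partial>lborel) \<le> (\<integral>w. bump m w \<partial>lborel)"
    using fin by (intro integral_mono bump_integrable m integrable_mult_right integrable_real_indicator) auto
  moreover have "0 < measure lborel ?B" using m content_ball_pos[of "1 / (2 * m)" "0 :: spacetime"] by simp
  then have "0 < (\<integral>w. exp (- 4 :: real) ^ 4 * indicator ?B w \<partial>lborel)" using fin by simp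
  ultimately show ?thesis by linarith
qed

lemma mollifier_props:
  assumes m: "m > 0"
  shows "0 \<le> mollifier m z" "mollifier m z \<le> 1 / (\<integral>w. bump m w \<partial>lborel)"
    "(\<integral>\<^sup>+z. ennreal (mollifier m z) \<partial>lborel) = 1" "norm z > 4 / m \<Longrightarrow> mollifier m z = 0"
proof -
  note p = bump_integral_pos[OF m]
  show "0 \<le> mollifier m z" for z using p by (simp add: mollifier_def bump_range)
  then have "(\<integral>\<^sup>+z. ennreal (mollifier m z) \<partial>lborel) = ennreal (\<integral>z. mollifier m z \<partial>lborel)"
    by (intro nn_integral_eq_integral) (auto simp: mollifier_def[abs_def] bump_integrable m)
  then show "(\<integral>\<^sup>+z. ennreal (mollifier m z) \<partial>lborel) = 1"
    using p by (simp add: mollifier_def[abs_def])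
  show "mollifier m z \<le> 1 / (\<integral>w. bump m w \<partial>lborel)"
    using p bump_range[of m z] by (simp add: mollifier_def divide_right_mono)
  show "norm z > 4 / m \<Longrightarrow> mollifier m z = 0" by (simp add: mollifier_def bump_support m)
qed

section \<open>Spatial derivatives as derivatives along lines\<close>

lemma smooth_elem_dx: "smooth_elem u \<Longrightarrow> smooth_elem (dx j u)"
  unfolding dx_def[abs_def] by (rule smooth_elem_frechet(2))

lemma dx_line_derivative:
  assumes "smooth_elem u"
  shows "((\<lambda>h. u (z + h *\<^sub>R (axis j 1, 0))) has_real_derivative dx j u z) (at 0)"
proof -
  let ?F = "frechet_derivative u (at z)"
  have "((\<lambda>h. z + h *\<^sub>R (axis j 1, 0)) has_derivative (\<lambda>h. h *\<^sub>R (axis j 1, 0))) (at 0)"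
    by (auto intro!: derivative_eq_intros)
  moreover have "(u has_derivative ?F) (at (z + 0 *\<^sub>R (axis j 1, 0)))"
    using smooth_elem_frechet(1)[OF assms] by (simp add: zero_prod_def[symmetric])
  ultimately have "((\<lambda>h. u (z + h *\<^sub>R (axis j 1, 0))) has_derivative (\<lambda>h. ?F (h *\<^sub>R (axis j 1, 0)))) (at 0)"
    by (rule has_derivative_compose)
  moreover have "(\<lambda>h. ?F (h *\<^sub>R (axis j 1, 0))) = (*) (dx j u z)"
  proof
    fix h
    show "?F (h *\<^sub>R (axis j 1, 0)) = dx j u z * h"
    using linear_scale[OF has_derivative_linear[OF smooth_elem_frechet(1)[OF assms]], of z h "(axis j 1, 0)"]
      by (simp add: dx_def)
  qed
  ultimately show ?thesis by (simp only: has_field_derivative_def)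
qed

text \<open>Differentiability of u is already known, so a derivative along a single line identifies
  \<open>dx j u z\<close>. This reduces every computation of \<open>dx\<close> below to calculus in
  one real variable.\<close>

lemma dx_eqI:
  assumes "smooth_elem u" "((\<lambda>h. u (z + h *\<^sub>R (axis j 1, 0))) has_real_derivative D) (at 0)"
  shows "dx j u z = D"
  using DERIV_unique[OF dx_line_derivative[OF assms(1)] assms(2)] .

lemma dx_eq_0:
  assumes "smooth_elem u" "\<And>y. norm y > r \<Longrightarrow> u y = 0" "norm z > r"
  shows "dx j u z = 0"
proof (rule dx_eqI[OF assms(1)])
  have "isCont (\<lambda>h. norm (z + h *\<^sub>R (axis j 1 :: space, 0 :: real))) 0" by (intro continuous_intros)
  then have "\<forall>\<^sub>F h in at 0. norm (z + h *\<^sub>R (axis j 1 :: space, 0 :: real)) > r"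
    using assms(3) by (auto simp: isCont_def zero_prod_def[symmetric] intro!: order_tendstoD)
  then have "\<forall>\<^sub>F h in at 0. u (z + h *\<^sub>R (axis j 1, 0)) = 0"
    by (rule eventually_mono) (rule assms(2))
  then have "\<forall>\<^sub>F h in nhds 0. u (z + h *\<^sub>R (axis j 1, 0)) = 0"
    using assms(2)[OF assms(3)] by (simp add: eventually_nhds_conv_at zero_prod_def[symmetric])
  then show "((\<lambda>h. u (z + h *\<^sub>R (axis j 1, 0))) has_real_derivative 0) (at 0)"
    by (subst DERIV_cong_ev[OF refl _ refl, of _ "\<lambda>h. 0"]) auto
qed

lemma dx_bounded:
  assumes "smooth_elem u" "\<And>y. norm y > r \<Longrightarrow> u y = 0"
  obtains B where "\<And>y. \<bar>dx j u y\<bar> \<le> B"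
proof -
  have "compact (dx j u ` cball 0 r)"
    by (intro compact_continuous_image smooth_elem_continuous smooth_elem_dx assms) auto
  then obtain B where "\<forall>x\<in>dx j u ` cball 0 r. norm x \<le> B"
    using compact_imp_bounded bounded_iff by blast
  then have B: "y \<in> cball 0 r \<Longrightarrow> \<bar>dx j u y\<bar> \<le> B" for y
    by (metis imageI real_norm_def)
  have "\<bar>dx j u y\<bar> \<le> max B 0" for y
    using B[of y] dx_eq_0[OF assms, where z = y] by (cases "norm y > r") auto
  then show thesis using that by blast
qed

lemma dx_reflect:
  assumes "smooth_elem u"
  shows "smooth_elem (\<lambda>w. u (z - w))" "dx j (\<lambda>w. u (z - w)) w = - dx j u (z - w)"
proof -
  show s: "smooth_elem (\<lambda>w. u (z - w))" using smooth_elem_affine[OF assms, of z "- 1"] by simp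
  have "((\<lambda>h. u (z - w + h *\<^sub>R (axis j 1, 0))) has_real_derivative dx j u (z - w)) (at (- 0))"
    using dx_line_derivative[OF assms, of "z - w" j] by simp
  then have "((\<lambda>h. u (z - w + (- h) *\<^sub>R (axis j 1, 0))) has_real_derivative dx j u (z - w) * (- 1)) (at 0)"
    by (rule DERIV_chain2) (auto intro!: derivative_eq_intros)
  then show "dx j (\<lambda>w. u (z - w)) w = - dx j u (z - w)"
    by (intro dx_eqI s) (simp add: algebra_simps del: scaleR_Pair)
qed

text \<open>On the bounded support, |U| \<le> U^2 + 1, and the constant 1 has finite integral
  there.\<close>

lemma integrable_of_square_integrable:
  fixes U :: "'a::euclidean_space \<Rightarrow> real"
  assumes [measurable]: "U \<in> borel_measurable borel" and z: "\<And>w. norm w > R \<Longrightarrow> U w = 0"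
    and s: "(\<integral>\<^sup>+w. ennreal ((U w)\<^sup>2) \<partial>lborel) < \<infinity>"
  shows "integrable lborel U"
proof (rule integrableI_bounded)
  have "(\<integral>\<^sup>+w. ennreal (norm (U w)) \<partial>lborel) \<le> (\<integral>\<^sup>+w. ennreal ((U w)\<^sup>2) + indicator (cball 0 R) w \<partial>lborel)"
  proof (rule nn_integral_mono)
    fix w
    have "\<bar>U w\<bar> \<le> (U w)\<^sup>2 + 1"
      using zero_le_power2[of "\<bar>U w\<bar> - 1"] zero_le_power2[of "U w"]
      unfolding power2_diff power2_abs one_power2 mult_1_right using abs_ge_zero[of "U w"] by linarith
    then have "ennreal \<bar>U w\<bar> \<le> ennreal ((U w)\<^sup>2) + 1"
      by (metis ennreal_1 ennreal_leI ennreal_plus zero_le_one zero_le_power2)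
    then show "ennreal (norm (U w)) \<le> ennreal ((U w)\<^sup>2) + indicator (cball 0 R) w"
      using z[of w] by (cases "norm w > R") auto
  qed
  also have "\<dots> = (\<integral>\<^sup>+w. ennreal ((U w)\<^sup>2) \<partial>lborel) + emeasure lborel (cball (0 :: 'a) R)"
    by (subst nn_integral_add) (auto intro!: borel_measurable_indicator)
  also have "\<dots> < \<infinity>"
    using s emeasure_bounded_finite[OF bounded_cball, of "0 :: 'a" R] by simp
  finally show "(\<integral>\<^sup>+w. ennreal (norm (U w)) \<partial>lborel) < \<infinity>" .
qed simp

text \<open>Mollifying in space and time at once avoids having to show that almost every time slice of
  \<open>U\<close> has a weak gradient.\<close>

lemma weak_Sobolev:
  fixes U :: "spacetime \<Rightarrow> real" and H :: "3 \<Rightarrow> spacetime \<Rightarrow> real"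
  assumes Um[measurable]: "U \<in> borel_measurable borel" and Hm[measurable]: "\<And>j. H j \<in> borel_measurable borel"
    and Uz: "\<And>z. norm z > R \<Longrightarrow> U z = 0" and Hz: "\<And>j z. norm z > R \<Longrightarrow> H j z = 0"
    and U2: "(\<integral>\<^sup>+z. ennreal ((U z)\<^sup>2) \<partial>lborel) < \<infinity>"
    and H2: "\<And>j. (\<integral>\<^sup>+z. ennreal ((H j z)\<^sup>2) \<partial>lborel) < \<infinity>"
    and weak: "\<And>\<psi> r j. smooth_elem \<psi> \<Longrightarrow> (\<And>z. norm z > r \<Longrightarrow> \<psi> z = 0)
      \<Longrightarrow> (\<integral>z. U z * dx j \<psi> z \<partial>lborel) = - (\<integral>z. H j z * \<psi> z \<partial>lborel)"
  shows "(\<integral>\<^sup>+t. epowr (\<integral>\<^sup>+x. ennreal (U (x, t) ^ 6) \<partial>lborel) (1 / 3) \<partial>lborel)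
    \<le> 16 * (\<Sum>j\<in>UNIV. \<integral>\<^sup>+z. ennreal ((H j z)\<^sup>2) \<partial>lborel)"
proof -
  have Ui: "integrable lborel U" and Hi: "integrable lborel (H j)" for j
    by (rule integrable_of_square_integrable[OF Um Uz U2, of R] integrable_of_square_integrable[OF Hm Hz H2, of R];
        assumption)+
  define k where "k n = mollifier (real (Suc n))" for n
  define B where "B n = 1 / (\<integral>w. bump (real (Suc n)) w \<partial>lborel)" for n
  have ks: "smooth_elem (k n)" for n by (simp add: k_def smooth_elem_mollifier)
  have kc: "continuous_on UNIV (k n)" "continuous_on UNIV (dx j (k n))" for n j
    by (intro smooth_elem_continuous smooth_elem_dx ks)+
  have km[measurable]: "k n \<in> borel_measurable borel" and dkm[measurable]: "dx j (k n) \<in> borel_measurable borel" for n j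
    using kc by (auto intro: borel_measurable_continuous_onI)
  have k0: "0 \<le> k n y" and kB: "k n y \<le> B n" and k1: "(\<integral>\<^sup>+y. ennreal (k n y) \<partial>lborel) = 1"
    and kz: "norm y > 4 / real (Suc n) \<Longrightarrow> k n y = 0" for n y
    unfolding k_def B_def by (intro mollifier_props; simp)+
  have kz4: "k n y = 0" if "norm y > 4" for n y
  proof (rule kz)
    have "4 / real (Suc n) \<le> 4" by (simp add: field_simps)
    then show "norm y > 4 / real (Suc n)" using that by simp
  qed
  have kb: "\<bar>k n y\<bar> \<le> B n" for n y using k0 kB by simp
  have "\<exists>B. \<forall>y. \<bar>dx j (k n) y\<bar> \<le> B" for j n
    by (rule dx_bounded[OF ks[of n], of 4 j]) (auto intro: kz4)
  then obtain B' where B': "\<bar>dx j (k n) y\<bar> \<le> B' j n" for j n y by metis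
  define u where "u n = conv (k n) U" for n
  have uc: "continuous_on UNIV (u n)" for n unfolding u_def by (rule continuous_conv[OF kc(1) kb Ui])
  have um[measurable]: "u n \<in> borel_measurable borel" for n using uc by (rule borel_measurable_continuous_onI)
  have uz: "u n z = 0" if "norm z > 4 + R" for n z
    unfolding u_def by (rule conv_eq_0[OF kz4 Uz that])
  define h where "h j n = conv (k n) (H j)" for j n
  have hc: "continuous_on UNIV (h j n)" for j n unfolding h_def by (rule continuous_conv[OF kc(1) kb Hi])
  have hm[measurable]: "h j n \<in> borel_measurable borel" for j n using hc by (rule borel_measurable_continuous_onI)
  \<comment> \<open>The derivative falls on the mollifier, and the weak identity with test function
    \<open>k n (z - w)\<close> moves it to U. The minus sign of the reflection and that of the
    integration by parts cancel.\<close>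
  have hd: "((\<lambda>a. u n (z + a *\<^sub>R (axis j 1, 0))) has_real_derivative h j n z) (at 0)" for n j z
  proof -
    have "((\<lambda>a. u n (z + a *\<^sub>R (axis j 1, 0))) has_real_derivative conv (dx j (k n)) U z) (at 0)"
      unfolding u_def
      by (rule conv_has_directional_derivative[OF km dkm kb B' dx_line_derivative[OF ks] Ui])
    also have "conv (dx j (k n)) U z = - (\<integral>w. U w * dx j (\<lambda>w. k n (z - w)) w \<partial>lborel)"
      by (simp add: conv_def dx_reflect(2)[OF ks] mult.commute)
    also have "\<dots> = (\<integral>w. H j w * k n (z - w) \<partial>lborel)"
    proof (subst weak)
      show "smooth_elem (\<lambda>w. k n (z - w))" by (rule dx_reflect(1)[OF ks])
      show "k n (z - w) = 0" if "norm w > 4 + norm z" for w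
        using that norm_triangle_sub[of w z] by (intro kz4) (simp add: norm_minus_commute)
    qed simp
    also have "\<dots> = h j n z" by (simp add: h_def conv_def mult.commute)
    finally show ?thesis .
  qed
  have slice: "epowr (\<integral>\<^sup>+x. ennreal (u n (x, t) ^ 6) \<partial>lborel) (1 / 3)
      \<le> 16 * (\<Sum>j\<in>UNIV. \<integral>\<^sup>+x. ennreal (h j n (x, t) ^ 2) \<partial>lborel)" for n t
  proof (rule Sobolev_smooth_vec3[where R = "4 + R"])
    show "continuous_on UNIV (\<lambda>x. u n (x, t))" "continuous_on UNIV (\<lambda>x. h j n (x, t))" for j
      by (rule continuous_on_compose2[OF uc] continuous_on_compose2[OF hc]; auto intro!: continuous_intros)+
    show "((\<lambda>a. u n (x + a *\<^sub>R axis j 1, t)) has_real_derivative h j n (x, t)) (at 0)" for j x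
      using hd[of n "(x, t)" j] by simp
    show "4 + R < norm x \<Longrightarrow> u n (x, t) = 0" for x
      using norm_fst_le[of x t] by (intro uz) auto
  qed
  \<comment> \<open>The smooth inequality holds at every single time. Its right side, integrated in
    t, is uniform in n because mollification does not increase the L_2 norm of
    \<open>H j\<close>.\<close>
  have total: "(\<integral>\<^sup>+t. epowr (\<integral>\<^sup>+x. ennreal (u n (x, t) ^ 6) \<partial>lborel) (1 / 3) \<partial>lborel)
      \<le> 16 * (\<Sum>j\<in>UNIV. \<integral>\<^sup>+z. ennreal ((H j z)\<^sup>2) \<partial>lborel)" for n
  proof -
    have "(\<integral>\<^sup>+t. epowr (\<integral>\<^sup>+x. ennreal (u n (x, t) ^ 6) \<partial>lborel) (1 / 3) \<partial>lborel)
        \<le> (\<integral>\<^sup>+t. 16 * (\<Sum>j\<in>UNIV. \<integral>\<^sup>+x. ennreal (h j n (x, t) ^ 2) \<partial>lborel) \<partial>lborel)"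
      by (intro nn_integral_mono slice)
    also have "\<dots> = 16 * (\<Sum>j\<in>UNIV. \<integral>\<^sup>+t. \<integral>\<^sup>+x. ennreal (h j n (x, t) ^ 2) \<partial>lborel \<partial>lborel)"
      by (simp add: nn_integral_cmult nn_integral_sum)
    also have "\<dots> = 16 * (\<Sum>j\<in>UNIV. \<integral>\<^sup>+z. ennreal (h j n z ^ 2) \<partial>lborel)"
      unfolding lborel_prod[symmetric]
      by (intro arg_cong2[where f = "(*)"] sum.cong refl lborel_pair.nn_integral_snd) (simp add: lborel_prod)
    also have "\<dots> \<le> 16 * (\<Sum>j\<in>UNIV. \<integral>\<^sup>+z. ennreal ((H j z)\<^sup>2) \<partial>lborel)"
      unfolding h_def by (intro mult_left_mono sum_mono conv_L2_le Hm km k0 k1) auto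
    finally show ?thesis .
  qed
  have ui: "integrable lborel (u n)" for n
    by (rule integrable_continuous_support[OF uc uz])
  have "(\<lambda>n. \<integral>\<^sup>+z. ennreal \<bar>conv (k n) U z - U z\<bar> \<partial>lborel) \<longlonglongrightarrow> 0"
  proof (rule conv_tendsto_L1[OF km k0 kB k1 kz _ Ui])
    show "(\<lambda>n. 4 / real (Suc n)) \<longlonglongrightarrow> 0"
      using tendsto_mult_right[OF LIMSEQ_inverse_real_of_nat, of 4] by (simp add: divide_inverse)
  qed auto
  then have "(\<lambda>n. \<integral>\<^sup>+z. ennreal \<bar>u n z - U z\<bar> \<partial>lborel) \<longlonglongrightarrow> 0" by (simp add: u_def)
  also have "(\<lambda>n. \<integral>\<^sup>+z. ennreal \<bar>u n z - U z\<bar> \<partial>lborel) = (\<lambda>n. ennreal (\<integral>z. norm (u n z - U z) \<partial>lborel))"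
    using ui Ui by (intro ext, subst nn_integral_eq_integral) auto
  finally have "(\<lambda>n. \<integral>z. norm (u n z - U z) \<partial>lborel) \<longlonglongrightarrow> 0"
    by (simp add: tendsto_ennreal_iff[where x = 0, simplified])
  then obtain r :: "nat \<Rightarrow> nat" where "AE z in lborel. (\<lambda>n. u (r n) z - U z) \<longlonglongrightarrow> 0"
    using tendsto_L1_AE_subseq[of lborel "\<lambda>n z. u n z - U z"] ui Ui by auto
  \<comment> \<open>Almost every time slice now converges almost everywhere in space. Fatou is
    applied twice: in x beneath the cube root, then in t.\<close>
  then have ae: "AE t in lborel. AE x in lborel. (\<lambda>n. u (r n) (x, t)) \<longlonglongrightarrow> U (x, t)"
    by (intro AE_lborel_swap) (auto elim!: eventually_mono intro: LIM_zero_cancel)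
  have "(\<integral>\<^sup>+t. epowr (\<integral>\<^sup>+x. ennreal (U (x, t) ^ 6) \<partial>lborel) (1 / 3) \<partial>lborel)
      \<le> (\<integral>\<^sup>+t. liminf (\<lambda>n. epowr (\<integral>\<^sup>+x. ennreal (u (r n) (x, t) ^ 6) \<partial>lborel) (1 / 3)) \<partial>lborel)"
  proof (rule nn_integral_mono_AE, use ae in eventually_elim)
    case (elim t)
    have "(\<integral>\<^sup>+x. ennreal (U (x, t) ^ 6) \<partial>lborel) = (\<integral>\<^sup>+x. liminf (\<lambda>n. ennreal (u (r n) (x, t) ^ 6)) \<partial>lborel)"
    proof (rule nn_integral_cong_AE, use elim in eventually_elim)
      case (elim x)
      have "(\<lambda>n. ennreal (u (r n) (x, t) ^ 6)) \<longlonglongrightarrow> ennreal (U (x, t) ^ 6)"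
        by (intro tendsto_ennrealI tendsto_power elim)
      then show ?case by (rule lim_imp_Liminf[OF trivial_limit_sequentially, symmetric])
    qed
    also have "\<dots> \<le> liminf (\<lambda>n. \<integral>\<^sup>+x. ennreal (u (r n) (x, t) ^ 6) \<partial>lborel)"
      by (rule nn_integral_liminf) measurable
    finally show ?case by (intro epowr_le_liminf) auto
  qed
  also have "\<dots> \<le> liminf (\<lambda>n. \<integral>\<^sup>+t. epowr (\<integral>\<^sup>+x. ennreal (u (r n) (x, t) ^ 6) \<partial>lborel) (1 / 3) \<partial>lborel)"
    by (rule nn_integral_liminf) measurable
  also have "\<dots> \<le> 16 * (\<Sum>j\<in>UNIV. \<integral>\<^sup>+z. ennreal ((H j z)\<^sup>2) \<partial>lborel)"
    by (rule order_trans[OF Liminf_le_Limsup Limsup_bounded]) (auto simp: total)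
  finally show ?thesis .
qed

section \<open>A local Sobolev inequality\<close>

lemma hat_deriv_eq_0: "\<bar>y\<bar> \<ge> 1 \<Longrightarrow> hat_deriv y = 0"
  by (auto simp: hat_deriv_def bexp_def)

text \<open>The factor \<open>exp 14\<close> makes the cutoff at least 1 where \<open>\<bar>x\<^sub>i\<bar> \<le> L / 8\<close> and \<open>t\<close> has distance at
  least \<open>2 / n\<close> from \<open>- a\<close> and \<open>0\<close>. Its spatial derivatives are bounded uniformly in \<open>n\<close>.\<close>

definition cutoff :: "real \<Rightarrow> real \<Rightarrow> real \<Rightarrow> spacetime \<Rightarrow> real" where
  "cutoff L a n z = exp 14 * ((\<Prod>i\<in>UNIV. hat (4 / L * fst z $ i))
     * (bexp 1 (n * (snd z + a) - 1) * bexp 1 (n * (- snd z) - 1)))"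

lemma smooth_elem_cutoff: "smooth_elem (cutoff L a n)"
proof -
  have "smooth_elem (\<lambda>z :: spacetime. exp 14 * ((\<Prod>i\<in>UNIV. hat (4 / L * fst z $ i + 0))
     * (bexp 1 (n * snd z + (n * a - 1)) * bexp 1 (- n * snd z + - 1))))"
    by (intro smooth_elem.intros smooth_elem_prod smooth_elem_hat bounded_linear_coord finite)
  moreover have "n * t + (n * a - 1) = n * (t + a) - 1" "- n * t + - 1 = n * (- t) - 1" for t
    by (simp_all add: distrib_left)
  ultimately show ?thesis by (simp only: cutoff_def[abs_def] add_0_right)
qed

context
  fixes L a n :: real
  assumes L: "L > 0" and a: "a > 0" and n: "n > 0"
begin

lemma cutoff_range: "0 \<le> cutoff L a n z" "cutoff L a n z \<le> exp 14"
proof -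
  have "0 \<le> (\<Prod>i\<in>UNIV. hat (4 / L * fst z $ i))" "(\<Prod>i\<in>UNIV. hat (4 / L * fst z $ i)) \<le> 1"
    by (auto intro!: prod_nonneg prod_le_1 simp: hat_simps)
  moreover have "0 \<le> bexp 1 (n * (snd z + a) - 1) * bexp 1 (n * (- snd z) - 1)"
    "bexp 1 (n * (snd z + a) - 1) * bexp 1 (n * (- snd z) - 1) \<le> 1"
    by (auto intro!: mult_le_one simp: bexp_one)
  ultimately show "0 \<le> cutoff L a n z" "cutoff L a n z \<le> exp 14"
    by (auto simp: cutoff_def intro!: mult_le_one)
qed

text \<open>Because 3/4 < 1, a cutoff supported in the cube of half-width L / 4 vanishes near the
  sphere of radius L.\<close>

lemma norm_le_of_coords:
  fixes x :: space
  assumes "\<And>i. \<bar>x $ i\<bar> \<le> L / 4"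
  shows "norm x \<le> 3 / 4 * L"
  using norm_le_l1_cart[of x] assms[of 1] assms[of 2] assms[of 3] unfolding sum_3 by linarith

lemma cutoff_dx:
  "dx j (cutoff L a n) z = exp 14 * (hat_deriv (4 / L * fst z $ j) * (4 / L)
     * ((\<Prod>i\<in>UNIV - {j}. hat (4 / L * fst z $ i))
        * (bexp 1 (n * (snd z + a) - 1) * bexp 1 (n * (- snd z) - 1))))"
proof (rule dx_eqI[OF smooth_elem_cutoff])
  define P where "P = (\<Prod>i\<in>UNIV - {j}. hat (4 / L * fst z $ i))"
  define T where "T = bexp 1 (n * (snd z + a) - 1) * bexp 1 (n * (- snd z) - 1)"
  have "cutoff L a n (z + h *\<^sub>R (axis j 1, 0)) = exp 14 * (hat (4 / L * (fst z $ j + h)) * (P * T))" for h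
  proof -
    have "(\<Prod>i\<in>UNIV. hat (4 / L * fst (z + h *\<^sub>R (axis j 1, 0)) $ i))
        = hat (4 / L * (fst z $ j + h)) * (\<Prod>i\<in>UNIV - {j}. hat (4 / L * fst (z + h *\<^sub>R (axis j 1, 0)) $ i))"
      by (subst prod.remove[of _ j]) auto
    also have "(\<Prod>i\<in>UNIV - {j}. hat (4 / L * fst (z + h *\<^sub>R (axis j 1, 0)) $ i)) = P"
      unfolding P_def by (intro prod.cong) (auto simp: axis_def)
    finally show ?thesis by (simp add: cutoff_def T_def mult.assoc)
  qed
  moreover have "((\<lambda>h. exp 14 * (hat (4 / L * (fst z $ j + h)) * (P * T))) has_real_derivative
      exp 14 * (hat_deriv (4 / L * fst z $ j) * (4 / L) * (P * T))) (at 0)"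
  proof -
    have "((\<lambda>h. hat (4 / L * (fst z $ j + h))) has_real_derivative hat_deriv (4 / L * (fst z $ j + 0)) * (4 / L)) (at 0)"
      by (rule DERIV_chain2[OF hat_has_real_derivative]) (use L in \<open>auto intro!: derivative_eq_intros\<close>)
    then show ?thesis by (intro DERIV_cmult DERIV_cmult_right) simp
  qed
  ultimately show "((\<lambda>h. cutoff L a n (z + h *\<^sub>R (axis j 1, 0))) has_real_derivative
      exp 14 * (hat_deriv (4 / L * fst z $ j) * (4 / L) * (P * T))) (at 0)"
    by (simp only:)
qed

text \<open>16 / L is the bound 4 for \<open>hat_deriv\<close> times the inner derivative 4 / L; the
  remaining factors are at most 1. The parameter n occurs only in the time factors, which are not
  differentiated.\<close>

lemma cutoff_dx_bound: "\<bar>dx j (cutoff L a n) z\<bar> \<le> exp 14 * (16 / L)"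
proof -
  have "\<bar>\<Prod>i\<in>UNIV - {j}. hat (4 / L * fst z $ i)\<bar> \<le> 1"
    by (simp add: abs_of_nonneg prod_nonneg prod_le_1 hat_simps)
  moreover have "\<bar>bexp 1 (n * (snd z + a) - 1) * bexp 1 (n * (- snd z) - 1)\<bar> \<le> 1"
    by (simp add: abs_of_nonneg bexp_one mult_le_one)
  ultimately have "\<bar>dx j (cutoff L a n) z\<bar> \<le> exp 14 * (4 * (4 / L) * (1 * 1))"
    unfolding cutoff_dx abs_mult using L by (intro mult_mono hat_deriv_bound) auto
  then show ?thesis by simp
qed

lemma cutoff_support:
  assumes z: "z \<notin> cball 0 (3 / 4 * L) \<times> {- a + 1 / n .. - 1 / n}"
  shows "cutoff L a n z = 0" "dx j (cutoff L a n) z = 0"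
proof -
  consider i where "\<bar>fst z $ i\<bar> > L / 4" | "snd z < - a + 1 / n" | "snd z > - 1 / n"
    using z norm_le_of_coords[of "fst z"] by (cases z) (force simp: not_le)
  then have "cutoff L a n z = 0 \<and> dx j (cutoff L a n) z = 0"
  proof cases
    case 1
    then have "\<bar>4 / L * fst z $ i\<bar> \<ge> 1" using L by (simp add: abs_mult field_simps)
    then have h: "hat (4 / L * fst z $ i) = 0" "hat_deriv (4 / L * fst z $ i) = 0"
      using hat_simps(4) hat_deriv_eq_0 by auto
    then have "(\<Prod>i\<in>UNIV. hat (4 / L * fst z $ i)) = 0" by (subst prod_zero_iff) auto
    moreover have "hat_deriv (4 / L * fst z $ j) = 0 \<or> (\<Prod>i\<in>UNIV - {j}. hat (4 / L * fst z $ i)) = 0"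
      using h by (cases "i = j") (auto simp: prod_zero_iff)
    ultimately show ?thesis by (auto simp: cutoff_dx cutoff_def)
  next
    case 2
    then have "n * (snd z + a) - 1 \<le> 0" using n by (simp add: field_simps)
    then show ?thesis by (simp add: cutoff_dx cutoff_def bexp_one)
  next
    case 3
    then have "n * (- snd z) - 1 \<le> 0" using n by (simp add: field_simps)
    then show ?thesis by (simp add: cutoff_dx cutoff_def bexp_one)
  qed
  then show "cutoff L a n z = 0" "dx j (cutoff L a n) z = 0" by auto
qed

lemma cutoff_ge_1:
  assumes x: "x \<in> ball 0 (L / 8)" and t: "2 / n \<le> t + a" "2 / n \<le> - t"
  shows "1 \<le> cutoff L a n (x, t)"
proof -
  have "\<bar>x $ i\<bar> \<le> L / 8" for i
    using x component_le_norm_cart[of x i] by simp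
  then have h: "exp (- 4) \<le> hat (4 / L * x $ i)" for i
    using L by (intro hat_simps) (simp add: abs_mult field_simps)
  have b: "exp (- 1) \<le> bexp 1 y" if "y \<ge> 1" for y
    using that by (simp add: bexp_def)
  \<comment> \<open>14 = 3 * 4 + 1 + 1: three spatial factors, each at least exp(-4) because |4 x_i
    / L| \<le> 1/2, and two time factors, each at least exp(-1).\<close>
  have "1 = exp 14 * ((\<Prod>i\<in>(UNIV :: 3 set). exp (- 4)) * (exp (- 1) * exp (- 1 :: real)))"
    by (simp flip: exp_of_nat_mult exp_add)
  also have "\<dots> \<le> cutoff L a n (x, t)"
    unfolding cutoff_def fst_conv snd_conv
  proof (intro mult_left_mono mult_mono prod_mono conjI h b prod_nonneg)
    show "1 \<le> n * (t + a) - 1" "1 \<le> n * - t - 1" using t n by (simp_all add: field_simps)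
  qed (auto simp: hat_simps bexp_one)
  finally show ?thesis .
qed

end

lemma dx_mult:
  assumes "smooth_elem u" "smooth_elem w"
  shows "dx j (\<lambda>z. u z * w z) z = u z * dx j w z + dx j u z * w z"
proof (rule dx_eqI)
  show "((\<lambda>h. u (z + h *\<^sub>R (axis j 1, 0)) * w (z + h *\<^sub>R (axis j 1, 0))) has_real_derivative
      u z * dx j w z + dx j u z * w z) (at 0)"
    using DERIV_mult[OF dx_line_derivative[OF assms(1), of z j] dx_line_derivative[OF assms(2), of z j]]
    by (simp add: zero_prod_def[symmetric] ac_simps)
qed (intro smooth_elem.mult assms)

text \<open>V is only square integrable on P, and w lives on a compact part of P. This integrability
  is what allows the tested product rule to be split term by term.\<close>

lemma integrable_mult_bounded_support:
  fixes V w :: "'a::euclidean_space \<Rightarrow> real"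
  assumes V[measurable]: "V \<in> borel_measurable borel" and w: "continuous_on UNIV w"
    and K: "compact K" "\<And>z. z \<notin> K \<Longrightarrow> w z = 0" and P: "K \<subseteq> P" "P \<in> sets borel"
    and V2: "(\<integral>\<^sup>+z\<in>P. ennreal ((V z)\<^sup>2) \<partial>lborel) < \<infinity>"
  shows "integrable lborel (\<lambda>z. V z * w z)"
proof -
  have [measurable]: "w \<in> borel_measurable borel" using w by (rule borel_measurable_continuous_onI)
  have Km[measurable]: "K \<in> sets borel" using K by (simp add: borel_compact)
  obtain R where R: "\<And>z. z \<in> K \<Longrightarrow> norm z \<le> R"
    using compact_imp_bounded[OF K(1)] bounded_iff by blast
  have i: "integrable lborel (\<lambda>z. indicator K z * V z)"
  proof (rule integrable_of_square_integrable[where R=R])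
    show "norm z > R \<Longrightarrow> indicator K z * V z = 0" for z using R[of z] by (auto simp: indicator_def)
    have "(\<integral>\<^sup>+z. ennreal ((indicator K z * V z)\<^sup>2) \<partial>lborel) \<le> (\<integral>\<^sup>+z\<in>P. ennreal ((V z)\<^sup>2) \<partial>lborel)"
      using P by (intro nn_integral_mono) (auto simp: indicator_def)
    then show "(\<integral>\<^sup>+z. ennreal ((indicator K z * V z)\<^sup>2) \<partial>lborel) < \<infinity>"
      using V2 by (rule le_less_trans)
  qed measurable
  have "compact (w ` K)" using w K by (intro compact_continuous_image continuous_on_subset[OF w]) auto
  then obtain B where "\<forall>x\<in>w ` K. norm x \<le> B" using compact_imp_bounded bounded_iff by blast
  then have B: "\<bar>w z\<bar> \<le> \<bar>B\<bar>" for z using K(2)[of z] by (cases "z \<in> K") force+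
  show ?thesis
  proof (rule Bochner_Integration.integrable_bound[OF integrable_mult_left[OF i, of "\<bar>B\<bar>"]])
    show "AE z in lborel. norm (V z * w z) \<le> norm (indicator K z * V z * \<bar>B\<bar>)"
    proof (rule AE_I2)
      fix z
      show "norm (V z * w z) \<le> norm (indicator K z * V z * \<bar>B\<bar>)"
        using B[of z] K(2)[of z] by (cases "z \<in> K") (auto simp: abs_mult intro!: mult_left_mono)
    qed
  qed measurable
qed

text \<open>Multiplying V by the cutoffs c_k gives functions defined on the whole space-time, with
  weak gradient c_k W + (dx c_k) V, to which \<open>weak_Sobolev\<close> applies with a bound
  independent of k. As k grows the cutoffs exhaust the time interval, and Fatou passes to the
  limit.\<close>

lemma local_Sobolev:
  fixes V :: "spacetime \<Rightarrow> real" and W :: "3 \<Rightarrow> spacetime \<Rightarrow> real" and L a :: real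
  defines "P \<equiv> ball 0 L \<times> {-a<..<0}"
  assumes Vm[measurable]: "V \<in> borel_measurable borel" and Wm[measurable]: "\<And>j. W j \<in> borel_measurable borel"
    and L: "0 < L" and a: "0 < a" and P: "P \<subseteq> \<Omega>"
    and V2: "(\<integral>\<^sup>+z\<in>P. ennreal ((V z)\<^sup>2) \<partial>lborel) < \<infinity>"
    and W2: "\<And>j. (\<integral>\<^sup>+z\<in>P. ennreal ((W j z)\<^sup>2) \<partial>lborel) < \<infinity>"
    and weak: "\<And>\<psi> j. smooth_elem \<psi> \<Longrightarrow> test_function \<Omega> \<psi>
      \<Longrightarrow> (\<integral>z. V z * dx j \<psi> z \<partial>lborel) = - (\<integral>z. W j z * \<psi> z \<partial>lborel)"
  shows "(\<integral>\<^sup>+t\<in>{-a<..<0}. epowr (\<integral>\<^sup>+x\<in>ball 0 (L / 8). ennreal (V (x, t) ^ 6) \<partial>lborel) (1 / 3) \<partial>lborel)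
    \<le> 16 * (\<Sum>j\<in>UNIV. \<integral>\<^sup>+z\<in>P. ennreal (exp 28 * (2 * (W j z)\<^sup>2 + 512 / L\<^sup>2 * (V z)\<^sup>2)) \<partial>lborel)"
    (is "_ \<le> ?C")
proof -
  have Pm[measurable]: "P \<in> sets borel" unfolding P_def by (intro borel_Times) auto
  \<comment> \<open>The summand 2 / a makes the time interval of \<open>K k\<close> nonempty already
    for k = 0.\<close>
  define m where "m k = 2 / a + real (Suc k)" for k
  have m: "m k > 0" for k using a by (auto simp: m_def intro: add_nonneg_pos)
  define c where "c k = cutoff L a (m k)" for k
  define K where "K k = cball (0 :: space) (3 / 4 * L) \<times> {- a + 1 / m k .. - 1 / m k}" for k
  have Kc: "compact (K k)" for k unfolding K_def by (intro compact_Times) auto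
  have KP: "K k \<subseteq> P" for k
  proof
    fix z assume z: "z \<in> K k"
    have "1 / m k > 0" using m by simp
    moreover have "3 / 4 * L < L" using L by simp
    moreover have "norm (fst z) \<le> 3 / 4 * L" "- a + 1 / m k \<le> snd z" "snd z \<le> - 1 / m k"
      using z by (auto simp: K_def)
    ultimately have "norm (fst z) < L" "- a < snd z" "snd z < 0" by linarith+
    then show "z \<in> P" by (cases z) (simp add: P_def)
  qed
  obtain R where R: "\<And>z. z \<in> P \<Longrightarrow> norm z \<le> R"
  proof -
    have "bounded P" unfolding P_def by (intro bounded_Times) auto
    then show thesis using that bounded_iff by blast
  qed
  have cs: "smooth_elem (c k)" for k by (simp add: c_def smooth_elem_cutoff)
  have cz: "z \<notin> K k \<Longrightarrow> c k z = 0" "z \<notin> K k \<Longrightarrow> dx j (c k) z = 0" for k z j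
    unfolding c_def K_def using cutoff_support[OF L a m] by auto
  have cc: "continuous_on UNIV (c k)" "continuous_on UNIV (dx j (c k))" for k j
    by (intro smooth_elem_continuous smooth_elem_dx cs)+
  have [measurable]: "c k \<in> borel_measurable borel" "dx j (c k) \<in> borel_measurable borel" for k j
    using cc by (auto intro: borel_measurable_continuous_onI)
  define U where "U k z = c k z * V z" for k z
  define H where "H k j z = c k z * W j z + dx j (c k) z * V z" for k j z
  have [measurable]: "U k \<in> borel_measurable borel" "H k j \<in> borel_measurable borel" for k j
    unfolding U_def H_def by measurable
  have cb: "\<bar>c k z\<bar> \<le> exp 14" "\<bar>dx j (c k) z\<bar> \<le> exp 14 * (16 / L)" for k z j
    using cutoff_range[OF L a m, of k z] cutoff_dx_bound[OF L a m, of j k z] by (auto simp: c_def)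
  have Uz: "z \<notin> P \<Longrightarrow> U k z = 0" and Hz: "z \<notin> P \<Longrightarrow> H k j z = 0" for k j z
  proof -
    have "z \<notin> K k" if "z \<notin> P" using KP that by blast
    then show "z \<notin> P \<Longrightarrow> U k z = 0" "z \<notin> P \<Longrightarrow> H k j z = 0"
      by (simp_all add: U_def H_def cz)
  qed
  have c2: "(c k z)\<^sup>2 \<le> exp 28" "(dx j (c k) z)\<^sup>2 \<le> exp 28 * (256 / L\<^sup>2)" for k z j
  proof -
    have e: "exp 28 = (exp 14 :: real)\<^sup>2" by (simp add: power2_eq_square flip: exp_add)
    show "(c k z)\<^sup>2 \<le> exp 28" unfolding e using cb(1)[of k z] by (simp add: abs_le_square_iff[symmetric])
    have "\<bar>dx j (c k) z\<bar>\<^sup>2 \<le> (exp 14 * (16 / L))\<^sup>2" using cb(2)[of j k z] by (intro power_mono) auto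
    then show "(dx j (c k) z)\<^sup>2 \<le> exp 28 * (256 / L\<^sup>2)"
      unfolding e by (simp add: power_mult_distrib power_divide)
  qed
  \<comment> \<open>(a + b)^2 \<le> 2 a^2 + 2 b^2, with 28 = 2 * 14 and 512 = 2 * 16^2 from the two
    cutoff bounds.\<close>
  have H2: "(H k j z)\<^sup>2 \<le> exp 28 * (2 * (W j z)\<^sup>2 + 512 / L\<^sup>2 * (V z)\<^sup>2)" for k j z
  proof -
    have "(H k j z)\<^sup>2 \<le> 2 * (c k z * W j z)\<^sup>2 + 2 * (dx j (c k) z * V z)\<^sup>2"
      using zero_le_power2[of "c k z * W j z - dx j (c k) z * V z"]
      unfolding H_def power2_sum power2_diff by linarith
    also have "\<dots> \<le> 2 * (exp 28 * (W j z)\<^sup>2) + 2 * (exp 28 * (256 / L\<^sup>2) * (V z)\<^sup>2)"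
      unfolding power_mult_distrib by (intro add_mono mult_left_mono mult_right_mono c2) auto
    finally show ?thesis by (simp add: algebra_simps)
  qed
  have HC: "(\<integral>\<^sup>+z. ennreal ((H k j z)\<^sup>2) \<partial>lborel)
      \<le> (\<integral>\<^sup>+z\<in>P. ennreal (exp 28 * (2 * (W j z)\<^sup>2 + 512 / L\<^sup>2 * (V z)\<^sup>2)) \<partial>lborel)" for k j
    using H2 Hz by (intro nn_integral_mono) (auto simp: indicator_def intro!: ennreal_leI)
  have Cfin: "(\<integral>\<^sup>+z\<in>P. ennreal (exp 28 * (2 * (W j z)\<^sup>2 + 512 / L\<^sup>2 * (V z)\<^sup>2)) \<partial>lborel) < \<infinity>" for j
  proof -
    have "(\<integral>\<^sup>+z\<in>P. ennreal (exp 28 * (2 * (W j z)\<^sup>2 + 512 / L\<^sup>2 * (V z)\<^sup>2)) \<partial>lborel)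
        = (\<integral>\<^sup>+z. ennreal (exp 28 * 2) * (ennreal ((W j z)\<^sup>2) * indicator P z)
            + ennreal (exp 28 * (512 / L\<^sup>2)) * (ennreal ((V z)\<^sup>2) * indicator P z) \<partial>lborel)"
      by (intro nn_integral_cong)
         (auto simp: indicator_def distrib_left mult.assoc simp flip: ennreal_mult ennreal_plus)
    also have "\<dots> = ennreal (exp 28 * 2) * (\<integral>\<^sup>+z\<in>P. ennreal ((W j z)\<^sup>2) \<partial>lborel)
        + ennreal (exp 28 * (512 / L\<^sup>2)) * (\<integral>\<^sup>+z\<in>P. ennreal ((V z)\<^sup>2) \<partial>lborel)"
      by (subst nn_integral_add) (auto simp: nn_integral_cmult)
    also have "\<dots> < \<infinity>" using V2 W2[of j] by (simp add: ennreal_mult_less_top)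
    finally show ?thesis .
  qed
  have main: "(\<integral>\<^sup>+t. epowr (\<integral>\<^sup>+x. ennreal (U k (x, t) ^ 6) \<partial>lborel) (1 / 3) \<partial>lborel) \<le> ?C" for k
  proof -
    have "(\<integral>\<^sup>+t. epowr (\<integral>\<^sup>+x. ennreal (U k (x, t) ^ 6) \<partial>lborel) (1 / 3) \<partial>lborel)
        \<le> 16 * (\<Sum>j\<in>UNIV. \<integral>\<^sup>+z. ennreal ((H k j z)\<^sup>2) \<partial>lborel)"
    proof (rule weak_Sobolev[where R = R])
      show "U k z = 0" "H k j z = 0" if "norm z > R" for z j
        using Uz Hz R that by (meson not_le)+
      have "(U k z)\<^sup>2 \<le> exp 28 * (V z)\<^sup>2" for z
        unfolding U_def power_mult_distrib by (intro mult_right_mono c2) auto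
      then have "(\<integral>\<^sup>+z. ennreal ((U k z)\<^sup>2) \<partial>lborel) \<le> (\<integral>\<^sup>+z. ennreal (exp 28) * (ennreal ((V z)\<^sup>2) * indicator P z) \<partial>lborel)"
        using Uz by (intro nn_integral_mono) (auto simp: indicator_def intro!: ennreal_leI simp flip: ennreal_mult)
      also have "\<dots> = ennreal (exp 28) * (\<integral>\<^sup>+z\<in>P. ennreal ((V z)\<^sup>2) \<partial>lborel)"
        by (simp add: nn_integral_cmult)
      also have "\<dots> < \<infinity>" using V2 by (simp add: ennreal_mult_less_top)
      finally show "(\<integral>\<^sup>+z. ennreal ((U k z)\<^sup>2) \<partial>lborel) < \<infinity>" .
      show "(\<integral>\<^sup>+z. ennreal ((H k j z)\<^sup>2) \<partial>lborel) < \<infinity>" for j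
        using HC Cfin by (rule le_less_trans)
      fix \<psi> :: "spacetime \<Rightarrow> real" and r j
      assume ps: "smooth_elem \<psi>"
      have pc: "continuous_on UNIV \<psi>" "continuous_on UNIV (dx j \<psi>)"
        by (intro smooth_elem_continuous smooth_elem_dx ps)+
      have s: "smooth_elem (\<lambda>z. c k z * \<psi> z)" by (intro smooth_elem.mult cs ps)
      \<comment> \<open>\<psi> itself may be supported anywhere; multiplying it by the cutoff makes
        it admissible on \<Omega>, and the product rule then gives the weak gradient of
        \<open>U k\<close>.\<close>
      have "test_function \<Omega> (\<lambda>z. c k z * \<psi> z)"
        by (rule smooth_elem_test_function[OF s Kc[of k]]) (use KP P cz in auto)
      from weak[OF s this, of j]
      have w: "(\<integral>z. V z * (c k z * dx j \<psi> z + dx j (c k) z * \<psi> z) \<partial>lborel) = - (\<integral>z. W j z * (c k z * \<psi> z) \<partial>lborel)"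
        by (simp add: dx_mult[OF cs ps])
      have i: "integrable lborel (\<lambda>z. V z * (c k z * dx j \<psi> z))" "integrable lborel (\<lambda>z. V z * (dx j (c k) z * \<psi> z))"
        "integrable lborel (\<lambda>z. W j z * (c k z * \<psi> z))"
        by (rule integrable_mult_bounded_support[OF _ _ Kc[of k] _ KP Pm V2]
            integrable_mult_bounded_support[OF _ _ Kc[of k] _ KP Pm W2];
            use cz in \<open>auto intro!: continuous_intros cc pc\<close>)+
      have "(\<integral>z. V z * (c k z * dx j \<psi> z) \<partial>lborel)
          = - ((\<integral>z. W j z * (c k z * \<psi> z) \<partial>lborel) + (\<integral>z. V z * (dx j (c k) z * \<psi> z) \<partial>lborel))"
        using w i by (simp add: distrib_left)
      also have "(\<integral>z. W j z * (c k z * \<psi> z) \<partial>lborel) + (\<integral>z. V z * (dx j (c k) z * \<psi> z) \<partial>lborel)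
          = (\<integral>z. W j z * (c k z * \<psi> z) + V z * (dx j (c k) z * \<psi> z) \<partial>lborel)"
        using i by simp
      finally show "(\<integral>z. U k z * dx j \<psi> z \<partial>lborel) = - (\<integral>z. H k j z * \<psi> z \<partial>lborel)"
        by (simp add: U_def H_def algebra_simps)
    qed measurable
    also have "\<dots> \<le> ?C" by (intro mult_left_mono sum_mono HC) auto
    finally show ?thesis .
  qed
  have "(\<integral>\<^sup>+t\<in>{-a<..<0}. epowr (\<integral>\<^sup>+x\<in>ball 0 (L / 8). ennreal (V (x, t) ^ 6) \<partial>lborel) (1 / 3) \<partial>lborel)
      \<le> (\<integral>\<^sup>+t. liminf (\<lambda>k. epowr (\<integral>\<^sup>+x. ennreal (U k (x, t) ^ 6) \<partial>lborel) (1 / 3)) \<partial>lborel)"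
  proof (rule nn_integral_mono)
    fix t :: real
    show "epowr (\<integral>\<^sup>+x\<in>ball 0 (L / 8). ennreal (V (x, t) ^ 6) \<partial>lborel) (1 / 3) * indicator {-a<..<0} t
        \<le> liminf (\<lambda>k. epowr (\<integral>\<^sup>+x. ennreal (U k (x, t) ^ 6) \<partial>lborel) (1 / 3))"
    proof (cases "t \<in> {-a<..<0}")
      case True
      \<comment> \<open>From this index on, depending on t, the given time lies where the cutoff is
        at least 1. The comparison is therefore pointwise in t and passes through a liminf.\<close>
      define k0 where "k0 = nat \<lceil>max (2 / (t + a)) (2 / (- t))\<rceil>"
      have k0: "2 / (t + a) \<le> real k0" "2 / (- t) \<le> real k0"
        using real_nat_ceiling_ge[of "max (2 / (t + a)) (2 / (- t))"] unfolding k0_def by linarith+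
      have "\<forall>\<^sub>F k in sequentially. epowr (\<integral>\<^sup>+x\<in>ball 0 (L / 8). ennreal (V (x, t) ^ 6) \<partial>lborel) (1 / 3)
          \<le> epowr (\<integral>\<^sup>+x. ennreal (U k (x, t) ^ 6) \<partial>lborel) (1 / 3)"
      proof (rule eventually_sequentiallyI[of k0])
        fix k assume k: "k \<ge> k0"
        have "real k0 \<le> m k" using k a by (auto simp: m_def intro: add_nonneg_nonneg order_trans[of _ "real k"])
        then have "2 / (t + a) \<le> m k" "2 / (- t) \<le> m k" using k0 by linarith+
        then have t: "2 / m k \<le> t + a" "2 / m k \<le> - t"
          using True m[of k] by (auto simp: field_simps)
        have "V (x, t) ^ 6 \<le> U k (x, t) ^ 6" if "x \<in> ball 0 (L / 8)" for x
        proof -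
          have "1 \<le> c k (x, t) ^ 6"
            using cutoff_ge_1[OF L a m that t] by (simp add: c_def)
          then have "1 * V (x, t) ^ 6 \<le> c k (x, t) ^ 6 * V (x, t) ^ 6"
            by (intro mult_right_mono) auto
          then show ?thesis by (simp add: U_def power_mult_distrib)
        qed
        then show "epowr (\<integral>\<^sup>+x\<in>ball 0 (L / 8). ennreal (V (x, t) ^ 6) \<partial>lborel) (1 / 3)
            \<le> epowr (\<integral>\<^sup>+x. ennreal (U k (x, t) ^ 6) \<partial>lborel) (1 / 3)"
          by (intro epowr_mono nn_integral_mono) (auto simp: indicator_def intro!: ennreal_leI)
      qed
      then show ?thesis using True by (simp add: Liminf_bounded)
    qed simp
  qed
  also have "\<dots> \<le> liminf (\<lambda>k. \<integral>\<^sup>+t. epowr (\<integral>\<^sup>+x. ennreal (U k (x, t) ^ 6) \<partial>lborel) (1 / 3) \<partial>lborel)"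
    by (rule nn_integral_liminf) measurable
  also have "\<dots> \<le> ?C"
    by (rule order_trans[OF Liminf_le_Limsup Limsup_bounded]) (intro trivial_limit_sequentially always_eventually allI main)+
  finally show ?thesis .
qed

text \<open>The solution is only Lebesgue measurable, while Tonelli on \<open>lborel\<close> calls
  for Borel functions, also on time slices. Each coordinate has a Borel version, and finitely many
  null sets are combined.\<close>

lemma lebesgue_on_borel_representative:
  fixes u :: "'a::euclidean_space \<Rightarrow> 'b::euclidean_space"
  assumes u: "u \<in> borel_measurable (lebesgue_on S)" and S: "S \<in> sets borel"
  obtains u' where "u' \<in> borel_measurable borel" "\<And>z. z \<notin> S \<Longrightarrow> u' z = 0"
    "AE z in lborel. indicator S z *\<^sub>R u z = u' z"
proof -
  have m: "(\<lambda>z. indicator S z *\<^sub>R u z) \<in> borel_measurable lebesgue"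
    using u S by (subst (asm) borel_measurable_restrict_space_iff) auto
  have "\<exists>g\<in>borel_measurable lborel. AE z in lborel. (indicator S z *\<^sub>R u z) \<bullet> b = g z" for b
    by (rule completion_ex_borel_measurable_real) (use m in measurable)
  then have "\<exists>g. g \<in> borel_measurable borel \<and> (AE z in lborel. (indicator S z *\<^sub>R u z) \<bullet> b = g z)" for b
    by (simp add: Bex_def)
  then have "\<exists>g. \<forall>b. g b \<in> borel_measurable borel \<and> (AE z in lborel. (indicator S z *\<^sub>R u z) \<bullet> b = g b z)"
    by (intro choice allI)
  then obtain g where g: "\<And>b. g b \<in> borel_measurable borel"
    "\<And>b. AE z in lborel. (indicator S z *\<^sub>R u z) \<bullet> b = g b z" by blast
  note g(1)[measurable]
  define u' where "u' z = indicator S z *\<^sub>R (\<Sum>b\<in>Basis. g b z *\<^sub>R b)" for z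
  have "u' \<in> borel_measurable borel" unfolding u'_def using S by measurable
  moreover have "u' z = 0" if "z \<notin> S" for z using that by (simp add: u'_def)
  moreover have "AE z in lborel. \<forall>b\<in>Basis. (indicator S z *\<^sub>R u z) \<bullet> b = g b z"
    using g(2) by (intro eventually_ball_finite) auto
  then have "AE z in lborel. indicator S z *\<^sub>R u z = u' z"
  proof eventually_elim
    case (elim z)
    have "indicator S z *\<^sub>R u z = (\<Sum>b\<in>Basis. ((indicator S z *\<^sub>R u z) \<bullet> b) *\<^sub>R b)"
      by (rule euclidean_representation[symmetric])
    also have "\<dots> = (\<Sum>b\<in>Basis. g b z *\<^sub>R b)" using elim by (intro sum.cong) auto
    finally show ?case unfolding u'_def by (metis indicator_simps scaleR_one scaleR_zero_left)
  qed
  ultimately show thesis by (rule that)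
qed

section \<open>From scalar components to vector fields\<close>

lemma epowr_cube_root_power: "epowr x (1 / 3) ^ 3 = x"
proof (cases x)
  case (real r)
  have "(r powr (1 / 3)) ^ 3 = r"
    using real by (cases "r = 0") (simp_all add: powr_powr flip: powr_realpow)
  then show ?thesis using real by (simp add: epowr_ennreal ennreal_power)
next
  case top
  then show ?thesis by (simp add: epowr_def)
qed

text \<open>With x_i the cube root of \<open>X i\<close> and S their sum, the sum of the cubes is at
  most S^3; then 9 \<le> 27 = 3^3.\<close>

lemma epowr_cube_root_sum:
  fixes X :: "3 \<Rightarrow> ennreal"
  assumes "Y \<le> 9 * (\<Sum>i\<in>UNIV. X i)"
  shows "epowr Y (1 / 3) \<le> 3 * (\<Sum>i\<in>UNIV. epowr (X i) (1 / 3))"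
proof (rule epowr_cube_root_le)
  define S where "S = (\<Sum>i\<in>UNIV. epowr (X i) (1 / 3))"
  have s: "epowr (X i) (1 / 3) \<le> S" for i unfolding S_def by (intro member_le_sum) auto
  have "(\<Sum>i\<in>UNIV. X i) = (\<Sum>i\<in>UNIV. epowr (X i) (1 / 3) ^ 3)" by (simp add: epowr_cube_root_power)
  also have "\<dots> \<le> (\<Sum>i\<in>UNIV. epowr (X i) (1 / 3) * (S * S))"
    unfolding power3_eq_cube mult.assoc by (intro sum_mono mult_left_mono mult_mono s) auto
  also have "\<dots> = S ^ 3" by (simp add: S_def power3_eq_cube mult.assoc flip: sum_distrib_right)
  finally have "9 * (\<Sum>i\<in>UNIV. X i) \<le> 9 * S ^ 3" by (intro mult_left_mono) auto
  also have "\<dots> \<le> 27 * S ^ 3" by (intro mult_right_mono) auto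
  also have "\<dots> = (3 * S) ^ 3" by (simp add: power_mult_distrib)
  finally show "Y \<le> (3 * (\<Sum>i\<in>UNIV. epowr (X i) (1 / 3))) ^ 3"
    using assms unfolding S_def by (rule order_trans[rotated])
qed

lemma norm_power6_le:
  fixes x :: space
  shows "norm x ^ 6 \<le> 9 * (\<Sum>i\<in>UNIV. (x $ i) ^ 6)"
proof -
  have *: "(a + b + c) ^ 3 \<le> 9 * (a ^ 3 + b ^ 3 + c ^ 3)" if "0 \<le> a" "0 \<le> b" "0 \<le> c" for a b c :: real
  proof -
    \<comment> \<open>The difference of the two sides is four times the sum of the first three
      products plus the sum of the last three.\<close>
    have "0 \<le> (a + b) * (a - b)\<^sup>2" "0 \<le> (b + c) * (b - c)\<^sup>2" "0 \<le> (a + c) * (a - c)\<^sup>2"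
      "0 \<le> a * (b - c)\<^sup>2" "0 \<le> b * (a - c)\<^sup>2" "0 \<le> c * (a - b)\<^sup>2"
      using that by auto
    then show ?thesis by (simp add: power2_eq_square power3_eq_cube algebra_simps)
  qed
  have "norm x ^ 6 = (norm x ^ 2) ^ 3" by (simp flip: power_mult)
  also have "norm x ^ 2 = (x $ 1)\<^sup>2 + (x $ 2)\<^sup>2 + (x $ 3)\<^sup>2"
    unfolding power2_norm_eq_inner inner_vec_def sum_3 by (simp add: power2_eq_square)
  also have "\<dots> ^ 3 \<le> 9 * (((x $ 1)\<^sup>2) ^ 3 + ((x $ 2)\<^sup>2) ^ 3 + ((x $ 3)\<^sup>2) ^ 3)"
    by (rule *) auto
  finally show ?thesis by (simp add: sum_3 flip: power_mult)
qed

text \<open>The scalar inequality is applied to each component. The constant is 432 = 3 * 3 * 48: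
  here 48 is 16 times three directions, one factor 3 counts components, and the other comes from
  \<open>epowr_cube_root_sum\<close>.\<close>

lemma local_Sobolev_vec:
  fixes v :: "spacetime \<Rightarrow> space" and G :: "spacetime \<Rightarrow> real ^ 3 ^ 3" and L a :: real
  defines "P \<equiv> ball 0 L \<times> {-a<..<0}"
  assumes vm[measurable]: "v \<in> borel_measurable borel" and Gm[measurable]: "G \<in> borel_measurable borel"
    and L: "0 < L" and a: "0 < a" and P: "P \<subseteq> \<Omega>"
    and v2: "(\<integral>\<^sup>+z\<in>P. ennreal (norm (v z) ^ 2) \<partial>lborel) < \<infinity>"
    and G2: "(\<integral>\<^sup>+z\<in>P. ennreal (norm (G z) ^ 2) \<partial>lborel) < \<infinity>"
    and weak: "\<And>\<psi> i j. smooth_elem \<psi> \<Longrightarrow> test_function \<Omega> \<psi>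
      \<Longrightarrow> (\<integral>z. v z $ i * dx j \<psi> z \<partial>lborel) = - (\<integral>z. G z $ i $ j * \<psi> z \<partial>lborel)"
  shows "(\<integral>\<^sup>+t\<in>{-a<..<0}. epowr (\<integral>\<^sup>+x\<in>ball 0 (L / 8). ennreal (norm (v (x, t)) ^ 6) \<partial>lborel) (1 / 3) \<partial>lborel)
    \<le> ennreal (432 * 512 * exp 28) * ((\<integral>\<^sup>+z\<in>P. ennreal (norm (G z) ^ 2) \<partial>lborel)
        + ennreal (1 / L\<^sup>2) * (\<integral>\<^sup>+z\<in>P. ennreal (norm (v z) ^ 2) \<partial>lborel))"
proof -
  have Pm[measurable]: "P \<in> sets borel" unfolding P_def by (intro borel_Times) auto
  have cm[measurable]: "(\<lambda>z. v z $ i) \<in> borel_measurable borel" "(\<lambda>z. G z $ i $ j) \<in> borel_measurable borel" for i j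
  proof -
    have [measurable]: "(\<lambda>x :: space. x $ i) \<in> borel_measurable borel" "(\<lambda>x :: real ^ 3 ^ 3. x $ i) \<in> borel_measurable borel" for i
      by (intro borel_measurable_continuous_onI continuous_intros)+
    show "(\<lambda>z. v z $ i) \<in> borel_measurable borel" "(\<lambda>z. G z $ i $ j) \<in> borel_measurable borel"
      by measurable
  qed
  let ?A = "\<integral>\<^sup>+z\<in>P. ennreal (norm (G z) ^ 2) \<partial>lborel"
  let ?B = "\<integral>\<^sup>+z\<in>P. ennreal (norm (v z) ^ 2) \<partial>lborel"
  have cv: "(v z $ i)\<^sup>2 \<le> norm (v z) ^ 2" for z i
    using component_le_norm_cart[of "v z" i] by (simp add: abs_le_square_iff[symmetric])
  have cG: "(G z $ i $ j)\<^sup>2 \<le> norm (G z) ^ 2" for z i j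
  proof -
    have "\<bar>G z $ i $ j\<bar> \<le> norm (G z)"
      using component_le_norm_cart[of "G z $ i" j] Finite_Cartesian_Product.norm_nth_le[of "G z" i] by linarith
    then show ?thesis by (simp add: abs_le_square_iff[symmetric])
  qed
  have vi2: "(\<integral>\<^sup>+z\<in>P. ennreal ((v z $ i)\<^sup>2) \<partial>lborel) \<le> ?B" for i
    by (intro nn_integral_mono mult_right_mono ennreal_leI cv) auto
  have Gij2: "(\<integral>\<^sup>+z\<in>P. ennreal ((G z $ i $ j)\<^sup>2) \<partial>lborel) \<le> ?A" for i j
    by (intro nn_integral_mono mult_right_mono ennreal_leI cG) auto
  define X where "X i t = (\<integral>\<^sup>+x\<in>ball 0 (L / 8). ennreal ((v (x, t) $ i) ^ 6) \<partial>lborel)" for i t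
  have [measurable]: "ball 0 (L / 8) \<in> sets (borel :: space measure)" by simp
  have [measurable]: "X i \<in> borel_measurable borel" for i
    unfolding X_def by measurable
  have scalar: "(\<integral>\<^sup>+t\<in>{-a<..<0}. epowr (X i t) (1 / 3) \<partial>lborel)
      \<le> 48 * (ennreal (512 * exp 28) * (?A + ennreal (1 / L\<^sup>2) * ?B))" for i
  proof -
    have "(\<integral>\<^sup>+t\<in>{-a<..<0}. epowr (X i t) (1 / 3) \<partial>lborel)
        \<le> 16 * (\<Sum>j\<in>UNIV. \<integral>\<^sup>+z\<in>P. ennreal (exp 28 * (2 * (G z $ i $ j)\<^sup>2 + 512 / L\<^sup>2 * (v z $ i)\<^sup>2)) \<partial>lborel)"
      unfolding X_def P_def
      by (rule local_Sobolev[OF cm(1) cm(2) L a P[unfolded P_def]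
            le_less_trans[OF vi2 v2, unfolded P_def] le_less_trans[OF Gij2 G2, unfolded P_def] weak])
    also have "\<dots> \<le> 16 * (\<Sum>j\<in>(UNIV :: 3 set). ennreal (512 * exp 28) * (?A + ennreal (1 / L\<^sup>2) * ?B))"
    proof (intro mult_left_mono sum_mono)
      fix j
      have "(\<integral>\<^sup>+z\<in>P. ennreal (exp 28 * (2 * (G z $ i $ j)\<^sup>2 + 512 / L\<^sup>2 * (v z $ i)\<^sup>2)) \<partial>lborel)
          \<le> (\<integral>\<^sup>+z. ennreal (512 * exp 28) * (ennreal (norm (G z) ^ 2) * indicator P z
            + ennreal (1 / L\<^sup>2) * (ennreal (norm (v z) ^ 2) * indicator P z)) \<partial>lborel)"
      proof (rule nn_integral_mono)
        fix z
        have "exp 28 * (2 * (G z $ i $ j)\<^sup>2 + 512 / L\<^sup>2 * (v z $ i)\<^sup>2)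
            \<le> exp 28 * (512 * norm (G z) ^ 2 + 512 / L\<^sup>2 * norm (v z) ^ 2)"
          by (intro mult_left_mono add_mono mult_mono cG cv) auto
        also have "\<dots> = 512 * exp 28 * (norm (G z) ^ 2 + 1 / L\<^sup>2 * norm (v z) ^ 2)"
          by (simp add: algebra_simps)
        finally have "ennreal (exp 28 * (2 * (G z $ i $ j)\<^sup>2 + 512 / L\<^sup>2 * (v z $ i)\<^sup>2))
            \<le> ennreal (512 * exp 28 * (norm (G z) ^ 2 + 1 / L\<^sup>2 * norm (v z) ^ 2))"
          by (rule ennreal_leI)
        also have "\<dots> = ennreal (512 * exp 28) * (ennreal (norm (G z) ^ 2) + ennreal (1 / L\<^sup>2) * ennreal (norm (v z) ^ 2))"
          by (subst ennreal_mult, simp, simp, subst ennreal_plus, simp, simp, subst ennreal_mult) auto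
        finally show "ennreal (exp 28 * (2 * (G z $ i $ j)\<^sup>2 + 512 / L\<^sup>2 * (v z $ i)\<^sup>2)) * indicator P z
            \<le> ennreal (512 * exp 28) * (ennreal (norm (G z) ^ 2) * indicator P z
            + ennreal (1 / L\<^sup>2) * (ennreal (norm (v z) ^ 2) * indicator P z))"
          by (auto simp: indicator_def)
      qed
      also have "\<dots> = ennreal (512 * exp 28) * (?A + ennreal (1 / L\<^sup>2) * ?B)"
        by (subst nn_integral_cmult, simp, subst nn_integral_add, simp, simp, subst nn_integral_cmult) auto
      finally show "(\<integral>\<^sup>+z\<in>P. ennreal (exp 28 * (2 * (G z $ i $ j)\<^sup>2 + 512 / L\<^sup>2 * (v z $ i)\<^sup>2)) \<partial>lborel)
          \<le> ennreal (512 * exp 28) * (?A + ennreal (1 / L\<^sup>2) * ?B)" .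
    qed auto
    also have "\<dots> = 48 * (ennreal (512 * exp 28) * (?A + ennreal (1 / L\<^sup>2) * ?B))"
      by (simp add: mult.assoc[symmetric])
    finally show ?thesis .
  qed
  have "(\<integral>\<^sup>+t\<in>{-a<..<0}. epowr (\<integral>\<^sup>+x\<in>ball 0 (L / 8). ennreal (norm (v (x, t)) ^ 6) \<partial>lborel) (1 / 3) \<partial>lborel)
      \<le> (\<integral>\<^sup>+t. 3 * (\<Sum>i\<in>UNIV. epowr (X i t) (1 / 3) * indicator {-a<..<0} t) \<partial>lborel)"
  proof (rule nn_integral_mono)
    fix t :: real
    have "(\<integral>\<^sup>+x\<in>ball 0 (L / 8). ennreal (norm (v (x, t)) ^ 6) \<partial>lborel)
        \<le> (\<integral>\<^sup>+x. 9 * (\<Sum>i\<in>UNIV. ennreal ((v (x, t) $ i) ^ 6) * indicator (ball 0 (L / 8)) x) \<partial>lborel)"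
    proof (rule nn_integral_mono)
      fix x
      have "ennreal (norm (v (x, t)) ^ 6) \<le> ennreal (9 * (\<Sum>i\<in>UNIV. (v (x, t) $ i) ^ 6))"
        by (intro ennreal_leI norm_power6_le)
      also have "\<dots> = 9 * (\<Sum>i\<in>UNIV. ennreal ((v (x, t) $ i) ^ 6))"
        by (subst ennreal_mult) (auto simp: sum_nonneg)
      finally show "ennreal (norm (v (x, t)) ^ 6) * indicator (ball 0 (L / 8)) x
          \<le> 9 * (\<Sum>i\<in>UNIV. ennreal ((v (x, t) $ i) ^ 6) * indicator (ball 0 (L / 8)) x)"
        by (auto simp: indicator_def)
    qed
    also have "\<dots> = 9 * (\<Sum>i\<in>UNIV. X i t)"
    proof -
      have m: "(\<lambda>x. ennreal ((v (x, t) $ i) ^ 6) * indicator (ball 0 (L / 8)) x) \<in> borel_measurable lborel" for i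
        by measurable
      show ?thesis
        by (simp only: nn_integral_cmult[OF borel_measurable_sum[OF m]] nn_integral_sum[OF m] X_def)
    qed
    finally have "epowr (\<integral>\<^sup>+x\<in>ball 0 (L / 8). ennreal (norm (v (x, t)) ^ 6) \<partial>lborel) (1 / 3)
        \<le> 3 * (\<Sum>i\<in>UNIV. epowr (X i t) (1 / 3))"
      by (rule epowr_cube_root_sum)
    then show "epowr (\<integral>\<^sup>+x\<in>ball 0 (L / 8). ennreal (norm (v (x, t)) ^ 6) \<partial>lborel) (1 / 3) * indicator {-a<..<0} t
        \<le> 3 * (\<Sum>i\<in>UNIV. epowr (X i t) (1 / 3) * indicator {-a<..<0} t)"
      by (auto simp: indicator_def)
  qed
  also have "\<dots> = 3 * (\<Sum>i\<in>UNIV. \<integral>\<^sup>+t\<in>{-a<..<0}. epowr (X i t) (1 / 3) \<partial>lborel)"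
  proof -
    have m: "(\<lambda>t. epowr (X i t) (1 / 3) * indicator {-a<..<0} t) \<in> borel_measurable lborel" for i
      by measurable
    show ?thesis
      by (simp only: nn_integral_cmult[OF borel_measurable_sum[OF m]] nn_integral_sum[OF m])
  qed
  also have "\<dots> \<le> 3 * (\<Sum>i\<in>(UNIV :: 3 set). 48 * (ennreal (512 * exp 28) * (?A + ennreal (1 / L\<^sup>2) * ?B)))"
    by (intro mult_left_mono sum_mono scalar) auto
  also have "\<dots> = ennreal (432 * 512 * exp 28) * (?A + ennreal (1 / L\<^sup>2) * ?B)"
  proof -
    have "ennreal (432 * 512 * exp 28) = 432 * ennreal (512 * exp 28)"
      by (subst mult.assoc, subst ennreal_mult) auto
    then show ?thesis by (simp add: mult.assoc[symmetric])
  qed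
  finally show ?thesis .
qed

section \<open>Interpolation\<close>

text \<open>Concavity of the logarithm: bound ln by its tangent at the weighted mean S; the linear
  corrections cancel when averaged with the weights.\<close>

lemma Youngs_inequality_3:
  fixes a b c :: real
  assumes "0 \<le> \<alpha>" "0 \<le> \<beta>" "0 \<le> \<gamma>" "\<alpha> + \<beta> + \<gamma> = 1" "0 < a" "0 < b" "0 < c"
  shows "a powr \<alpha> * b powr \<beta> * c powr \<gamma> \<le> \<alpha> * a + \<beta> * b + \<gamma> * c"
proof -
  define S where "S = \<alpha> * a + \<beta> * b + \<gamma> * c"
  have "S > 0"
  proof (rule ccontr)
    have n: "0 \<le> \<alpha> * a" "0 \<le> \<beta> * b" "0 \<le> \<gamma> * c" using assms by auto
    assume "\<not> S > 0"
    then have "\<alpha> * a = 0" "\<beta> * b = 0" "\<gamma> * c = 0" using n unfolding S_def by linarith+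
    then show False using assms by auto
  qed
  have l: "ln x \<le> ln S + (x / S - 1)" if "x > 0" for x
    using ln_le_minus_one[of "x / S"] that \<open>S > 0\<close> by (simp add: ln_div)
  have "\<alpha> * ln a + \<beta> * ln b + \<gamma> * ln c
      \<le> \<alpha> * (ln S + (a / S - 1)) + \<beta> * (ln S + (b / S - 1)) + \<gamma> * (ln S + (c / S - 1))"
    using assms by (intro add_mono mult_left_mono l) auto
  also have "\<dots> = (\<alpha> + \<beta> + \<gamma>) * (ln S - 1) + (\<alpha> * a + \<beta> * b + \<gamma> * c) / S"
    by (simp add: algebra_simps add_divide_distrib)
  also have "\<dots> = ln S" using \<open>S > 0\<close> assms unfolding S_def[symmetric] by simp
  finally have "exp (\<alpha> * ln a + \<beta> * ln b + \<gamma> * ln c) \<le> S"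
    using \<open>S > 0\<close> by (metis exp_le_cancel_iff exp_ln)
  then show ?thesis using assms by (simp add: S_def powr_def exp_add)
qed

text \<open>Three-factor Hoelder inequality for w^s = 1^\<alpha> (w^6)^\<beta> (w^2)^\<gamma>. Each
  factor is divided by its integral or a bound of it; Young's inequality then applies pointwise, and
  the normalised integrals are at most 1 with weights adding up to 1.\<close>

lemma nn_integral_powr_interpolation:
  fixes w :: "'a::euclidean_space \<Rightarrow> real"
  assumes [measurable]: "w \<in> borel_measurable borel" "B \<in> sets borel" and w0: "\<And>x. 0 \<le> w x"
    and m: "m > 0" "emeasure lborel B \<le> ennreal m"
    and K: "K > 0" "(\<integral>\<^sup>+x\<in>B. ennreal (w x ^ 2) \<partial>lborel) \<le> ennreal K"
    and e: "0 \<le> \<alpha>" "0 < \<beta>" "0 \<le> \<gamma>" "\<alpha> + \<beta> + \<gamma> = 1" and s: "s = 6 * \<beta> + 2 * \<gamma>"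
  shows "(\<integral>\<^sup>+x\<in>B. ennreal (w x powr s) \<partial>lborel)
    \<le> ennreal (m powr \<alpha> * K powr \<gamma>) * epowr (\<integral>\<^sup>+x\<in>B. ennreal (w x ^ 6) \<partial>lborel) \<beta>"
proof (cases "\<integral>\<^sup>+x\<in>B. ennreal (w x ^ 6) \<partial>lborel")
  case top
  then show ?thesis using m K by (simp add: epowr_def ennreal_mult_top)
next
  case (real X)
  show ?thesis
  proof (cases "X = 0")
    \<comment> \<open>Dividing by X is impossible here. Instead w vanishes almost everywhere on B,
      and hence so does w^s.\<close>
    case True
    then have "(\<integral>\<^sup>+x\<in>B. ennreal (w x ^ 6) \<partial>lborel) = 0" using real by simp
    then have "AE x in lborel. ennreal (w x ^ 6) * indicator B x = 0"
      by (subst (asm) nn_integral_0_iff_AE) auto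
    then have "AE x in lborel. ennreal (w x powr s) * indicator B x = 0"
      by eventually_elim (use w0 in \<open>auto simp: indicator_def order_antisym split: if_splits\<close>)
    then have "(\<integral>\<^sup>+x\<in>B. ennreal (w x powr s) \<partial>lborel) = (\<integral>\<^sup>+x. 0 \<partial>(lborel :: 'a measure))"
      by (rule nn_integral_cong_AE)
    then show ?thesis by simp
  next
    case False
    then have X: "X > 0" using real by simp
    define C where "C = m powr \<alpha> * X powr \<beta> * K powr \<gamma>"
    have C: "C > 0" using m X K by (simp add: C_def)
    have p: "w x powr s \<le> C * (\<alpha> * (1 / m) + \<beta> * (w x ^ 6 / X) + \<gamma> * (w x ^ 2 / K))" for x
    proof (cases "w x = 0")
      case True
      then show ?thesis using C m e by simp
    next
      case False
      then have w: "w x > 0" using w0[of x] by simp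
      have pw: "(w x ^ k) powr a = w x powr (real k * a)" for k a
        using w by (simp only: powr_realpow[symmetric] powr_powr)
      have "w x powr s = (w x ^ 6) powr \<beta> * (w x ^ 2) powr \<gamma>"
        by (simp only: s powr_add pw) simp
      also have "\<dots> = C * ((1 / m) powr \<alpha> * (w x ^ 6 / X) powr \<beta> * (w x ^ 2 / K) powr \<gamma>)"
        using m X K w by (simp add: C_def powr_divide)
      also have "\<dots> \<le> C * (\<alpha> * (1 / m) + \<beta> * (w x ^ 6 / X) + \<gamma> * (w x ^ 2 / K))"
        using C e m X K w by (intro mult_left_mono Youngs_inequality_3) auto
      finally show ?thesis .
    qed
    have "(\<integral>\<^sup>+x\<in>B. ennreal (w x powr s) \<partial>lborel)
        \<le> (\<integral>\<^sup>+x. ennreal (C * \<alpha> / m) * indicator B x + (ennreal (C * \<beta> / X) * (ennreal (w x ^ 6) * indicator B x)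
           + ennreal (C * \<gamma> / K) * (ennreal (w x ^ 2) * indicator B x)) \<partial>lborel)"
    proof (rule nn_integral_mono)
      fix x
      have "ennreal (w x powr s) \<le> ennreal (C * \<alpha> / m + (C * \<beta> / X * w x ^ 6 + C * \<gamma> / K * w x ^ 2))"
        using p[of x] by (intro ennreal_leI) (simp add: algebra_simps)
      also have "\<dots> = ennreal (C * \<alpha> / m) + (ennreal (C * \<beta> / X) * ennreal (w x ^ 6) + ennreal (C * \<gamma> / K) * ennreal (w x ^ 2))"
        using C e m X K w0[of x] by (simp add: ennreal_plus ennreal_mult[symmetric])
      finally show "ennreal (w x powr s) * indicator B x \<le> ennreal (C * \<alpha> / m) * indicator B x
          + (ennreal (C * \<beta> / X) * (ennreal (w x ^ 6) * indicator B x)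
           + ennreal (C * \<gamma> / K) * (ennreal (w x ^ 2) * indicator B x))"
        by (auto simp: indicator_def)
    qed
    also have "\<dots> = ennreal (C * \<alpha> / m) * emeasure lborel B
        + (ennreal (C * \<beta> / X) * (\<integral>\<^sup>+x\<in>B. ennreal (w x ^ 6) \<partial>lborel)
          + ennreal (C * \<gamma> / K) * (\<integral>\<^sup>+x\<in>B. ennreal (w x ^ 2) \<partial>lborel))"
      by (simp add: nn_integral_add nn_integral_cmult)
    also have "\<dots> \<le> ennreal (C * \<alpha> / m) * ennreal m + (ennreal (C * \<beta> / X) * ennreal X + ennreal (C * \<gamma> / K) * ennreal K)"
      unfolding real by (intro add_mono mult_left_mono m K) auto
    also have "\<dots> = ennreal (C * \<alpha> + (C * \<beta> + C * \<gamma>))"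
      using C e m X K by (simp add: ennreal_plus ennreal_mult[symmetric])
    also have "C * \<alpha> + (C * \<beta> + C * \<gamma>) = C" using e by (metis add.assoc distrib_left mult.right_neutral)
    also have "ennreal C = ennreal (m powr \<alpha> * K powr \<gamma>) * epowr (\<integral>\<^sup>+x\<in>B. ennreal (w x ^ 6) \<partial>lborel) \<beta>"
      using X unfolding real by (simp add: C_def epowr_ennreal ennreal_mult[symmetric] mult_ac)
    finally show ?thesis .
  qed
qed

text \<open>Hoelder in time against the constant 1, by the same normalisation with two factors. The
  strict inequality \<delta> < 1 is where l < q(\<eta>) enters.\<close>

lemma nn_integral_epowr_le:
  fixes Y :: "'a::euclidean_space \<Rightarrow> ennreal"
  assumes [measurable]: "Y \<in> borel_measurable borel" "T \<in> sets borel"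
    and \<tau>: "\<tau> > 0" "emeasure lborel T \<le> ennreal \<tau>"
    and N: "N > 0" "(\<integral>\<^sup>+t\<in>T. Y t \<partial>lborel) \<le> ennreal N" and d: "0 < \<delta>" "\<delta> < 1"
  shows "(\<integral>\<^sup>+t\<in>T. epowr (Y t) \<delta> \<partial>lborel) \<le> ennreal (\<tau> powr (1 - \<delta>) * N powr \<delta>)"
proof -
  define C where "C = \<tau> powr (1 - \<delta>) * N powr \<delta>"
  have C: "C > 0" using \<tau> N by (simp add: C_def)
  have p: "epowr (Y t) \<delta> \<le> ennreal (C * (1 - \<delta>) / \<tau>) + ennreal (C * \<delta> / N) * Y t" for t
  proof (cases "Y t")
    case top
    then show ?thesis using C d N by (simp add: epowr_def ennreal_mult_top)
  next
    case (real y)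
    have "y powr \<delta> \<le> C * ((1 - \<delta>) * (1 / \<tau>) + \<delta> * (y / N))"
    proof (cases "y = 0")
      case True
      then show ?thesis using C d \<tau> by simp
    next
      case False
      then have y: "y > 0" using real by simp
      have "y powr \<delta> = C * ((1 / \<tau>) powr (1 - \<delta>) * (y / N) powr \<delta>)"
        using \<tau> N y by (simp add: C_def powr_divide)
      also have "\<dots> \<le> C * ((1 - \<delta>) * (1 / \<tau>) + \<delta> * (y / N))"
        using C d \<tau> N y by (intro mult_left_mono Youngs_inequality_0) auto
      finally show ?thesis .
    qed
    then have "ennreal (y powr \<delta>) \<le> ennreal (C * (1 - \<delta>) / \<tau> + C * \<delta> / N * y)"
      by (intro ennreal_leI) (simp add: algebra_simps)
    also have "\<dots> = ennreal (C * (1 - \<delta>) / \<tau>) + ennreal (C * \<delta> / N) * ennreal y"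
      using C d \<tau> N real by (simp add: ennreal_plus ennreal_mult[symmetric])
    finally show ?thesis using real by (simp add: epowr_ennreal)
  qed
  have "(\<integral>\<^sup>+t\<in>T. epowr (Y t) \<delta> \<partial>lborel)
      \<le> (\<integral>\<^sup>+t. ennreal (C * (1 - \<delta>) / \<tau>) * indicator T t + ennreal (C * \<delta> / N) * (Y t * indicator T t) \<partial>lborel)"
    using p by (intro nn_integral_mono) (auto simp: indicator_def)
  also have "\<dots> = ennreal (C * (1 - \<delta>) / \<tau>) * emeasure lborel T + ennreal (C * \<delta> / N) * (\<integral>\<^sup>+t\<in>T. Y t \<partial>lborel)"
    by (simp add: nn_integral_add nn_integral_cmult)
  also have "\<dots> \<le> ennreal (C * (1 - \<delta>) / \<tau>) * ennreal \<tau> + ennreal (C * \<delta> / N) * ennreal N"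
    by (intro add_mono mult_left_mono \<tau> N) auto
  also have "\<dots> = ennreal (C * (1 - \<delta>) + C * \<delta>)"
    using C d \<tau> N by (simp add: ennreal_plus ennreal_mult[symmetric])
  finally show ?thesis by (simp add: C_def algebra_simps)
qed

section \<open>Arithmetic of the scaling exponents\<close>

lemma epowr_mult: "0 < a \<Longrightarrow> 0 < c \<Longrightarrow> epowr (ennreal c * x) a = ennreal (c powr a) * epowr x a"
  by (cases x) (auto simp: epowr_def ennreal_mult_top powr_mult simp flip: ennreal_mult)

lemma epowr_epowr: "0 < a \<Longrightarrow> 0 < b \<Longrightarrow> epowr (epowr x a) b = epowr x (a * b)"
  by (cases x) (auto simp: epowr_def powr_powr)

lemma powr_exp_collect:
  fixes A B D E H :: real
  assumes "c > 0" "M > 0" "N > 0"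
  shows "1 / exp A powr \<kappa> * (((c * exp B) powr \<alpha> * (M * exp D) powr \<gamma>) powr p
      * (exp E powr (1 - \<delta>) * (N * exp H) powr \<delta>))
    = (c powr \<alpha> * M powr \<gamma>) powr p * N powr \<delta>
      * exp (- (A * \<kappa>) + ((B * \<alpha> + D * \<gamma>) * p + (E * (1 - \<delta>) + H * \<delta>)))"
proof -
  have "((c * exp B) powr \<alpha> * (M * exp D) powr \<gamma>) powr p
      = (c powr \<alpha> * M powr \<gamma>) powr p * exp ((B * \<alpha> + D * \<gamma>) * p)"
    using assms by (simp add: powr_mult exp_powr_real distrib_right exp_add)
  moreover have "exp E powr (1 - \<delta>) * (N * exp H) powr \<delta> = N powr \<delta> * exp (E * (1 - \<delta>) + H * \<delta>)"
    using assms by (simp add: powr_mult exp_powr_real exp_add)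
  moreover have "1 / exp A powr \<kappa> = exp (- (A * \<kappa>))" by (simp add: exp_powr_real exp_minus inverse_eq_divide)
  ultimately show ?thesis by (simp only: exp_add mult_ac)
qed

text \<open>Writing L and F as exponentials turns the claim into linear arithmetic in ln L and ln F.
  The coefficient of ln L cancels, which reflects the scale invariance built into \<kappa>; what is
  left of F is the exponent in the growth hypothesis with opposite sign. The entries are the ball
  volume, the L_2 bound in space, the length of the time interval and the L_2 L_6 bound.\<close>

lemma scaling_exponents:
  fixes l s \<theta> \<kappa> L F c M N0 :: real
  assumes "L > 0" "F > 0" "c > 0" "M > 0" "N0 > 0" "s > 0" "l > 0"
    and \<kappa>: "\<kappa> = l * (3 / s + 2 / l - 1)"
  defines "r \<equiv> L * sqrt F"
    and "\<alpha> \<equiv> 1 - s * (1 / 2 - \<theta> / 3)" and "\<gamma> \<equiv> s * (1 - \<theta>) / 2" and "\<delta> \<equiv> \<theta> * l / 2"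
  shows "1 / r powr \<kappa> * (((c * r ^ 3) powr \<alpha> * (M * L / F\<^sup>2) powr \<gamma>) powr (l / s)
        * ((r\<^sup>2) powr (1 - \<delta>) * (N0 * L / F) powr \<delta>))
    = (c powr \<alpha> * M powr \<gamma>) powr (l / s) * N0 powr \<delta>
        * F powr (- (l / 2 * (1 + 3 / s) - 3 / 2 * (1 - s * (1 / 2 - \<theta> / 3)) * (l / s)))"
proof -
  define x y p where "x = ln L" and "y = ln F" and "p = l / s"
  have L: "L = exp x" and F: "F = exp y" using assms by (auto simp: x_def y_def)
  have sq: "sqrt F = exp (y / 2)"
  proof -
    have "(exp (y / 2))\<^sup>2 = F" unfolding F by (simp add: power2_eq_square flip: exp_add)
    then show ?thesis by (intro real_sqrt_unique) auto
  qed
  have r: "r = exp (x + y / 2)" by (simp add: r_def sq L exp_add)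
  have r3: "r ^ 3 = exp (3 * x + 3 * y / 2)" "r\<^sup>2 = exp (2 * x + y)"
    unfolding r by (simp_all add: algebra_simps flip: exp_of_nat_mult)
  have k: "\<kappa> = 3 * p + 2 - l" unfolding \<kappa> p_def using assms by (simp add: field_simps)
  have pa: "\<alpha> * p = p - l * (1 / 2 - \<theta> / 3)" "\<gamma> * p = l * (1 - \<theta>) / 2"
    unfolding \<alpha>_def \<gamma>_def p_def using assms by (simp_all add: field_simps)
  have M: "M * L / F\<^sup>2 = M * exp (x - 2 * y)"
    unfolding L F by (simp add: exp_diff exp_double)
  have N: "N0 * L / F = N0 * exp (x - y)" unfolding L F by (simp add: exp_diff)
  have "1 / r powr \<kappa> * (((c * r ^ 3) powr \<alpha> * (M * L / F\<^sup>2) powr \<gamma>) powr p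
        * ((r\<^sup>2) powr (1 - \<delta>) * (N0 * L / F) powr \<delta>))
     = (c powr \<alpha> * M powr \<gamma>) powr p * N0 powr \<delta>
       * exp (- ((x + y / 2) * \<kappa>) + (((3 * x + 3 * y / 2) * \<alpha> + (x - 2 * y) * \<gamma>) * p
          + ((2 * x + y) * (1 - \<delta>) + (x - y) * \<delta>)))"
    unfolding r3 M N unfolding r by (rule powr_exp_collect) (use assms in auto)
  also have "- ((x + y / 2) * \<kappa>) + (((3 * x + 3 * y / 2) * \<alpha> + (x - 2 * y) * \<gamma>) * p
          + ((2 * x + y) * (1 - \<delta>) + (x - y) * \<delta>))
      = - ((x + y / 2) * \<kappa>) + ((3 * x + 3 * y / 2) * (\<alpha> * p) + (x - 2 * y) * (\<gamma> * p)
          + ((2 * x + y) * (1 - \<delta>) + (x - y) * \<delta>))"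
    by (simp add: algebra_simps)
  also have "\<dots> = y * - (l / 2 + 3 / 2 * p - 3 / 2 * (\<alpha> * p))"
    unfolding pa k \<delta>_def by (simp add: field_simps)
  also have "l / 2 + 3 / 2 * p - 3 / 2 * (\<alpha> * p) = l / 2 * (1 + 3 / s) - 3 / 2 * \<alpha> * (l / s)"
    unfolding p_def using assms by (simp add: field_simps)
  finally show ?thesis unfolding p_def \<alpha>_def by (simp add: F exp_powr_real)
qed

section \<open>The scaled mixed norms\<close>

lemma integral_lebesgue_eq_lborel_AE:
  fixes h k :: "'a::euclidean_space \<Rightarrow> real"
  assumes k[measurable]: "k \<in> borel_measurable borel" and ae: "AE z in lborel. h z = k z"
  shows "integral\<^sup>L lebesgue h = integral\<^sup>L lborel k"
proof -
  have kl: "k \<in> borel_measurable lebesgue" by (rule measurable_completion) simp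
  have ae': "AE z in lebesgue. k z = h z" using ae by (auto simp: AE_completion_iff elim: eventually_mono)
  have "h \<in> borel_measurable lebesgue" by (rule borel_measurable_AE[OF kl ae'])
  then have "integral\<^sup>L lebesgue h = integral\<^sup>L lebesgue k"
    using kl ae' by (intro integral_cong_AE) (auto elim: eventually_mono)
  also have "\<dots> = integral\<^sup>L lborel k" by (rule integral_completion) simp
  finally show ?thesis .
qed

lemma ennreal_le_divide_of_mult_le:
  assumes "0 < c" "ennreal c * X \<le> ennreal M" "0 \<le> M"
  shows "X \<le> ennreal (M / c)"
proof (cases X)
  case (real x)
  then have "c * x \<le> M" using assms by (simp flip: ennreal_mult)
  then show ?thesis using real assms by (intro ennreal_leI[THEN ord_eq_le_trans[OF real(2)]]) (simp add: field_simps)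
next
  case top
  then show ?thesis using assms by (simp add: ennreal_mult_top top_unique)
qed

text \<open>The energy quantities at scale L control v in L_\<infinity> L_2 and its gradient in L_2.
  The local Sobolev inequality then gives L_2 L_6 on \<open>ball 0 (L / 8)\<close>, and F \<le> 1/64
  is what places \<open>ball 0 r\<close>, r = L sqrt(F), inside that ball. Hoelder in space and then
  in time finishes.\<close>

lemma M_mixed_bound:
  fixes f :: "real \<Rightarrow> real" and v :: "spacetime \<Rightarrow> space" and q :: "spacetime \<Rightarrow> real"
    and s l \<kappa> \<theta> L M :: real
  assumes sws: "suitable_weak_solution v q" and L: "0 < L" "L < 1" and F: "0 < f L" "f L \<le> 1 / 64"
    and M: "0 < M" and A: "A_f f v L \<le> ennreal M" and E: "E_f f v L \<le> ennreal M"
    and s: "s > 1" and l: "l > 1" and \<kappa>: "\<kappa> = l * (3 / s + 2 / l - 1)"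
    and \<theta>: "0 < \<theta>" "\<theta> \<le> 1" and sp: "s * (1 / 2 - \<theta> / 3) < 1" and lq: "\<theta> * l / 2 < 1"
  shows "M_mixed s l \<kappa> v (L * sqrt (f L)) \<le> ennreal
    ((unit_ball_vol 3 powr (1 - s * (1 / 2 - \<theta> / 3)) * M powr (s * (1 - \<theta>) / 2)) powr (l / s)
      * (2 * (432 * 512 * exp 28) * M) powr (\<theta> * l / 2)
      * f L powr (- (l / 2 * (1 + 3 / s) - 3 / 2 * (1 - s * (1 / 2 - \<theta> / 3)) * (l / s))))"
proof -
  define F where "F = f L"
  define r where "r = L * sqrt F"
  define C0 :: real where "C0 = 432 * 512 * exp 28"
  \<comment> \<open>\<open>K\<close> is the bound on the spatial L_2 integral contained in
    \<open>A_f\<close>. \<open>N\<close> below is the resulting L_2 L_6 bound, with factor 2 for two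
    equal contributions.\<close>
  define K where "K = M * L / F\<^sup>2"
  define N where "N = (2 * C0 * M) * L / F"
  define c :: real where "c = unit_ball_vol 3"
  define \<alpha> where "\<alpha> = 1 - s * (1 / 2 - \<theta> / 3)"
  define \<beta> where "\<beta> = s * \<theta> / 6"
  define \<gamma> where "\<gamma> = s * (1 - \<theta>) / 2"
  define \<delta> where "\<delta> = \<theta> * l / 2"
  let ?Q = "Qcyl 1"
  let ?T = "{- (r\<^sup>2)<..<0}"
  \<comment> \<open>Radius L but duration only r^2 = L^2 F: in the rescaled coordinates, unit radius
    and unit time.\<close>
  define P where "P = ball (0 :: space) L \<times> ?T"
  have F': "0 < F" "F \<le> 1 / 64" using F by (simp_all add: F_def)
  have sqF: "sqrt F \<le> 1 / 8"
  proof -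
    have "sqrt F \<le> sqrt ((1 / 8)\<^sup>2)" using F' by (intro real_sqrt_le_mono) (simp add: power2_eq_square)
    then show ?thesis by simp
  qed
  have r: "0 < r" "r \<le> L / 8" "r\<^sup>2 = L\<^sup>2 * F"
    using L F' sqF by (auto simp: r_def power_mult_distrib)
  have r2: "0 < r\<^sup>2" "r\<^sup>2 \<le> L\<^sup>2" "r\<^sup>2 \<le> 1"
    using r L F' by (auto simp: mult_left_le power_le_one intro: mult_le_one)
  have K: "K > 0" and N: "N > 0" and c: "c > 0" and C0: "C0 > 0"
    using M L F' by (auto simp: K_def N_def c_def C0_def)
  have PL: "P \<subseteq> Qcyl L" and PQ: "P \<subseteq> ?Q"
    using r2 L by (auto simp: P_def Qcyl_def)
  have Qm[measurable]: "Qcyl d \<in> sets borel" for d unfolding Qcyl_def by (intro borel_Times) auto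
  have Pm[measurable]: "P \<in> sets borel" unfolding P_def by (intro borel_Times) auto
  have bm[measurable]: "ball (0 :: space) d \<in> sets borel" for d by simp
  have vm: "v \<in> borel_measurable (lebesgue_on ?Q)" and Gm: "nabla v \<in> borel_measurable (lebesgue_on ?Q)"
    using sws by (auto simp: suitable_weak_solution_def mem_Linf_L2_def mem_Lp_def)
  have "\<exists>G. has_weak_gradient ?Q v G" using sws by (simp add: suitable_weak_solution_def)
  \<comment> \<open>\<open>nabla\<close> is a choice; it satisfies the weak gradient identity
    because some weak gradient exists.\<close>
  then have grad: "has_weak_gradient ?Q v (nabla v)" unfolding nabla_def by (rule someI_ex)
  obtain v' where v'm[measurable]: "v' \<in> borel_measurable borel" and v'0: "\<And>z. z \<notin> ?Q \<Longrightarrow> v' z = 0"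
    and v': "AE z in lborel. indicator ?Q z *\<^sub>R v z = v' z"
    by (rule lebesgue_on_borel_representative[OF vm Qm[of 1]]) blast
  obtain G where G'm[measurable]: "G \<in> borel_measurable borel" and G0: "\<And>z. z \<notin> ?Q \<Longrightarrow> G z = 0"
    and G: "AE z in lborel. indicator ?Q z *\<^sub>R nabla v z = G z"
    by (rule lebesgue_on_borel_representative[OF Gm Qm[of 1]]) blast
  have weak: "(\<integral>z. v' z $ i * dx j \<psi> z \<partial>lborel) = - (\<integral>z. G z $ i $ j * \<psi> z \<partial>lborel)"
    if ps: "smooth_elem \<psi>" and test: "test_function ?Q \<psi>" for \<psi> i j
  proof -
    have nth[measurable]: "(\<lambda>x :: space. x $ i) \<in> borel_measurable borel" "(\<lambda>x :: real ^ 3 ^ 3. x $ i) \<in> borel_measurable borel" for i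
      by (intro borel_measurable_continuous_onI continuous_intros)+
    have [measurable]: "\<psi> \<in> borel_measurable borel" "dx j \<psi> \<in> borel_measurable borel"
      using smooth_elem_continuous ps smooth_elem_dx[OF ps] by (auto intro: borel_measurable_continuous_onI)
    have 1: "(LINT z:?Q|lebesgue. v z $ i * dx j \<psi> z) = (\<integral>z. v' z $ i * dx j \<psi> z \<partial>lborel)"
      unfolding set_lebesgue_integral_def
      by (rule integral_lebesgue_eq_lborel_AE, measurable) (use v' in eventually_elim, auto simp: indicator_def split: if_splits)
    have 2: "(LINT z:?Q|lebesgue. nabla v z $ i $ j * \<psi> z) = (\<integral>z. G z $ i $ j * \<psi> z \<partial>lborel)"
      unfolding set_lebesgue_integral_def
      by (rule integral_lebesgue_eq_lborel_AE, measurable) (use G in eventually_elim, auto simp: indicator_def split: if_splits)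
    show ?thesis using grad test unfolding has_weak_gradient_def 1[symmetric] 2[symmetric] by blast
  qed
  \<comment> \<open>The mixed norms are defined through time slices of v, so the Borel version must
    agree with v on almost every slice, not merely almost everywhere in space-time.\<close>
  have vs: "AE t in lborel. t \<in> ?T \<longrightarrow> (AE x in lborel. x \<in> ball 0 L \<longrightarrow> v (x, t) = v' (x, t))"
    using AE_lborel_swap[OF v']
  proof eventually_elim
    case (elim t)
    show ?case
    proof
      assume t: "t \<in> ?T"
      show "AE x in lborel. x \<in> ball 0 L \<longrightarrow> v (x, t) = v' (x, t)"
        using elim
      proof eventually_elim
        case (elim x)
        show ?case
        proof
          assume "x \<in> ball 0 L"
          then have "(x, t) \<in> ?Q" using t PQ by (auto simp: P_def)
          then show "v (x, t) = v' (x, t)" using elim by simp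
        qed
      qed
    qed
  qed
  have vK: "AE t in lborel. t \<in> ?T \<longrightarrow> (\<integral>\<^sup>+x\<in>ball 0 L. ennreal (norm (v' (x, t)) ^ 2) \<partial>lborel) \<le> ennreal K"
  proof -
    have "AE t in lebesgue_on {- (L\<^sup>2)<..<0}. ennreal (F\<^sup>2 / L) *
        (\<integral>\<^sup>+ x\<in>ball 0 L. ennreal (norm (v (x, t)) ^ 2) \<partial>lebesgue) \<le> ennreal M"
      using esssup_AE by (rule eventually_mono)
        (use A in \<open>auto simp: A_f_def F_def intro: order_trans\<close>)
    then have "AE t in lborel. t \<in> {- (L\<^sup>2)<..<0} \<longrightarrow> ennreal (F\<^sup>2 / L) *
        (\<integral>\<^sup>+ x\<in>ball 0 L. ennreal (norm (v (x, t)) ^ 2) \<partial>lborel) \<le> ennreal M"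
      by (simp add: AE_restrict_space_iff AE_completion_iff nn_integral_completion)
    then show ?thesis
      using vs
    proof eventually_elim
      case (elim t)
      show ?case
      proof
        assume t: "t \<in> ?T"
        then have t': "t \<in> {- (L\<^sup>2)<..<0}" using r2 by auto
        have "(\<integral>\<^sup>+x\<in>ball 0 L. ennreal (norm (v' (x, t)) ^ 2) \<partial>lborel)
            = (\<integral>\<^sup>+x\<in>ball 0 L. ennreal (norm (v (x, t)) ^ 2) \<partial>lborel)"
        proof (rule nn_integral_cong_AE)
          show "AE x in lborel. ennreal (norm (v' (x, t)) ^ 2) * indicator (ball 0 L) x
              = ennreal (norm (v (x, t)) ^ 2) * indicator (ball 0 L) x"
            using elim(2)[rule_format, OF t] by eventually_elim (auto simp: indicator_def)
        qed
        also have "\<dots> \<le> ennreal (M / (F\<^sup>2 / L))"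
          by (rule ennreal_le_divide_of_mult_le) (use elim(1) t' M L F' in auto)
        finally show "(\<integral>\<^sup>+x\<in>ball 0 L. ennreal (norm (v' (x, t)) ^ 2) \<partial>lborel) \<le> ennreal K"
          by (simp add: K_def)
      qed
    qed
  qed
  have GA: "(\<integral>\<^sup>+z\<in>P. ennreal (norm (G z) ^ 2) \<partial>lborel) \<le> ennreal (M * L / F)"
  proof -
    have "(\<integral>\<^sup>+z\<in>P. ennreal (norm (G z) ^ 2) \<partial>lborel) \<le> (\<integral>\<^sup>+z\<in>Qcyl L. ennreal (norm (nabla v z) ^ 2) \<partial>lborel)"
    proof (rule nn_integral_mono_AE, use G in eventually_elim)
      case (elim z)
      then show ?case using PL PQ by (auto simp: indicator_def split: if_splits)
    qed
    also have "\<dots> \<le> ennreal (M / (F / L))"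
      by (rule ennreal_le_divide_of_mult_le) (use E M L F' in \<open>auto simp: E_f_def F_def nn_integral_completion\<close>)
    finally show ?thesis by simp
  qed
  have vB: "(\<integral>\<^sup>+z\<in>P. ennreal (norm (v' z) ^ 2) \<partial>lborel) \<le> ennreal (K * r\<^sup>2)"
  proof -
    have "(\<integral>\<^sup>+z\<in>P. ennreal (norm (v' z) ^ 2) \<partial>lborel)
        = (\<integral>\<^sup>+t. \<integral>\<^sup>+x. ennreal (norm (v' (x, t)) ^ 2) * indicator P (x, t) \<partial>lborel \<partial>lborel)"
      unfolding lborel_prod[symmetric] by (rule lborel_pair.nn_integral_snd[symmetric]) (simp add: lborel_prod)
    also have "\<dots> \<le> (\<integral>\<^sup>+t. ennreal K * indicator ?T t \<partial>lborel)"
    proof (rule nn_integral_mono_AE, use vK in eventually_elim)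
      case (elim t)
      have "(\<lambda>x. ennreal (norm (v' (x, t)) ^ 2) * indicator P (x, t))
          = (\<lambda>x. ennreal (norm (v' (x, t)) ^ 2) * indicator (ball 0 L) x * indicator ?T t)"
        by (auto simp: P_def indicator_def fun_eq_iff)
      then show ?case using elim by (cases "t \<in> ?T") auto
    qed
    also have "\<dots> = ennreal (K * r\<^sup>2)"
      using K r2 by (simp add: nn_integral_cmult_indicator ennreal_mult)
    finally show ?thesis .
  qed
  define Y where "Y t = epowr (\<integral>\<^sup>+x\<in>ball 0 (L / 8). ennreal (norm (v' (x, t)) ^ 6) \<partial>lborel) (1 / 3)" for t
  have [measurable]: "Y \<in> borel_measurable borel" unfolding Y_def by measurable
  have YN: "(\<integral>\<^sup>+t\<in>?T. Y t \<partial>lborel) \<le> ennreal N"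
  proof -
    have "(\<integral>\<^sup>+t\<in>?T. Y t \<partial>lborel) \<le> ennreal C0 * ((\<integral>\<^sup>+z\<in>P. ennreal (norm (G z) ^ 2) \<partial>lborel)
        + ennreal (1 / L\<^sup>2) * (\<integral>\<^sup>+z\<in>P. ennreal (norm (v' z) ^ 2) \<partial>lborel))"
      unfolding Y_def C0_def P_def
    proof (rule local_Sobolev_vec[OF v'm G'm L(1) r2(1) PQ[unfolded P_def] _ _ weak])
      show "(\<integral>\<^sup>+z\<in>ball 0 L \<times> ?T. ennreal (norm (v' z) ^ 2) \<partial>lborel) < \<infinity>"
        "(\<integral>\<^sup>+z\<in>ball 0 L \<times> ?T. ennreal (norm (G z) ^ 2) \<partial>lborel) < \<infinity>"
        using le_less_trans[OF vB] le_less_trans[OF GA] unfolding P_def by simp_all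
    qed
    also have "\<dots> \<le> ennreal C0 * (ennreal (M * L / F) + ennreal (1 / L\<^sup>2) * ennreal (K * r\<^sup>2))"
      by (intro mult_left_mono add_mono GA vB) auto
    also have "\<dots> = ennreal (C0 * (M * L / F + 1 / L\<^sup>2 * (K * r\<^sup>2)))"
      using C0 M L F' K by (simp flip: ennreal_mult ennreal_plus)
    \<comment> \<open>Here the short duration pays off: the cutoff contribution equals the gradient
      bound.\<close>
    also have "1 / L\<^sup>2 * (K * r\<^sup>2) = M * L / F"
      unfolding r(3) K_def using L F' by (simp add: field_simps power2_eq_square)
    finally show ?thesis by (simp add: N_def algebra_simps)
  qed
  define m where "m = c * r ^ 3"
  have m: "m > 0" "emeasure lborel (ball (0 :: space) r) \<le> ennreal m"
    using r c emeasure_ball[of r "0 :: space"] by (auto simp: m_def c_def)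
  \<comment> \<open>These are the Hoelder weights: \<alpha> = 1 - s/p(\<eta>) for the volume, the
    others from 1/p(\<eta>) = \<theta>/6 + (1 - \<theta>)/2.\<close>
  have e: "0 \<le> \<alpha>" "0 < \<beta>" "0 \<le> \<gamma>" "\<alpha> + \<beta> + \<gamma> = 1" "s = 6 * \<beta> + 2 * \<gamma>"
    using s \<theta> sp by (auto simp: \<alpha>_def \<beta>_def \<gamma>_def field_simps)
  have d: "0 < \<delta>" "\<delta> < 1" using \<theta> l lq by (auto simp: \<delta>_def)
  define c1 where "c1 = m powr \<alpha> * K powr \<gamma>"
  have c1: "c1 > 0" using m K by (simp add: c1_def)
  have ls: "0 < l / s" using l s by simp
  have inner: "AE t in lborel. t \<in> ?T \<longrightarrow>
      epowr (\<integral>\<^sup>+ x\<in>ball 0 r. ennreal (norm (v (x, t)) powr s) \<partial>lebesgue) (l / s)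
      \<le> ennreal (c1 powr (l / s)) * epowr (Y t) \<delta>"
    using vs vK
  proof eventually_elim
    case (elim t)
    show ?case
    proof
      assume t: "t \<in> ?T"
      have "(\<integral>\<^sup>+ x\<in>ball 0 r. ennreal (norm (v (x, t)) powr s) \<partial>lebesgue)
          = (\<integral>\<^sup>+ x\<in>ball 0 r. ennreal (norm (v (x, t)) powr s) \<partial>lborel)"
        by (rule nn_integral_completion)
      also have "\<dots> = (\<integral>\<^sup>+ x\<in>ball 0 r. ennreal (norm (v' (x, t)) powr s) \<partial>lborel)"
      proof (rule nn_integral_cong_AE)
        show "AE x in lborel. ennreal (norm (v (x, t)) powr s) * indicator (ball 0 r) x
            = ennreal (norm (v' (x, t)) powr s) * indicator (ball 0 r) x"
          using elim(1)[rule_format, OF t] by eventually_elim (use r L in \<open>auto simp: indicator_def\<close>)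
      qed
      also have "\<dots> \<le> ennreal c1 * epowr (\<integral>\<^sup>+x\<in>ball 0 r. ennreal (norm (v' (x, t)) ^ 6) \<partial>lborel) \<beta>"
        unfolding c1_def
      proof (rule nn_integral_powr_interpolation[OF _ _ _ m K _ e])
        have "(\<integral>\<^sup>+x\<in>ball 0 r. ennreal (norm (v' (x, t)) ^ 2) \<partial>lborel)
            \<le> (\<integral>\<^sup>+x\<in>ball 0 L. ennreal (norm (v' (x, t)) ^ 2) \<partial>lborel)"
          using r L by (intro nn_integral_mono) (auto simp: indicator_def)
        then show "(\<integral>\<^sup>+x\<in>ball 0 r. ennreal (norm (v' (x, t)) ^ 2) \<partial>lborel) \<le> ennreal K"
          using elim(2) t by (blast intro: order_trans)
      qed auto
      also have "\<dots> \<le> ennreal c1 * epowr (\<integral>\<^sup>+x\<in>ball 0 (L / 8). ennreal (norm (v' (x, t)) ^ 6) \<partial>lborel) \<beta>"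
        using r e by (intro mult_left_mono epowr_mono nn_integral_mono) (auto simp: indicator_def)
      finally have "epowr (\<integral>\<^sup>+ x\<in>ball 0 r. ennreal (norm (v (x, t)) powr s) \<partial>lebesgue) (l / s)
          \<le> epowr (ennreal c1 * epowr (\<integral>\<^sup>+x\<in>ball 0 (L / 8). ennreal (norm (v' (x, t)) ^ 6) \<partial>lborel) \<beta>) (l / s)"
        using ls by (intro epowr_mono) auto
      also have "\<dots> = ennreal (c1 powr (l / s))
          * epowr (\<integral>\<^sup>+x\<in>ball 0 (L / 8). ennreal (norm (v' (x, t)) ^ 6) \<partial>lborel) (\<beta> * (l / s))"
        using c1 ls e by (simp add: epowr_mult epowr_epowr)
      \<comment> \<open>The L_6 integral carries the power \<theta> l / 6, a third of \<delta>;
        since \<open>Y\<close> is already a cube root, it appears to the power \<delta>.\<close>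
      also have "\<beta> * (l / s) = 1 / 3 * \<delta>" using s by (simp add: \<beta>_def \<delta>_def)
      also have "epowr (\<integral>\<^sup>+x\<in>ball 0 (L / 8). ennreal (norm (v' (x, t)) ^ 6) \<partial>lborel) (1 / 3 * \<delta>) = epowr (Y t) \<delta>"
        unfolding Y_def using d by (intro epowr_epowr[symmetric]) auto
      finally show "epowr (\<integral>\<^sup>+ x\<in>ball 0 r. ennreal (norm (v (x, t)) powr s) \<partial>lebesgue) (l / s)
          \<le> ennreal (c1 powr (l / s)) * epowr (Y t) \<delta>" .
    qed
  qed
  have "M_mixed s l \<kappa> v r = ennreal (1 / r powr \<kappa>) *
     (\<integral>\<^sup>+ t\<in>?T. epowr (\<integral>\<^sup>+ x\<in>ball 0 r. ennreal (norm (v (x, t)) powr s) \<partial>lebesgue) (l / s) \<partial>lborel)"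
    unfolding M_mixed_def by (subst nn_integral_completion) (rule refl)
  also have "\<dots> \<le> ennreal (1 / r powr \<kappa>) *
     (\<integral>\<^sup>+ t. ennreal (c1 powr (l / s)) * (epowr (Y t) \<delta> * indicator ?T t) \<partial>lborel)"
  proof (intro mult_left_mono nn_integral_mono_AE)
    show "AE t in lborel. epowr (\<integral>\<^sup>+ x\<in>ball 0 r. ennreal (norm (v (x, t)) powr s) \<partial>lebesgue) (l / s) * indicator ?T t
        \<le> ennreal (c1 powr (l / s)) * (epowr (Y t) \<delta> * indicator ?T t)"
      using inner by eventually_elim (auto simp: indicator_def)
  qed auto
  also have "\<dots> = ennreal (1 / r powr \<kappa>) * (ennreal (c1 powr (l / s)) * (\<integral>\<^sup>+ t\<in>?T. epowr (Y t) \<delta> \<partial>lborel))"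
    by (subst nn_integral_cmult) auto
  also have "\<dots> \<le> ennreal (1 / r powr \<kappa>) * (ennreal (c1 powr (l / s)) * ennreal ((r\<^sup>2) powr (1 - \<delta>) * N powr \<delta>))"
    by (intro mult_left_mono nn_integral_epowr_le N YN d r2) (use r2 in auto)
  also have "\<dots> = ennreal (1 / r powr \<kappa> * (c1 powr (l / s) * ((r\<^sup>2) powr (1 - \<delta>) * N powr \<delta>)))"
    by (simp flip: ennreal_mult)
  also have "1 / r powr \<kappa> * (c1 powr (l / s) * ((r\<^sup>2) powr (1 - \<delta>) * N powr \<delta>))
    = (c powr \<alpha> * M powr \<gamma>) powr (l / s) * (2 * C0 * M) powr \<delta>
        * F powr (- (l / 2 * (1 + 3 / s) - 3 / 2 * (1 - s * (1 / 2 - \<theta> / 3)) * (l / s)))"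
    unfolding c1_def m_def K_def N_def r_def \<alpha>_def \<gamma>_def \<delta>_def
    using L F' c M C0 s l \<kappa> by (intro scaling_exponents) auto
  finally show ?thesis
    by (simp only: r_def F_def c_def C0_def \<alpha>_def \<gamma>_def \<delta>_def)
qed

section \<open>From the quantitative bound to the limit\<close>

theorem theorem2p1:
  fixes f g :: "real \<Rightarrow> real"
    and v :: "spacetime \<Rightarrow> space" and q :: "spacetime \<Rightarrow> real"
    and s l \<kappa> \<eta> :: real
  assumes f_range: "\<And>r. r \<in> {0<..1} \<Longrightarrow> f r \<in> {0<..1}"
    and f_mono: "mono_on {0<..1} f"
    and f_cont: "continuous_on {0<..1} f"
    and f_lim: "(f \<longlongrightarrow> 0) (at_right 0)"
    and f_one: "f 1 = 1"
    and f_ratio: "\<And>a. 0 < a \<Longrightarrow> Liminf (at_right 0) (\<lambda>\<rho>. ereal (f (\<rho> * a) / f \<rho>)) > 0"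
    and g_pos: "\<And>r. r \<in> {0<..<1} \<Longrightarrow> g r > 0"
    and sws: "suitable_weak_solution v q"
    and M1_finite: "(SUP r\<in>{0<..<1}. A_f f v r + E_f f v r + D_f f q r) < \<infinity>"
    and s_gt: "s > 1" and l_gt: "l > 1"
    and kappa: "\<kappa> = l * (3 / s + 2 / l - 1)" and "l > \<kappa>" and "\<kappa> > 0"
    and eta: "0 \<le> \<eta>" "\<eta> \<le> 1"
    and s_less: "s < p_exp \<eta>" and l_less: "l < q_exp \<eta>"
    and growth: "filterlim
      (\<lambda>\<rho>. f \<rho> powr (l / 2 * (1 + 3 / s) - 3 / 2 * (1 - s / p_exp \<eta>) * (l / s))
            * inverse (g (\<rho> * sqrt (f \<rho>))))
      at_top (at_right 0)"
  shows "((\<lambda>r. ennreal (g r) * M_mixed s l \<kappa> v r) \<longlongrightarrow> 0) (at_right 0)"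
proof -
  \<comment> \<open>Interpolation parameter between L_\<infinity> L_2 (\<theta> = 0) and L_2 L_6
    (\<theta> = 1). The value \<eta> = 0 corresponds to \<theta> = 3/5, where both exponents are
    10/3.\<close>
  define \<theta> where "\<theta> = \<eta> + 3 * (1 - \<eta>) / 5"
  have \<theta>: "0 < \<theta>" "\<theta> \<le> 1" using eta by (auto simp: \<theta>_def field_simps)
  have p: "1 / p_exp \<eta> = 1 / 2 - \<theta> / 3" "p_exp \<eta> > 0" and q: "1 / q_exp \<eta> = \<theta> / 2" "q_exp \<eta> > 0"
    using eta by (auto simp: p_exp_def q_exp_def \<theta>_def field_simps)
  have sp: "s / p_exp \<eta> = s * (1 / 2 - \<theta> / 3)" by (simp flip: p(1))
  have sp1: "s * (1 / 2 - \<theta> / 3) < 1" using s_less p(2) unfolding sp[symmetric] by simp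
  have lq1: "\<theta> * l / 2 < 1"
  proof -
    have "l * (1 / q_exp \<eta>) < 1" using l_less q(2) by simp
    then show ?thesis unfolding q(1) by (simp add: mult.commute)
  qed
  define e where "e = l / 2 * (1 + 3 / s) - 3 / 2 * (1 - s * (1 / 2 - \<theta> / 3)) * (l / s)"
  define S where "S = (SUP r\<in>{0<..<1}. A_f f v r + E_f f v r + D_f f q r)"
  \<comment> \<open>The \<open>+ 1\<close> keeps M positive even if the supremum is 0, as the bound
    requires.\<close>
  define M where "M = enn2real S + 1"
  have M: "M > 0" by (simp add: M_def add_nonneg_pos)
  have SM: "S \<le> ennreal M"
    using M1_finite unfolding S_def[symmetric] M_def by (cases S) (auto intro: ennreal_leI)
  have AE: "A_f f v L \<le> ennreal M" "E_f f v L \<le> ennreal M" if "L \<in> {0<..<1}" for L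
  proof -
    have "A_f f v L + E_f f v L + D_f f q L \<le> S" unfolding S_def using that by (rule SUP_upper)
    then have "A_f f v L + E_f f v L + D_f f q L \<le> ennreal M" using SM by (rule order_trans)
    moreover have "A_f f v L + 0 + 0 \<le> A_f f v L + E_f f v L + D_f f q L"
      "0 + E_f f v L + 0 \<le> A_f f v L + E_f f v L + D_f f q L"
      by (intro add_mono; simp)+
    ultimately show "A_f f v L \<le> ennreal M" "E_f f v L \<le> ennreal M"
      unfolding add_0 add_0_right by (blast intro: order_trans)+
  qed
  define C where "C = (unit_ball_vol 3 powr (1 - s * (1 / 2 - \<theta> / 3)) * M powr (s * (1 - \<theta>) / 2)) powr (l / s)
      * (2 * (432 * 512 * exp 28) * M) powr (\<theta> * l / 2)"
  have C: "C \<ge> 0" by (simp add: C_def)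
  define h where "h \<rho> = \<rho> * sqrt (f \<rho>)" for \<rho>
  show ?thesis
  proof (rule order_tendstoI)
    fix b :: ennreal
    assume "0 < b"
    then obtain \<epsilon> where \<epsilon>: "\<epsilon> > 0" "ennreal \<epsilon> < b"
    proof -
      obtain x where x: "0 < x" "x < b" using dense[OF \<open>0 < b\<close>] by auto
      then obtain x' where "x = ennreal x'" "0 < x'"
        by (cases x) (auto simp: top_unique dest: less_imp_le)
      then show thesis using that[of x'] x by auto
    qed
    have "\<forall>\<^sub>F \<rho> in at_right 0. (C + 1) / \<epsilon> \<le> f \<rho> powr e * inverse (g (h \<rho>))"
      using growth unfolding filterlim_at_top e_def h_def sp[symmetric] by blast
    moreover have "\<forall>\<^sub>F \<rho> in at_right 0. f \<rho> < 1 / 64"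
      using f_lim by (rule order_tendstoD) simp
    ultimately have "\<forall>\<^sub>F \<rho> in at_right 0. (C + 1) / \<epsilon> \<le> f \<rho> powr e * inverse (g (h \<rho>)) \<and> f \<rho> < 1 / 64"
      by (rule eventually_conj)
    then obtain \<rho>1 where \<rho>1: "\<rho>1 > 0"
      "\<And>\<rho>. 0 < \<rho> \<Longrightarrow> \<rho> < \<rho>1 \<Longrightarrow> (C + 1) / \<epsilon> \<le> f \<rho> powr e * inverse (g (h \<rho>)) \<and> f \<rho> < 1 / 64"
      unfolding eventually_at_right_field by auto
    define \<rho>0 where "\<rho>0 = min \<rho>1 1 / 2"
    have \<rho>0: "0 < \<rho>0" "\<rho>0 < 1" "\<rho>0 < \<rho>1" using \<rho>1(1) by (auto simp: \<rho>0_def)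
    have fp: "0 < f \<rho>" "f \<rho> \<le> 1" if "0 < \<rho>" "\<rho> \<le> 1" for \<rho> using f_range[of \<rho>] that by auto
    have h0: "h \<rho>0 > 0" using \<rho>0 fp[of \<rho>0] by (simp add: h_def)
    have main: "ennreal (g r) * M_mixed s l \<kappa> v r < b" if r: "0 < r" "r < h \<rho>0" for r
    proof -
      have hle: "h \<rho> \<le> \<rho>" if "0 < \<rho>" "\<rho> \<le> 1" for \<rho>
        using fp[OF that] that by (simp add: h_def mult_left_le)
      have rl: "r < \<rho>0" using r hle[of \<rho>0] \<rho>0 by simp
      \<comment> \<open>Every small r is a value of h: continuity of f makes h continuous, and h r
        \<le> r < h \<rho>0 brackets r, so the intermediate value theorem gives L in [r, \<rho>0]
        with h L = r. The growth condition is then used at L, where its argument of g is exactly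
        r.\<close>
      have "continuous_on {r..\<rho>0} h"
        unfolding h_def using r \<rho>0
        by (intro continuous_intros continuous_on_subset[OF f_cont]) auto
      moreover have "h r \<le> r" using r rl \<rho>0 by (intro hle) auto
      ultimately obtain L where L: "r \<le> L" "L \<le> \<rho>0" "h L = r"
        using IVT'[of h r r \<rho>0] r rl by auto
      have L1: "0 < L" "L < 1" "L < \<rho>1" using L r \<rho>0 by auto
      have fL: "0 < f L" "f L \<le> 1 / 64" "(C + 1) / \<epsilon> \<le> f L powr e * inverse (g r)"
        using fp[of L] \<rho>1(2)[of L] L1 L(3) by auto
      have gr: "g r > 0" using g_pos[of r] r rl \<rho>0 by auto
      have "M_mixed s l \<kappa> v r \<le> ennreal (C * f L powr (- e))"
        using M_mixed_bound[OF sws L1(1,2) fL(1,2) M AE s_gt l_gt kappa \<theta> sp1 lq1] L1 L(3)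
        by (simp add: C_def e_def h_def)
      then have "ennreal (g r) * M_mixed s l \<kappa> v r \<le> ennreal (g r) * ennreal (C * f L powr (- e))"
        by (intro mult_left_mono) auto
      also have "\<dots> = ennreal (g r * (C * f L powr (- e)))" using gr C by (simp add: ennreal_mult)
      also have "\<dots> \<le> ennreal \<epsilon>"
      proof (rule ennreal_leI)
        have P: "f L powr e > 0" using fL by simp
        have "(C + 1) * g r \<le> \<epsilon> * f L powr e"
          using fL(3) \<epsilon> gr by (simp add: field_simps)
        then have "C * g r \<le> \<epsilon> * f L powr e" using gr by (simp add: distrib_right)
        then show "g r * (C * f L powr (- e)) \<le> \<epsilon>"
          using P by (simp add: powr_minus field_simps)
      qed
      also note \<epsilon>(2)
      finally show ?thesis .
    qed
    show "\<forall>\<^sub>F r in at_right 0. ennreal (g r) * M_mixed s l \<kappa> v r < b"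
      unfolding eventually_at_right_field using h0 main by blast
  qed simp
qed

end
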